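(* Let $0<\alpha<d$, $1<q<p<\infty$ and let $v$ be a weight on $\mathbb{R}^d$. Let $\frac1r=\frac1q-\frac1p$ and let $\theta_1,\theta_2>1$ satisfy $$\frac1q=\frac1{\theta_2 p}+\frac{\theta_1}{r}.$$ Suppose that $\|v\|_{L^{\theta_1}(dx)}^{\theta_1/r}<\infty$. Suppose moreover that one of the following two conditions (a), (b) is satisfied. (a) $v\in A_\infty$, $$\sup_{Q\in\mathcal{Q}:\,\ell_Q\le 1}\ell_Q^{\alpha}\left(\frac{v(Q)}{|Q|}\right)^{\frac1{\theta_2 p}}<\infty\quad\text{and}\quad\lim_{\lambda\to\infty}\ \sup_{Q\in\mathcal{Q}:\,\ell_Q\le 1/\lambda}\ell_Q^{\alpha}\left(\frac{v(Q)}{|Q|}\right)^{\frac1{\theta_2 p}}=0.$$ (b) For some $\theta$ with $1<\theta<\theta_1$, $$\sup_{Q\in\mathcal{Q}:\,\ell_Q\le 1}\ell_Q^{\alpha}\left(\frac{v^\theta(Q)}{|Q|}\right)^{\frac1{\theta\theta_2 p}}<\infty\quad\text{and}\quad\lim_{\lambda\to\infty}\ \sup_{Q\in\mathcal{Q}:\,\ell_Q\le 1/\lambda}\ell_Q^{\alpha}\left(\frac{v^\theta(Q)}{|Q|}\right)^{\frac1{\theta\theta_2 p}}=0.$$ Then there is a finite constant $c$, independent of $\varepsilon$ and $\varphi$, such that for any $\varepsilon>0$ there exists $C(\varepsilon)>0$ such that, for any $\varphi\in C_c^\infty(\mathbb{R}^d)$, $$\|\varphi\|_{L^q(v)}\le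 c\left(\varepsilon\,\|(-\Delta)^{\alpha/2}\varphi\|_{L^p(dx)}+C(\varepsilon)\,\|\varphi\|_{L^p(dx)}\right).$$
   Context: $\mathcal{Q}=\mathcal{Q}(\mathbb{R}^d)$ is the family of all cubes in $\mathbb{R}^d$ with sides parallel to the axes; $\ell_Q$ is the side length and $|Q|$ the volume of $Q$. A weight is a nonnegative locally integrable function $v$ on $\mathbb{R}^d$; $v(Q)=\int_Q v\,dx$, $v^\theta(Q)=\int_Q v^\theta\,dx$, $\|\varphi\|_{L^q(v)}=(\int_{\mathbb{R}^d}|\varphi|^q v\,dx)^{1/q}$. For $1<s<\infty$, $$[w]_{A_s}=\sup_{Q\in\mathcal{Q}}\left(\frac1{|Q|}\int_Q w\,dx\right)\left(\frac1{|Q|}\int_Q w^{-\frac1{s-1}}\,dx\right)^{s-1},$$ and $w\in A_\infty$ means $[w]_{A_\infty}:=\lim_{s\to\infty}[w]_{A_s}<\infty$ (in particular $w\in A_s$ for some $1<s<\infty$). With the Fourier transform $\hat f(\xi)=\int_{\mathbb{R}^d}f(x)e^{-2\pi i x\cdot\xi}\,dx$, the operator $(-\Delta)^{\alpha/2}$ is the Fourier multiplier operator with symbol $(2\pi|\xi|)^\alpha$. *)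

theory Defs
  imports "HOL-Analysis.Analysis"
begin

text \<open>
  Weights and test functions live on \<^typ>\<open>real^'d\<close>, so the dimension is \<open>CARD('d)\<close>.
  Integrals of nonnegative functions are taken in \<^typ>\<open>ennreal\<close>, so that suprema and norms
  are genuinely infinite when they diverge.
\<close>

text \<open>
  Real powers on \<open>[0,\<infinity>]\<close>.  The real \<^const>\<open>powr\<close> satisfies \<open>0 powr a = 0\<close> for every \<open>a\<close>;
  here \<open>0\<close> to a negative power is \<open>\<infinity>\<close>, which matters for \<open>w\<close> to the power \<open>-1/(s-1)\<close>
  in the Muckenhoupt constants.
\<close>

definition epowr :: "ennreal \<Rightarrow> real \<Rightarrow> ennreal" where
  "epowr x a =
    (if a = 0 then 1
     else if x = 0 then (if a < 0 then \<infinity> else 0)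
     else if x = \<infinity> then (if a < 0 then 0 else \<infinity>)
     else ennreal (enn2real x powr a))"

definition weight :: "(real^'d \<Rightarrow> real) \<Rightarrow> bool" where
  "weight v \<longleftrightarrow> (\<forall>x. 0 \<le> v x) \<and> (\<forall>K. compact K \<longrightarrow> v absolutely_integrable_on K)"

definition cube :: "real^'d \<Rightarrow> real \<Rightarrow> (real^'d) set" where
  "cube a l = cbox a (a + (\<chi> i. l))"

definition average :: "(real^'d) set \<Rightarrow> (real^'d \<Rightarrow> ennreal) \<Rightarrow> ennreal" where
  "average Q g = (\<integral>\<^sup>+x\<in>Q. g x \<partial>lebesgue) / emeasure lebesgue Q"

text \<open>
  The product below uses the \<^typ>\<open>ennreal\<close> convention \<open>0 * \<infinity> = 0\<close>; it is only relevant to the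
  weight that vanishes almost everywhere, since any other weight vanishing on a set of
  positive measure has a cube on which the product is \<open>\<infinity>\<close>.
\<close>

definition Muckenhoupt_const :: "real \<Rightarrow> (real^'d \<Rightarrow> real) \<Rightarrow> ennreal" where
  "Muckenhoupt_const s w =
    (SUP a. SUP l\<in>{0<..}.
       average (cube a l) (\<lambda>x. ennreal (w x)) *
       epowr (average (cube a l) (\<lambda>x. epowr (ennreal (w x)) (- 1 / (s - 1)))) (s - 1))"

definition A_infinity :: "(real^'d \<Rightarrow> real) \<Rightarrow> bool" where
  "A_infinity w \<longleftrightarrow> weight w \<and>
    (\<exists>L. L < \<infinity> \<and> ((\<lambda>s. Muckenhoupt_const s w) \<longlongrightarrow> L) at_top)"

definition small_cube_sup :: "real \<Rightarrow> real \<Rightarrow> (real^'d \<Rightarrow> real) \<Rightarrow> real \<Rightarrow> ennreal" where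
  "small_cube_sup \<alpha> b g \<delta> =
    (SUP a. SUP l\<in>{0<..\<delta>}.
       ennreal (l powr \<alpha>) * epowr (average (cube a l) (\<lambda>x. ennreal (g x))) b)"

definition weighted_Lnorm ::
    "real \<Rightarrow> (real^'d \<Rightarrow> real) \<Rightarrow> (real^'d \<Rightarrow> 'b::real_normed_vector) \<Rightarrow> ennreal" where
  "weighted_Lnorm q v f = epowr (\<integral>\<^sup>+x. ennreal (norm (f x) powr q * v x) \<partial>lebesgue) (1 / q)"

abbreviation Lnorm :: "real \<Rightarrow> (real^'d \<Rightarrow> 'b::real_normed_vector) \<Rightarrow> ennreal" where
  "Lnorm p f \<equiv> weighted_Lnorm p (\<lambda>_. 1) f"

text \<open>
  \<open>C_diff k\<close> is the class \<open>C\<^sup>k\<close>, by recursion on first-order partial derivatives.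
\<close>

primrec C_diff :: "nat \<Rightarrow> (real^'d \<Rightarrow> complex) \<Rightarrow> bool" where
  "C_diff 0 f \<longleftrightarrow> continuous_on UNIV f"
| "C_diff (Suc k) f \<longleftrightarrow> (\<forall>x. f differentiable (at x)) \<and>
     (\<forall>i. C_diff k (\<lambda>x. frechet_derivative f (at x) (axis i 1)))"

definition test_function :: "(real^'d \<Rightarrow> complex) \<Rightarrow> bool" where
  "test_function f \<longleftrightarrow> (\<forall>k. C_diff k f) \<and> compact (closure {x. f x \<noteq> 0})"

definition fourier :: "(real^'d \<Rightarrow> complex) \<Rightarrow> real^'d \<Rightarrow> complex" where
  "fourier f \<xi> = (\<integral>x. f x * exp (- 2 * of_real pi * \<i> * of_real (x \<bullet> \<xi>)) \<partial>lebesgue)"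

definition inverse_fourier :: "(real^'d \<Rightarrow> complex) \<Rightarrow> real^'d \<Rightarrow> complex" where
  "inverse_fourier g x = (\<integral>\<xi>. g \<xi> * exp (2 * of_real pi * \<i> * of_real (x \<bullet> \<xi>)) \<partial>lebesgue)"

text \<open>
  For a test function \<open>f\<close> and \<open>\<alpha> > 0\<close> the function under the inverse transform is continuous
  and rapidly decreasing, so the inversion integral converges absolutely.
\<close>

definition frac_laplacian :: "real \<Rightarrow> (real^'d \<Rightarrow> complex) \<Rightarrow> real^'d \<Rightarrow> complex" where
  "frac_laplacian \<alpha> f =
    inverse_fourier (\<lambda>\<xi>. of_real ((2 * pi * norm \<xi>) powr \<alpha>) * fourier f \<xi>)"

end

theory Submission
  imports Defs "HOL-Probability.Probability"
begin

text \<open>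
  Let \<open>a = \<theta>2 * p > p\<close>.  Hoelder's inequality bounds the norm of \<open>\<phi>\<close> in \<open>L\<^sup>q(v)\<close> by a constant times its
  norm in \<open>L\<^sup>p\<close> with weight \<open>v powr (p / a)\<close>, and by Jensen condition (b) implies the cube conditions
  of (a).  Truncating the subordination formula for \<open>|\<xi>| powr (- \<alpha>)\<close> by a finite difference of order
  \<open>m\<close> in time represents \<open>\<phi>\<close> by heat averages of \<open>\<phi>\<close> at the times \<open>\<tau>, \<dots>, m * \<tau>\<close> and a potential of its
  fractional Laplacian that is essentially localised to times below \<open>\<tau>\<close>.  There the cube condition
  with constant \<open>M\<close> at scales below \<open>sqrt \<tau>\<close> yields a trace inequality with constant \<open>O(M)\<close>, by a
  Schur test whose test functions are powers of a Riesz potential of \<open>v\<close> of small order; the gap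
  \<open>p < a\<close> provides the room in the exponents.
\<close>

section \<open>Powers in the extended nonnegative reals and Hoelder inequalities\<close>

text \<open>The factor in front of \<epsilon> must be uniform in \<epsilon>, so the trace inequality
  has to depend on M exactly through M^p. Then M = \<epsilon> is reached by shrinking the cubes, and
  the resulting scale \<delta> enters only C(\<epsilon>). The exact dependence comes from scaling:
  once v is divided by the bound of its heat average at time \<tau> = \<delta>^2, the Schur test
  sees neither M nor \<tau>, and undoing the normalisation cancels every power of \<tau>. Cutting
  the subordination integral sharply at \<tau> would leave a remainder that is not a finite
  combination of heat averages of \<phi>. The difference of order m produces (1 - e^(\<tau>
  Laplacian))^m instead: its terms after the identity are Gaussian averages, while the density
  decays like s^(\<alpha>/2 - 1 - m) at infinity. The exponents of the Schur test follow a count of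
  degrees in Y = 2^\<alpha>, one power of Y per division of the time by four: u has degree a, F has
  degree a - \<sigma>, and the truncated potential T lowers the degree by one.\<close>

lemma epowr_0 [simp]: "a > 0 \<Longrightarrow> epowr 0 a = 0"
  by (simp add: epowr_def)

lemma epowr_one [simp]: "epowr 1 a = 1"
  by (simp add: epowr_def)

lemma epowr_exp_one [simp]: "epowr x 1 = x"
  by (cases x) (auto simp: epowr_def ennreal_top_neq_one)

lemma epowr_top [simp]: "a > 0 \<Longrightarrow> epowr \<top> a = \<top>"
  by (simp add: epowr_def)

lemma epowr_ennreal: "0 \<le> x \<Longrightarrow> 0 < a \<Longrightarrow> epowr (ennreal x) a = ennreal (x powr a)"
  by (auto simp: epowr_def)

lemma epowr_ennreal_pos: "0 < x \<Longrightarrow> epowr (ennreal x) a = ennreal (x powr a)"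
  by (auto simp: epowr_def)

lemma epowr_mono:
  assumes "x \<le> y" "0 < a" shows "epowr x a \<le> epowr y a"
proof (cases y)
  case (real b)
  then obtain c where "x = ennreal c" "0 \<le> c" "c \<le> b"
    using assms(1) by (metis ennreal_cases ennreal_le_iff leD ennreal_less_top)
  with real assms(2) show ?thesis
    by (auto simp: epowr_ennreal intro!: ennreal_leI powr_mono2)
qed (use assms in simp)

lemma epowr_mult:
  assumes "0 < a" shows "epowr (x * y) a = epowr x a * epowr y a"
proof -
  consider "x = 0" | "y = 0" | "x = \<top>" "y \<noteq> 0" | "y = \<top>" "x \<noteq> 0"
    | c d where "x = ennreal c" "y = ennreal d" "0 \<le> c" "0 \<le> d"
    by (metis ennreal_cases)
  then show ?thesis
  proof cases
    case 3
    then have "epowr y a \<noteq> 0" using assms by (cases y) (auto simp: epowr_def)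
    with 3 assms show ?thesis by (simp add: ennreal_top_mult)
  next
    case 4
    then have "epowr x a \<noteq> 0" using assms by (cases x) (auto simp: epowr_def)
    with 4 assms show ?thesis by (simp add: ennreal_mult_top)
  next
    case 5
    then show ?thesis using assms
      by (simp add: epowr_ennreal powr_mult flip: ennreal_mult)
  qed (use assms in auto)
qed

lemma epowr_epowr:
  assumes "0 < a" "0 < b" shows "epowr (epowr x a) b = epowr x (a * b)"
  using assms by (cases x) (auto simp: epowr_ennreal powr_powr)

lemma epowr_add:
  assumes "0 < a" "0 < b" shows "epowr x (a + b) = epowr x a * epowr x b"
  using assms by (cases x) (auto simp: epowr_ennreal powr_add ennreal_mult' add_pos_pos)

lemma measurable_epowr [measurable (raw)]:
  assumes "f \<in> borel_measurable M"
  shows "(\<lambda>x. epowr (f x) a) \<in> borel_measurable M"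
proof (rule measurable_compose[OF assms])
  have [measurable]: "(\<lambda>x. ennreal (enn2real x powr a)) \<in> borel_measurable borel" by measurable
  have [measurable]: "Measurable.pred borel (\<lambda>x::ennreal. x = c)" for c
    unfolding pred_def by (simp add: borel_closed[OF closed_Collect_eq])
  show "(\<lambda>x. epowr x a) \<in> borel_measurable borel"
    unfolding epowr_def by (intro measurable_If) auto
qed

lemma epowr_eq_0_iff: "0 < a \<Longrightarrow> epowr x a = 0 \<longleftrightarrow> x = 0"
  by (cases "x = \<top>") (auto simp: epowr_def ennreal_eq_0_iff enn2real_eq_0_iff powr_eq_0_iff)

lemma epowr_eq_top_iff: "0 < a \<Longrightarrow> epowr x a = \<top> \<longleftrightarrow> x = \<top>"
  by (simp add: epowr_def)

section \<open>Young, Hoelder, Jensen and Schur inequalities without integrability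
  assumptions\<close>

lemma epowr_Young:
  assumes "0 < s" "s < 1"
  shows "epowr x s * epowr y (1 - s) \<le> ennreal s * x + ennreal (1 - s) * y"
proof -
  consider "x = 0" | "y = 0" | "x = \<top>" | "y = \<top>"
    | c d where "x = ennreal c" "y = ennreal d" "0 < c" "0 < d"
    by (metis ennreal_cases ennreal_0 order_le_less)
  then show ?thesis
  proof cases
    case 5
    then show ?thesis using assms Youngs_inequality_0[of s "1 - s" c d]
      by (simp add: epowr_ennreal flip: ennreal_mult ennreal_plus)
  next
    case 3
    then show ?thesis using assms by (simp add: ennreal_mult_top)
  next
    case 4
    then show ?thesis using assms by (simp add: ennreal_mult_top)
  qed (use assms in simp_all)
qed

text \<open>Dividing f and g by their integrals reduces this to the pointwise
  \<open>epowr_Young\<close>, whose right-hand side then integrates to s + (1 - s) = 1. The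
  degenerate cases are treated apart: a vanishing integral makes its factor vanish almost
  everywhere, and an infinite one next to a nonzero one makes the right-hand side infinite.\<close>

lemma nn_integral_Hoelder:
  assumes [measurable]: "f \<in> borel_measurable M" "g \<in> borel_measurable M" and s: "0 < s" "s < 1"
  shows "(\<integral>\<^sup>+x. epowr (f x) s * epowr (g x) (1 - s) \<partial>M)
      \<le> epowr (\<integral>\<^sup>+x. f x \<partial>M) s * epowr (\<integral>\<^sup>+x. g x \<partial>M) (1 - s)"
proof -
  define A where "A = (\<integral>\<^sup>+x. f x \<partial>M)"
  define B where "B = (\<integral>\<^sup>+x. g x \<partial>M)"
  consider "A = 0" | "B = 0" | "A = \<top>" "B \<noteq> 0" | "B = \<top>" "A \<noteq> 0"
    | c d where "A = ennreal c" "B = ennreal d" "0 < c" "0 < d"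
    by (metis ennreal_cases ennreal_0 order_le_less)
  then show ?thesis
  proof cases
    case 1
    then have "AE x in M. f x = 0" by (simp add: A_def nn_integral_0_iff_AE)
    then have "(\<integral>\<^sup>+x. epowr (f x) s * epowr (g x) (1 - s) \<partial>M) = (\<integral>\<^sup>+x. 0 \<partial>M)"
      by (intro nn_integral_cong_AE) (use s in auto)
    then show ?thesis by simp
  next
    case 2
    then have "AE x in M. g x = 0" by (simp add: B_def nn_integral_0_iff_AE)
    then have "(\<integral>\<^sup>+x. epowr (f x) s * epowr (g x) (1 - s) \<partial>M) = (\<integral>\<^sup>+x. 0 \<partial>M)"
      by (intro nn_integral_cong_AE) (use s in auto)
    then show ?thesis by simp
  next
    case 3
    then show ?thesis using s epowr_eq_0_iff[of "1 - s" B]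
      by (simp add: ennreal_top_mult A_def B_def)
  next
    case 4
    then show ?thesis using s epowr_eq_0_iff[of s A]
      by (simp add: ennreal_mult_top A_def B_def)
  next
    case 5
    then have AB: "A \<noteq> 0" "A \<noteq> \<top>" "B \<noteq> 0" "B \<noteq> \<top>" by auto
    have "(\<integral>\<^sup>+x. epowr (f x) s * epowr (g x) (1 - s) \<partial>M)
      = (\<integral>\<^sup>+x. (epowr A s * epowr B (1 - s)) *
          (epowr (f x / A) s * epowr (g x / B) (1 - s)) \<partial>M)"
    proof (intro nn_integral_cong)
      fix x
      have 1: "f x = A * (f x / A)" "g x = B * (g x / B)"
        by (simp_all only: ennreal_times_divide mult.commute[of A] mult.commute[of B]
            mult_divide_eq_ennreal[OF AB(1,2)] mult_divide_eq_ennreal[OF AB(3,4)])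
      have "epowr (f x) s = epowr A s * epowr (f x / A) s"
           "epowr (g x) (1 - s) = epowr B (1 - s) * epowr (g x / B) (1 - s)"
        using s by (simp_all only: epowr_mult[symmetric] diff_gt_0_iff_gt 1[symmetric])
      then show "epowr (f x) s * epowr (g x) (1 - s) = (epowr A s * epowr B (1 - s)) *
          (epowr (f x / A) s * epowr (g x / B) (1 - s))"
        by (simp add: mult_ac)
    qed
    also have "\<dots> = (epowr A s * epowr B (1 - s)) *
        (\<integral>\<^sup>+x. (epowr (f x / A) s * epowr (g x / B) (1 - s)) \<partial>M)"
      by (rule nn_integral_cmult) measurable
    also have "(\<integral>\<^sup>+x. (epowr (f x / A) s * epowr (g x / B) (1 - s)) \<partial>M)
        \<le> (\<integral>\<^sup>+x. ennreal s * (f x / A) + ennreal (1 - s) * (g x / B) \<partial>M)"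
      by (intro nn_integral_mono epowr_Young s)
    also have "\<dots> = ennreal s * (A / A) + ennreal (1 - s) * (B / B)"
      unfolding A_def B_def by (subst nn_integral_add) (auto simp: nn_integral_cmult nn_integral_divide)
    also have "\<dots> = 1"
      using 5 s by (simp add: ennreal_divide_self flip: ennreal_plus)
    finally show ?thesis by (simp add: A_def B_def mult_left_mono)
  qed
qed

text \<open>Jensen's inequality for the measure with density \<open>k\<close>, whose mass need not
  be 1; hence the factor with exponent p - 1. It is Hoelder for the splitting k f = (k f^p)^(1/p)
  k^(1 - 1/p).\<close>

lemma nn_integral_epowr_le:
  assumes [measurable]: "f \<in> borel_measurable M" "k \<in> borel_measurable M" and p: "1 < p"
  shows "epowr (\<integral>\<^sup>+x. k x * f x \<partial>M) p
      \<le> epowr (\<integral>\<^sup>+x. k x \<partial>M) (p - 1) * (\<integral>\<^sup>+x. k x * epowr (f x) p \<partial>M)"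
proof -
  have *: "k x * f x = epowr (k x * epowr (f x) p) (1 / p) * epowr (k x) (1 - 1 / p)" for x
    using p epowr_add[of "1 / p" "1 - 1 / p" "k x"]
    by (simp add: epowr_mult epowr_epowr mult_ac)
  have "epowr (\<integral>\<^sup>+x. k x * f x \<partial>M) p
      \<le> epowr (epowr (\<integral>\<^sup>+x. k x * epowr (f x) p \<partial>M) (1 / p) *
           epowr (\<integral>\<^sup>+x. k x \<partial>M) (1 - 1 / p)) p"
    unfolding * by (intro epowr_mono nn_integral_Hoelder) (use p in auto)
  also have "\<dots> = epowr (\<integral>\<^sup>+x. k x \<partial>M) (p - 1) * (\<integral>\<^sup>+x. k x * epowr (f x) p \<partial>M)"
  proof -
    have "(1 - 1 / p) * p = p - 1" using p by (simp add: field_simps)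
    then show ?thesis using p by (simp add: epowr_mult epowr_epowr mult_ac)
  qed
  finally show ?thesis .
qed

lemma nn_integral_epowr_concave:
  assumes [measurable]: "f \<in> borel_measurable M" "k \<in> borel_measurable M"
    and s: "0 < s" "s \<le> 1" and k: "(\<integral>\<^sup>+x. k x \<partial>M) \<le> 1"
  shows "(\<integral>\<^sup>+x. k x * epowr (f x) s \<partial>M) \<le> epowr (\<integral>\<^sup>+x. k x * f x \<partial>M) s"
proof (cases "s = 1")
  case False
  then have s1: "s < 1" using s by simp
  have *: "k x * epowr (f x) s = epowr (k x * f x) s * epowr (k x) (1 - s)" for x
    using s s1 epowr_add[of s "1 - s" "k x"] by (simp add: epowr_mult mult_ac)
  have "(\<integral>\<^sup>+x. k x * epowr (f x) s \<partial>M)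
      \<le> epowr (\<integral>\<^sup>+x. k x * f x \<partial>M) s * epowr (\<integral>\<^sup>+x. k x \<partial>M) (1 - s)"
    unfolding * by (intro nn_integral_Hoelder) (use s s1 in auto)
  also have "\<dots> \<le> epowr (\<integral>\<^sup>+x. k x * f x \<partial>M) s * epowr 1 (1 - s)"
    by (intro mult_left_mono epowr_mono k) (use s1 in auto)
  finally show ?thesis by simp
qed simp

text \<open>Weighted Jensen with density k U, applied to f / U. As U is finite and nonzero almost
  everywhere, the division can be undone under the integral. The test function U is free; choosing
  it well is the whole difficulty later on.\<close>

lemma nn_integral_Schur:
  assumes [measurable]: "f \<in> borel_measurable M" "k \<in> borel_measurable M" "U \<in> borel_measurable M"
    and p: "1 < p" and U: "AE x in M. U x \<noteq> 0 \<and> U x \<noteq> \<top>"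
  shows "epowr (\<integral>\<^sup>+x. k x * f x \<partial>M) p
      \<le> epowr (\<integral>\<^sup>+x. k x * U x \<partial>M) (p - 1) *
         (\<integral>\<^sup>+x. k x * (epowr (f x) p * epowr (U x) (1 - p)) \<partial>M)"
proof -
  have eq: "k x * U x * (f x * epowr (U x) (- 1)) = k x * f x"
           "k x * U x * epowr (f x * epowr (U x) (- 1)) p
              = k x * (epowr (f x) p * epowr (U x) (1 - p))"
    if "U x \<noteq> 0 \<and> U x \<noteq> \<top>" for x
  proof -
    obtain c where c: "U x = ennreal c" "0 < c"
      using \<open>U x \<noteq> 0 \<and> U x \<noteq> \<top>\<close> by (cases "U x") (auto simp: less_le)
    have 1: "U x * epowr (U x) (- 1) = 1"
      using c by (simp add: epowr_ennreal_pos powr_minus flip: ennreal_mult)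
    have "k x * U x * (f x * epowr (U x) (- 1)) = k x * f x * (U x * epowr (U x) (- 1))"
      by (simp only: mult_ac)
    then show "k x * U x * (f x * epowr (U x) (- 1)) = k x * f x" by (simp add: 1)
    have 2: "U x * epowr (epowr (U x) (- 1)) p = epowr (U x) (1 - p)"
      using c p by (simp add: epowr_ennreal_pos powr_powr powr_diff powr_minus divide_inverse inverse_powr
          flip: ennreal_mult)
    show "k x * U x * epowr (f x * epowr (U x) (- 1)) p
              = k x * (epowr (f x) p * epowr (U x) (1 - p))"
      using p by (simp add: epowr_mult mult_ac flip: 2)
  qed
  have "(\<integral>\<^sup>+x. k x * f x \<partial>M) = (\<integral>\<^sup>+x. k x * U x * (f x * epowr (U x) (- 1)) \<partial>M)"
    using U by (intro nn_integral_cong_AE) (auto simp: eq)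
  moreover have "(\<integral>\<^sup>+x. k x * U x * epowr (f x * epowr (U x) (- 1)) p \<partial>M)
      = (\<integral>\<^sup>+x. k x * (epowr (f x) p * epowr (U x) (1 - p)) \<partial>M)"
    using U by (intro nn_integral_cong_AE) (auto simp: eq)
  moreover have "epowr (\<integral>\<^sup>+x. k x * U x * (f x * epowr (U x) (- 1)) \<partial>M) p
      \<le> epowr (\<integral>\<^sup>+x. k x * U x \<partial>M) (p - 1) *
         (\<integral>\<^sup>+x. k x * U x * epowr (f x * epowr (U x) (- 1)) p \<partial>M)"
    by (rule nn_integral_epowr_le) (use p in auto)
  ultimately show ?thesis by simp
qed

lemma epowr_add_le:
  assumes "1 < p" shows "epowr (x + y) p \<le> ennreal (2 powr p) * (epowr x p + epowr y p)"
proof -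
  have "x + y \<le> ennreal 2 * max x y"
    by (metis add_mono ennreal_numeral max.cobounded1 max.cobounded2 mult_2 zero_le_numeral)
  then have "epowr (x + y) p \<le> epowr (ennreal 2 * max x y) p"
    using assms by (intro epowr_mono) auto
  also have "\<dots> = ennreal (2 powr p) * epowr (max x y) p"
    using assms by (simp add: epowr_mult epowr_ennreal del: ennreal_numeral)
  also have "epowr (max x y) p \<le> epowr x p + epowr y p"
    by (cases "x \<le> y") (auto simp: max_def)
  finally show ?thesis by (simp add: mult_left_mono)
qed

text \<open>Each term is split as c = c^s c^(1 - s) and the second factor is raised to (c + d)^(1 -
  s). With s = 1 / p it separates the two norms when the final p-th root is taken.\<close>

lemma epowr_subadd:
  assumes "0 < s" "s \<le> 1" shows "epowr (x + y) s \<le> epowr x s + epowr y s"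
proof (cases "x = \<top> \<or> y = \<top> \<or> s = 1")
  case False
  then obtain c d where c: "x = ennreal c" "y = ennreal d" "0 \<le> c" "0 \<le> d"
    by (metis ennreal_cases)
  have "(c + d) powr s \<le> c powr s + d powr s"
  proof (cases "c + d = 0")
    case False
    with c have pos: "0 < c + d" by simp
    have e: "t powr s * t powr (1 - s) = t" if "0 \<le> t" for t :: real
      using powr_add[of t s "1 - s"] that by (metis diff_add_cancel add.commute powr_one)
    have "c + d = c powr s * c powr (1 - s) + d powr s * d powr (1 - s)"
      using c by (simp only: e)
    also have "\<dots> \<le> c powr s * (c + d) powr (1 - s) + d powr s * (c + d) powr (1 - s)"
      using c assms by (intro add_mono mult_left_mono powr_mono2) auto
    also have "\<dots> = (c powr s + d powr s) * ((c + d) / (c + d) powr s)"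
      using pos by (simp add: powr_diff distrib_right add_divide_distrib)
    finally have "1 \<le> (c powr s + d powr s) / (c + d) powr s"
      using pos by (simp add: pos_le_divide_eq pos_divide_le_eq)
    then show ?thesis using pos by (simp add: pos_le_divide_eq)
  qed (use c in auto)
  then show ?thesis using c assms
    by (simp add: epowr_ennreal flip: ennreal_plus)
qed (use assms in auto)

section \<open>The heat semigroup\<close>

lemma nn_integral_affine:
  fixes t :: "'a::euclidean_space"
  assumes [measurable]: "f \<in> borel_measurable borel" and c: "c \<noteq> 0"
  shows "(\<integral>\<^sup>+x. f x \<partial>lborel) = ennreal (\<bar>c\<bar> ^ DIM('a)) * (\<integral>\<^sup>+x. f (t + c *\<^sub>R x) \<partial>lborel)"
  by (subst lborel_affine[OF c, of t])
     (simp add: nn_integral_density nn_integral_distr nn_integral_cmult)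

lemma integrable_affine:
  fixes t :: "'a::euclidean_space" and f :: "'a \<Rightarrow> 'b::{banach, second_countable_topology}"
  assumes f: "integrable lborel f" and c: "c \<noteq> 0"
  shows "integrable lborel (\<lambda>x. f (t + c *\<^sub>R x))"
proof -
  have [measurable]: "f \<in> borel_measurable borel"
    using borel_measurable_integrable[OF f] by simp
  have "ennreal (\<bar>c\<bar> ^ DIM('a)) * (\<integral>\<^sup>+x. norm (f (t + c *\<^sub>R x)) \<partial>lborel) < \<infinity>"
    using f c by (subst nn_integral_affine[symmetric]) (auto simp: integrable_iff_bounded)
  moreover have "ennreal (\<bar>c\<bar> ^ DIM('a)) \<noteq> 0" using c by simp
  ultimately show ?thesis
    by (auto simp: integrable_iff_bounded ennreal_mult_less_top)
qed

lemma integral_affine: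
  fixes t :: "'a::euclidean_space" and f :: "'a \<Rightarrow> 'b::{banach, second_countable_topology}"
  assumes f: "f \<in> borel_measurable borel" and c: "c \<noteq> 0"
  shows "(\<integral>x. f x \<partial>lborel) = (\<bar>c\<bar> ^ DIM('a)) *\<^sub>R (\<integral>x. f (t + c *\<^sub>R x) \<partial>lborel)"
proof -
  have "(\<integral>x. f x \<partial>lborel)
      = (\<integral>x. f x \<partial>density (distr lborel borel (\<lambda>x. t + c *\<^sub>R x)) (\<lambda>_. ennreal (\<bar>c\<bar> ^ DIM('a))))"
    by (subst lborel_affine[OF c, of t]) simp
  also have "\<dots> = (\<integral>x. (\<bar>c\<bar> ^ DIM('a)) *\<^sub>R f x \<partial>distr lborel borel (\<lambda>x. t + c *\<^sub>R x))"
    using f by (subst integral_density) simp_all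
  also have "\<dots> = (\<integral>x. (\<bar>c\<bar> ^ DIM('a)) *\<^sub>R f (t + c *\<^sub>R x) \<partial>lborel)"
    using f by (subst integral_distr) simp_all
  finally show ?thesis by simp
qed

text \<open>Lebesgue measure on a Euclidean space is the image of the product measure over
  \<open>Basis\<close>. This reduces Gaussian integrals, and later the integrability of a negative
  power of 1 + |x|^2, to one dimension.\<close>

lemma
  fixes f :: "'a::euclidean_space \<Rightarrow> real \<Rightarrow> 'b::{real_normed_field,banach,second_countable_topology}"
  assumes f: "\<And>b. b \<in> Basis \<Longrightarrow> integrable lborel (f b)"
  shows integrable_lborel_prod: "integrable lborel (\<lambda>x::'a. \<Prod>b\<in>Basis. f b (x \<bullet> b))"
    and integral_lborel_prod:
      "(\<integral>x. (\<Prod>b\<in>Basis. f b ((x::'a) \<bullet> b)) \<partial>lborel) = (\<Prod>b\<in>Basis. \<integral>x. f b x \<partial>lborel)"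
proof -
  interpret product_sigma_finite "\<lambda>_::'a. lborel :: real measure" ..
  have [measurable]: "f b \<in> borel_measurable borel" if "b \<in> Basis" for b
    using borel_measurable_integrable[OF f[OF that]] by simp
  have [measurable]: "(\<lambda>x::'a. \<Prod>b\<in>Basis. f b (x \<bullet> b)) \<in> borel_measurable borel"
    by measurable
  have eq: "(\<Prod>b\<in>Basis. f b ((\<Sum>c\<in>Basis. y c *\<^sub>R c) \<bullet> b)) = (\<Prod>b\<in>Basis. f b (y b))"
    for y :: "'a \<Rightarrow> real"
    by (intro prod.cong refl) simp
  have eq2: "(\<lambda>y. \<Prod>b\<in>Basis. f b ((\<Sum>c\<in>Basis. y c *\<^sub>R c) \<bullet> b)) = (\<lambda>y. \<Prod>b\<in>Basis. f b (y b))"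
    using eq by blast
  show "integrable lborel (\<lambda>x::'a. \<Prod>b\<in>Basis. f b (x \<bullet> b))"
    by (subst lborel_eq, subst integrable_distr_eq, measurable, subst eq2,
        intro product_integrable_prod f) auto
  show "(\<integral>x. (\<Prod>b\<in>Basis. f b ((x::'a) \<bullet> b)) \<partial>lborel) = (\<Prod>b\<in>Basis. \<integral>x. f b x \<partial>lborel)"
    by (subst lborel_eq, subst integral_distr, measurable, subst eq2,
        intro product_integral_prod f) auto
qed

text \<open>Normalised for the heat equation whose generator is the Laplacian itself, so that with
  the Fourier convention in use the multiplier at time t is exp (- t |2 pi \<xi>|^2).\<close>

definition heat_kernel :: "real \<Rightarrow> 'a::euclidean_space \<Rightarrow> real" where
  "heat_kernel t x = (4 * pi * t) powr (- real DIM('a) / 2) * exp (- (norm x)\<^sup>2 / (4 * t))"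

lemma heat_kernel_pos: "0 < t \<Longrightarrow> 0 < heat_kernel t x"
  by (simp add: heat_kernel_def)

lemma heat_kernel_nonneg [simp]: "0 \<le> heat_kernel t x"
  by (simp add: heat_kernel_def)

lemma heat_kernel_minus [simp]: "heat_kernel t (- x) = heat_kernel t x"
  by (simp add: heat_kernel_def)

lemma measurable_heat_kernel [measurable (raw)]:
  assumes [measurable]: "f \<in> borel_measurable M" "g \<in> borel_measurable M"
  shows "(\<lambda>x. heat_kernel (f x) (g x)) \<in> borel_measurable M"
  unfolding heat_kernel_def by measurable

text \<open>Rescaling by sqrt (2 s) turns the integral into the characteristic function of the
  standard normal law.\<close>

lemma
  assumes s: "0 < s"
  shows integrable_gaussian_1d:
      "integrable lborel (\<lambda>x::real. complex_of_real (exp (- x\<^sup>2 / (4 * s))) * iexp (\<eta> * x))"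
    and integral_gaussian_1d:
      "(\<integral>x. complex_of_real (exp (- (x::real)\<^sup>2 / (4 * s))) * iexp (\<eta> * x) \<partial>lborel)
        = complex_of_real (sqrt (4 * pi * s) * exp (- s * \<eta>\<^sup>2))"
proof -
  define c where "c = sqrt (2 * s)"
  have c: "c > 0" "c\<^sup>2 = 2 * s" using s by (auto simp: c_def)
  define f where "f x = complex_of_real (std_normal_density x) * iexp ((c * \<eta>) * x)" for x
  have int_f: "integrable lborel f"
  proof (rule Bochner_Integration.integrable_bound)
    show "integrable lborel std_normal_density" by (rule integrable_normal_density) simp
    show "AE x in lborel. norm (f x) \<le> norm (std_normal_density x)"
      by (auto simp: f_def norm_mult)
  qed (simp add: f_def[abs_def])
  have "(\<integral>x. f x \<partial>lborel) = char std_normal_distribution (c * \<eta>)"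
    by (simp add: char_def f_def integral_density scaleR_conv_of_real)
  also have "\<dots> = exp (- s * \<eta>\<^sup>2)"
    unfolding char_std_normal_distribution using c by (simp add: power_mult_distrib)
  finally have If: "(\<integral>x. f x \<partial>lborel) = complex_of_real (exp (- s * \<eta>\<^sup>2))" .
  have *: "complex_of_real (exp (- x\<^sup>2 / (4 * s))) * iexp (\<eta> * x)
      = sqrt (2 * pi) * f (0 + (1 / c) * x)" for x
  proof -
    have "(x / c)\<^sup>2 / 2 = x\<^sup>2 / (4 * s)" using c s by (simp add: power_divide)
    then show ?thesis using c
      by (simp add: f_def std_normal_density_def)
  qed
  show "integrable lborel (\<lambda>x::real. complex_of_real (exp (- x\<^sup>2 / (4 * s))) * iexp (\<eta> * x))"
    unfolding * using c by (intro integrable_mult_right lborel_integrable_real_affine int_f) auto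
  have "(\<integral>x. f x \<partial>lborel) = \<bar>1 / c\<bar> *\<^sub>R (\<integral>x. f (0 + (1 / c) * x) \<partial>lborel)"
    by (rule lborel_integral_real_affine) (use c in auto)
  then have "(\<integral>x. f (0 + (1 / c) * x) \<partial>lborel) = c * (\<integral>x. f x \<partial>lborel)"
    using c by (simp add: scaleR_conv_of_real)
  then have "(\<integral>x. f (0 + (1 / c) * x) \<partial>lborel) = c * complex_of_real (exp (- s * \<eta>\<^sup>2))"
    by (simp only: If)
  moreover have "sqrt (2 * pi) * c = sqrt (4 * pi * s)"
    by (simp add: c_def flip: real_sqrt_mult)
  ultimately show "(\<integral>x. complex_of_real (exp (- (x::real)\<^sup>2 / (4 * s))) * iexp (\<eta> * x) \<partial>lborel)
        = complex_of_real (sqrt (4 * pi * s) * exp (- s * \<eta>\<^sup>2))"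
    unfolding * by (simp flip: of_real_mult)
qed

lemma
  fixes \<xi> :: "'a::euclidean_space"
  assumes s: "0 < s"
  shows integrable_gaussian:
      "integrable lborel (\<lambda>x. complex_of_real (exp (- (norm x)\<^sup>2 / (4 * s))) * iexp (x \<bullet> \<xi>))"
    and integral_gaussian:
      "(\<integral>x. complex_of_real (exp (- (norm x)\<^sup>2 / (4 * s))) * iexp (x \<bullet> \<xi>) \<partial>lborel)
        = complex_of_real ((4 * pi * s) powr (real DIM('a) / 2) * exp (- s * (norm \<xi>)\<^sup>2))"
proof -
  have *: "complex_of_real (exp (- (norm x)\<^sup>2 / (4 * s))) * iexp (x \<bullet> \<xi>)
      = (\<Prod>b\<in>Basis. complex_of_real (exp (- (x \<bullet> b)\<^sup>2 / (4 * s))) * iexp ((\<xi> \<bullet> b) * (x \<bullet> b)))"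
    for x :: 'a
  proof -
    have "(norm x)\<^sup>2 = (\<Sum>b\<in>Basis. (x \<bullet> b)\<^sup>2)"
      by (subst power2_norm_eq_inner, subst euclidean_inner) (simp add: power2_eq_square)
    moreover have "x \<bullet> \<xi> = (\<Sum>b\<in>Basis. (\<xi> \<bullet> b) * (x \<bullet> b))"
      by (subst euclidean_inner) (simp add: mult.commute)
    ultimately show ?thesis
      by (simp add: prod.distrib exp_sum sum_divide_distrib sum_distrib_left flip: of_real_prod sum_negf)
  qed
  show "integrable lborel (\<lambda>x. complex_of_real (exp (- (norm x)\<^sup>2 / (4 * s))) * iexp (x \<bullet> \<xi>))"
    unfolding * using s by (intro integrable_lborel_prod integrable_gaussian_1d)
  have "(\<integral>x. complex_of_real (exp (- (norm x)\<^sup>2 / (4 * s))) * iexp (x \<bullet> \<xi>) \<partial>lborel)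
      = (\<Prod>b\<in>Basis. complex_of_real (sqrt (4 * pi * s) * exp (- s * (\<xi> \<bullet> b)\<^sup>2)))"
    unfolding * by (subst integral_lborel_prod[OF integrable_gaussian_1d[OF s]])
      (simp only: integral_gaussian_1d[OF s])
  also have "\<dots> = complex_of_real (sqrt (4 * pi * s) ^ DIM('a) * exp (\<Sum>b\<in>Basis. - s * (\<xi> \<bullet> b)\<^sup>2))"
    by (simp add: prod.distrib exp_sum)
  also have "sqrt (4 * pi * s) ^ DIM('a) = (4 * pi * s) powr (real DIM('a) / 2)"
    using s by (simp add: powr_half_sqrt[symmetric] powr_realpow[symmetric] powr_powr)
  also have "(\<Sum>b\<in>Basis. - s * (\<xi> \<bullet> b)\<^sup>2) = - s * (norm \<xi>)\<^sup>2"
    by (subst power2_norm_eq_inner, subst euclidean_inner)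
       (simp add: power2_eq_square sum_distrib_left sum_negf)
  finally show "(\<integral>x. complex_of_real (exp (- (norm x)\<^sup>2 / (4 * s))) * iexp (x \<bullet> \<xi>) \<partial>lborel)
        = complex_of_real ((4 * pi * s) powr (real DIM('a) / 2) * exp (- s * (norm \<xi>)\<^sup>2))" .
qed

lemma
  fixes \<xi> :: "'a::euclidean_space"
  assumes t: "0 < t"
  shows integrable_heat_kernel_iexp:
      "integrable lborel (\<lambda>x. complex_of_real (heat_kernel t x) * iexp (x \<bullet> \<xi>))"
    and integral_heat_kernel_iexp:
      "(\<integral>x. complex_of_real (heat_kernel t x) * iexp (x \<bullet> \<xi>) \<partial>lborel)
        = complex_of_real (exp (- t * (norm \<xi>)\<^sup>2))"
proof -
  have *: "complex_of_real (heat_kernel t x) * iexp (x \<bullet> \<xi>)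
     = complex_of_real ((4 * pi * t) powr (- real DIM('a) / 2)) *
        (complex_of_real (exp (- (norm x)\<^sup>2 / (4 * t))) * iexp (x \<bullet> \<xi>))" for x :: 'a
    by (simp add: heat_kernel_def)
  show "integrable lborel (\<lambda>x. complex_of_real (heat_kernel t x) * iexp (x \<bullet> \<xi>))"
    unfolding * using t by (intro integrable_mult_right integrable_gaussian)
  have "(4 * pi * t) powr (- real DIM('a) / 2) * (4 * pi * t) powr (real DIM('a) / 2) = 1"
    using t by (simp flip: powr_add)
  then show "(\<integral>x. complex_of_real (heat_kernel t x) * iexp (x \<bullet> \<xi>) \<partial>lborel)
        = complex_of_real (exp (- t * (norm \<xi>)\<^sup>2))"
    unfolding * integral_mult_right_zero integral_gaussian[OF t]
    by (simp only: of_real_mult[symmetric] mult.assoc[symmetric] mult_1)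
qed

lemma integrable_heat_kernel: "0 < t \<Longrightarrow> integrable lborel (heat_kernel t :: 'a::euclidean_space \<Rightarrow> real)"
  using integrable_heat_kernel_iexp[of t "0::'a"] by (simp flip: complex_of_real_integrable_eq)

lemma integral_heat_kernel: "0 < t \<Longrightarrow> (\<integral>x. heat_kernel t (x::'a::euclidean_space) \<partial>lborel) = 1"
  using integral_heat_kernel_iexp[of t "0::'a"] by simp

lemma nn_integral_heat_kernel:
  assumes "0 < t" shows "(\<integral>\<^sup>+x. ennreal (heat_kernel t (x::'a::euclidean_space)) \<partial>lborel) = 1"
  using assms by (simp add: nn_integral_eq_integral integrable_heat_kernel integral_heat_kernel)

lemma nn_integral_translate:
  fixes f :: "'a::euclidean_space \<Rightarrow> ennreal"
  assumes "f \<in> borel_measurable borel"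
  shows "(\<integral>\<^sup>+x. f (x - c) \<partial>lborel) = (\<integral>\<^sup>+x. f x \<partial>lborel)"
    and "(\<integral>\<^sup>+x. f (c - x) \<partial>lborel) = (\<integral>\<^sup>+x. f x \<partial>lborel)"
  using nn_integral_affine[OF assms, of 1 "- c"] nn_integral_affine[OF assms, of "- 1" c] by simp_all

text \<open>Completing the square in y. The last factor is a probability density in y, so
  integrating it out gives the semigroup law directly.\<close>

lemma heat_kernel_mult:
  fixes x y :: "'a::euclidean_space"
  assumes s: "0 < s" and t: "0 < t"
  shows "heat_kernel s (x - y) * heat_kernel t (y - z) =
    heat_kernel (s + t) (x - z) *
      heat_kernel (s * t / (s + t)) (y - ((t / (s + t)) *\<^sub>R x + (s / (s + t)) *\<^sub>R z))"
proof -
  have "s + t \<noteq> 0" "s \<noteq> 0" "t \<noteq> 0" using assms by auto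
  define u where "u = x - z"
  define w where "w = y - z"
  have 1: "x - y = u - w" by (simp add: u_def w_def)
  have 2: "y - ((t / (s + t)) *\<^sub>R x + (s / (s + t)) *\<^sub>R z) = w - (t / (s + t)) *\<^sub>R u"
  proof -
    have "(t / (s + t)) *\<^sub>R z + (s / (s + t)) *\<^sub>R z = z"
      using \<open>s + t \<noteq> 0\<close> by (simp flip: scaleR_left_distrib add_divide_distrib add: add.commute)
    then show ?thesis by (simp add: u_def w_def algebra_simps)
  qed
  have sq: "(norm (u - w))\<^sup>2 / (4 * s) + (norm w)\<^sup>2 / (4 * t)
      = (norm u)\<^sup>2 / (4 * (s + t))
        + (norm (w - (t / (s + t)) *\<^sub>R u))\<^sup>2 / (4 * (s * t / (s + t)))"
  proof -
    have 3: "(norm (u - w))\<^sup>2 = (norm u)\<^sup>2 - 2 * (u \<bullet> w) + (norm w)\<^sup>2"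
      by (simp add: power2_norm_eq_inner inner_diff inner_commute)
    have 4: "(norm (w - (t / (s + t)) *\<^sub>R u))\<^sup>2
        = (norm w)\<^sup>2 - 2 * (t / (s + t)) * (u \<bullet> w) + (t / (s + t))\<^sup>2 * (norm u)\<^sup>2"
      unfolding power2_norm_eq_inner
      by (simp add: inner_diff inner_commute power2_eq_square)
    have "(A - 2 * B + C) / (4 * s) + C / (4 * t)
      = A / (4 * (s + t)) + (C - 2 * (t / (s + t)) * B + (t / (s + t))\<^sup>2 * A) / (4 * (s * t / (s + t)))"
      for A B C :: real
      using \<open>s + t \<noteq> 0\<close> \<open>s \<noteq> 0\<close> \<open>t \<noteq> 0\<close>
      by (simp add: divide_simps) (simp add: algebra_simps power2_eq_square)
    then show ?thesis unfolding 3 4 by simp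
  qed
  have "4 * pi * s * (4 * pi * t) = 4 * pi * (s + t) * (4 * pi * (s * t / (s + t)))"
    using \<open>s + t \<noteq> 0\<close> by simp
  then have pw: "(4 * pi * s) powr a * (4 * pi * t) powr a
      = (4 * pi * (s + t)) powr a * (4 * pi * (s * t / (s + t))) powr a" for a
    using s t by (simp only: powr_mult[symmetric] mult_nonneg_nonneg less_imp_le pi_ge_zero
        add_pos_pos divide_pos_pos mult_pos_pos zero_le_numeral)
  have ex: "exp (- (norm (u - w))\<^sup>2 / (4 * s)) * exp (- (norm w)\<^sup>2 / (4 * t))
      = exp (- (norm u)\<^sup>2 / (4 * (s + t)))
        * exp (- (norm (w - (t / (s + t)) *\<^sub>R u))\<^sup>2 / (4 * (s * t / (s + t))))"
  proof -
    have "- ((norm (u - w))\<^sup>2 / (4 * s)) + - ((norm w)\<^sup>2 / (4 * t))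
      = - ((norm u)\<^sup>2 / (4 * (s + t)))
        + - ((norm (w - (t / (s + t)) *\<^sub>R u))\<^sup>2 / (4 * (s * t / (s + t))))"
      using sq by linarith
    then show ?thesis by (simp only: exp_add[symmetric] minus_divide_left)
  qed
  have "y - z = w" "x - z = u" by (simp_all add: u_def w_def)
  define a where "a = - real DIM('a) / 2"
  have *: "(A * E) * (B * F) = (C * G) * (D * H)" if "A * B = C * D" "E * F = G * H"
    for A B C D E F G H :: real
    using that by algebra
  show ?thesis
    unfolding 1 2 heat_kernel_def a_def[symmetric] \<open>y - z = w\<close> \<open>x - z = u\<close>
    by (rule *[OF pw ex])
qed

lemma heat_kernel_convolution:
  fixes x z :: "'a::euclidean_space"
  assumes s: "0 < s" and t: "0 < t"
  shows "(\<integral>\<^sup>+y. ennreal (heat_kernel s (x - y)) * ennreal (heat_kernel t (y - z)) \<partial>lborel)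
    = ennreal (heat_kernel (s + t) (x - z))"
proof -
  define r where "r = s * t / (s + t)"
  have "0 < r" using assms by (simp add: r_def)
  then have *: "(\<integral>\<^sup>+y. ennreal (heat_kernel r (y - c)) \<partial>lborel) = 1" for c :: 'a
    using nn_integral_translate(1)[where f = "\<lambda>y. ennreal (heat_kernel r y)"]
    by (simp add: nn_integral_heat_kernel)
  show ?thesis
    by (simp add: heat_kernel_mult[OF assms] r_def[symmetric] flip: ennreal_mult)
       (simp add: ennreal_mult nn_integral_cmult *)
qed

text \<open>The exponential only grows with the time, so the loss is just the ratio of the two
  normalising prefactors. Hence averages at comparable times are comparable, with the later time on
  the right.\<close>

lemma heat_kernel_le:
  fixes x :: "'a::euclidean_space"
  assumes s: "0 < s" "s \<le> t"
  shows "heat_kernel s x \<le> (t / s) powr (real DIM('a) / 2) * heat_kernel t x"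
proof -
  have "(4 * pi * s) powr (- real DIM('a) / 2)
      = (t / s) powr (real DIM('a) / 2) * (4 * pi * t) powr (- real DIM('a) / 2)"
    using s by (simp add: powr_divide powr_mult powr_minus field_simps)
  moreover have "exp (- (norm x)\<^sup>2 / (4 * s)) \<le> exp (- (norm x)\<^sup>2 / (4 * t))"
    using s by (auto intro!: divide_left_mono)
  ultimately show ?thesis
    by (simp add: heat_kernel_def mult_left_mono mult.assoc)
qed

section \<open>The heat semigroup acting on functions with values in [0, \<infinity>]\<close>

definition heat :: "real \<Rightarrow> ('a::euclidean_space \<Rightarrow> ennreal) \<Rightarrow> 'a \<Rightarrow> ennreal" where
  "heat t f x = (\<integral>\<^sup>+y. ennreal (heat_kernel t (x - y)) * f y \<partial>lborel)"

lemma measurable_heat [measurable (raw)]: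
  fixes f :: "'a::euclidean_space \<Rightarrow> ennreal"
  assumes [measurable]: "f \<in> borel_measurable borel" "t \<in> borel_measurable M" "g \<in> borel_measurable M"
  shows "(\<lambda>x. heat (t x) f (g x)) \<in> borel_measurable M"
  unfolding heat_def by measurable

lemma heat_mono: "(\<And>x. f x \<le> g x) \<Longrightarrow> heat t f x \<le> heat t g x"
  unfolding heat_def by (intro nn_integral_mono mult_left_mono) auto

lemma nn_integral_heat_kernel_diff:
  fixes x :: "'a::euclidean_space"
  assumes "0 < t" shows "(\<integral>\<^sup>+y. ennreal (heat_kernel t (x - y)) \<partial>lborel) = 1"
  using assms nn_integral_heat_kernel[of t, where 'a = 'a]
  by (simp add: nn_integral_translate(2)[where f = "\<lambda>y. ennreal (heat_kernel t y)"])

lemma heat_const: "0 < t \<Longrightarrow> heat t (\<lambda>_. c) x = c"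
  by (simp add: heat_def nn_integral_multc nn_integral_heat_kernel_diff)

lemma heat_le: "(\<And>x. f x \<le> c) \<Longrightarrow> 0 < t \<Longrightarrow> heat t f x \<le> c"
  using heat_mono[of f "\<lambda>_. c" t x] by (simp add: heat_const)

lemma heat_add:
  assumes [measurable]: "f \<in> borel_measurable borel" "g \<in> borel_measurable borel"
  shows "heat t (\<lambda>x. f x + g x) x = heat t f x + heat t g x"
  unfolding heat_def by (simp add: distrib_left nn_integral_add)

lemma heat_cmult:
  assumes [measurable]: "f \<in> borel_measurable borel"
  shows "heat t (\<lambda>x. c * f x) x = c * heat t f x"
  unfolding heat_def by (simp add: nn_integral_cmult mult.left_commute)

lemma heat_suminf:
  assumes [measurable]: "\<And>i. f i \<in> borel_measurable borel"
  shows "heat t (\<lambda>x. \<Sum>i. f i x) x = (\<Sum>i. heat t (f i) x)"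
  unfolding heat_def ennreal_suminf_cmult[symmetric] by (subst nn_integral_suminf) auto

lemma heat_heat:
  fixes f :: "'a::euclidean_space \<Rightarrow> ennreal"
  assumes [measurable]: "f \<in> borel_measurable borel" and s: "0 < s" and t: "0 < t"
  shows "heat s (heat t f) x = heat (s + t) f x"
proof -
  have "heat s (heat t f) x = (\<integral>\<^sup>+y. \<integral>\<^sup>+z. ennreal (heat_kernel s (x - y)) *
      (ennreal (heat_kernel t (y - z)) * f z) \<partial>lborel \<partial>lborel)"
    unfolding heat_def by (simp add: nn_integral_cmult)
  also have "\<dots> = (\<integral>\<^sup>+z. \<integral>\<^sup>+y. ennreal (heat_kernel s (x - y)) *
      (ennreal (heat_kernel t (y - z)) * f z) \<partial>lborel \<partial>lborel)"
    by (rule lborel_pair.Fubini') measurable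
  also have "\<dots> = heat (s + t) f x"
    unfolding heat_def
    by (simp add: mult.assoc[symmetric] nn_integral_multc heat_kernel_convolution[OF s t])
  finally show ?thesis .
qed

lemma heat_adjoint:
  fixes f g :: "'a::euclidean_space \<Rightarrow> ennreal"
  assumes [measurable]: "f \<in> borel_measurable borel" "g \<in> borel_measurable borel"
  shows "(\<integral>\<^sup>+x. heat t f x * g x \<partial>lborel) = (\<integral>\<^sup>+x. f x * heat t g x \<partial>lborel)"
proof -
  have "(\<integral>\<^sup>+x. heat t f x * g x \<partial>lborel)
      = (\<integral>\<^sup>+x. \<integral>\<^sup>+y. (ennreal (heat_kernel t (x - y)) * f y) * g x \<partial>lborel \<partial>lborel)"
    unfolding heat_def by (simp add: nn_integral_multc)
  also have "\<dots> = (\<integral>\<^sup>+y. \<integral>\<^sup>+x. (ennreal (heat_kernel t (x - y)) * f y) * g x \<partial>lborel \<partial>lborel)"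
    by (rule lborel_pair.Fubini') measurable
  also have "\<dots> = (\<integral>\<^sup>+y. \<integral>\<^sup>+x. f y * (ennreal (heat_kernel t (y - x)) * g x) \<partial>lborel \<partial>lborel)"
    by (intro nn_integral_cong) (metis heat_kernel_minus minus_diff_eq mult.assoc mult.commute)
  also have "\<dots> = (\<integral>\<^sup>+x. f x * heat t g x \<partial>lborel)"
    unfolding heat_def by (simp add: nn_integral_cmult)
  finally show ?thesis .
qed

lemma heat_le_heat:
  fixes x :: "'a::euclidean_space"
  assumes [measurable]: "f \<in> borel_measurable borel" and s: "0 < s" "s \<le> t" "t \<le> r * s"
  shows "heat s f x \<le> ennreal (r powr (real DIM('a) / 2)) * heat t f x"
proof -
  have "heat s f x \<le> (\<integral>\<^sup>+y. ennreal (r powr (real DIM('a) / 2)) *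
      (ennreal (heat_kernel t (x - y)) * f y) \<partial>lborel)"
    unfolding heat_def mult.assoc[symmetric]
  proof (intro nn_integral_mono mult_right_mono)
    fix y
    have "heat_kernel s (x - y) \<le> (t / s) powr (real DIM('a) / 2) * heat_kernel t (x - y)"
      by (rule heat_kernel_le) (use s in auto)
    also have "\<dots> \<le> r powr (real DIM('a) / 2) * heat_kernel t (x - y)"
      using s by (intro mult_right_mono powr_mono2) (auto simp: field_simps)
    finally show "ennreal (heat_kernel s (x - y))
        \<le> ennreal (r powr (real DIM('a) / 2)) * ennreal (heat_kernel t (x - y))"
      by (simp flip: ennreal_mult)
  qed simp
  also have "\<dots> = ennreal (r powr (real DIM('a) / 2)) * heat t f x"
    unfolding heat_def by (rule nn_integral_cmult) measurable
  finally show ?thesis .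
qed

lemma heat_epowr_le:
  fixes x :: "'a::euclidean_space"
  assumes [measurable]: "f \<in> borel_measurable borel" and "0 < s" "s \<le> 1" and t: "0 < t"
  shows "heat t (\<lambda>x. epowr (f x) s) x \<le> epowr (heat t f x) s"
  unfolding heat_def
  by (rule nn_integral_epowr_concave) (use assms in \<open>auto simp: nn_integral_heat_kernel_diff\<close>)

lemma epowr_heat_le:
  fixes x :: "'a::euclidean_space"
  assumes [measurable]: "f \<in> borel_measurable borel" and "1 < p" and t: "0 < t"
  shows "epowr (heat t f x) p \<le> heat t (\<lambda>x. epowr (f x) p) x"
  using nn_integral_epowr_le[of f lborel "\<lambda>y. ennreal (heat_kernel t (x - y))" p] assms
  by (simp add: heat_def nn_integral_heat_kernel_diff)

lemma heat_Hoelder: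
  fixes x :: "'a::euclidean_space"
  assumes [measurable]: "f \<in> borel_measurable borel" "g \<in> borel_measurable borel"
    and s: "0 < s" "s < 1"
  shows "heat t (\<lambda>x. epowr (f x) s * epowr (g x) (1 - s)) x
    \<le> epowr (heat t f x) s * epowr (heat t g x) (1 - s)"
proof -
  have eq: "k * (epowr a s * epowr b (1 - s)) = epowr (k * a) s * epowr (k * b) (1 - s)" for k a b
    using s epowr_add[of s "1 - s" k] by (simp add: epowr_mult mult_ac)
  show ?thesis unfolding heat_def eq by (rule nn_integral_Hoelder) (use s in auto)
qed

section \<open>Cube averages and heat averages\<close>

lemma emeasure_cube:
  fixes c :: "real^'d"
  assumes "0 \<le> l" shows "emeasure lborel (cube c l) = ennreal (l ^ CARD('d))"
proof -
  have "emeasure lborel (cube c l) = ennreal (\<Prod>b\<in>Basis. ((\<chi> i. l)::real^'d) \<bullet> b)"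
    unfolding cube_def using assms
    by (subst emeasure_lborel_cbox) (auto simp: Basis_vec_def inner_axis inner_add_left)
  also have "(\<Prod>b\<in>Basis. ((\<chi> i. l)::real^'d) \<bullet> b) = (\<Prod>b\<in>(Basis::(real^'d) set). l)"
    by (intro prod.cong) (auto simp: Basis_vec_def inner_axis)
  finally show ?thesis by simp
qed

lemma mem_cube_iff: "y \<in> cube c l \<longleftrightarrow> y - c \<in> cbox 0 (\<chi> i. l)" for c y :: "real^'d"
  by (auto simp: cube_def mem_box_cart algebra_simps)

text \<open>By the parallelogram law |z + u|^2 is at most 2 |z|^2 + 2 |u|^2. Doubling the time
  absorbs the factor 2 in front of |z|^2, the bound on |u| costs exp (d / 4), and the prefactors
  differ by 2^(d/2).\<close>

lemma heat_kernel_le_shift: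
  fixes z u :: "'a::euclidean_space"
  assumes t: "0 < t" and u: "(norm u)\<^sup>2 \<le> real DIM('a) * t"
  shows "heat_kernel t z
    \<le> 2 powr (real DIM('a) / 2) * exp (real DIM('a) / 4) * heat_kernel (2 * t) (z + u)"
proof -
  have "(norm (z + u))\<^sup>2 \<le> 2 * (norm z)\<^sup>2 + 2 * (norm u)\<^sup>2"
  proof -
    have "(norm (z + u))\<^sup>2 + (norm (z - u))\<^sup>2 = 2 * (norm z)\<^sup>2 + 2 * (norm u)\<^sup>2"
      by (simp add: power2_norm_eq_inner inner_diff inner_add inner_commute)
    then show ?thesis by (smt (verit) zero_le_power2)
  qed
  also have "\<dots> \<le> 2 * (norm z)\<^sup>2 + 2 * (real DIM('a) * t)" using u by simp
  finally have "(norm (z + u))\<^sup>2 / (8 * t) \<le> (norm z)\<^sup>2 / (4 * t) + real DIM('a) / 4"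
    using t by (simp add: field_simps)
  then have e: "exp (- (norm z)\<^sup>2 / (4 * t)) \<le> exp (real DIM('a) / 4) * exp (- (norm (z + u))\<^sup>2 / (8 * t))"
    by (simp flip: exp_add)
  have "(4 * pi * t) powr (- real DIM('a) / 2)
      = 2 powr (real DIM('a) / 2) * (8 * pi * t) powr (- real DIM('a) / 2)"
  proof -
    have "(8 * pi * t) powr (- real DIM('a) / 2) = 2 powr (- real DIM('a) / 2) * (4 * pi * t) powr (- real DIM('a) / 2)"
      using powr_mult[of 2 "4 * pi * t"] t by (simp add: mult.assoc)
    then show ?thesis by (simp flip: powr_add mult.assoc)
  qed
  then show ?thesis
    using mult_left_mono[OF e, of "2 powr (real DIM('a) / 2) * (8 * pi * t) powr (- real DIM('a) / 2)"]
    by (simp add: heat_kernel_def mult_ac)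
qed

text \<open>The kernel at time \<open>t\<close> is dominated by its average at time \<open>2 * t\<close> over a cube of side
  \<open>sqrt t\<close>, so no covering of space by cubes is needed.\<close>

lemma heat_le_cube_average:
  fixes g :: "real^'d \<Rightarrow> ennreal"
  assumes [measurable]: "g \<in> borel_measurable borel" and t: "0 < t"
    and A: "\<And>c. (\<integral>\<^sup>+y. indicator (cube c (sqrt t)) y * g y \<partial>lborel) \<le> A * ennreal (sqrt t ^ CARD('d))"
  shows "heat t g x \<le> ennreal (2 powr (real CARD('d) / 2) * exp (real CARD('d) / 4)) * A"
proof -
  define l where "l = sqrt t"
  define K where "K = 2 powr (real CARD('d) / 2) * exp (real CARD('d) / 4)"
  define S where "S = cbox 0 ((\<chi> i. l) :: real^'d)"
  have l: "0 < l" "l\<^sup>2 = t" using t by (auto simp: l_def)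
  have [measurable]: "S \<in> sets borel" by (simp add: S_def)
  have S_norm: "(norm u)\<^sup>2 \<le> real CARD('d) * t" if "u \<in> S" for u
  proof -
    have "(norm u)\<^sup>2 = (\<Sum>i\<in>UNIV. (u $ i)\<^sup>2)"
      unfolding power2_norm_eq_inner inner_vec_def by (simp add: power2_eq_square)
    also have "\<dots> \<le> (\<Sum>i\<in>(UNIV::'d set). l\<^sup>2)"
      using that by (intro sum_mono power_mono) (auto simp: S_def mem_box_cart)
    finally show ?thesis using l by simp
  qed
  have ind: "(\<integral>\<^sup>+c. indicator S (y - c) \<partial>lborel) = ennreal (l ^ CARD('d))" for y
    using nn_integral_translate(2)[of "indicator S :: real^'d \<Rightarrow> ennreal" y] emeasure_cube[of l "0::real^'d"] l
    by (simp add: S_def cube_def)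
  \<comment> \<open>\<open>l ^ CARD('d)\<close> is the measure of the set of corners c whose cube
    contains y. Writing it as an integral over c introduces the average over cubes.\<close>
  have "heat t g x * ennreal (l ^ CARD('d))
      = (\<integral>\<^sup>+y. \<integral>\<^sup>+c. indicator S (y - c) * (ennreal (heat_kernel t (x - y)) * g y) \<partial>lborel \<partial>lborel)"
    unfolding heat_def by (simp add: nn_integral_multc ind nn_integral_cmult[symmetric] mult.commute)
  also have "\<dots> \<le> (\<integral>\<^sup>+y. \<integral>\<^sup>+c. ennreal (K * heat_kernel (2 * t) (x - c)) * (indicator S (y - c) * g y) \<partial>lborel \<partial>lborel)"
  proof (intro nn_integral_mono)
    fix y c :: "real^'d"
    have "heat_kernel t (x - y) \<le> K * heat_kernel (2 * t) (x - c)" if "y - c \<in> S"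
      using heat_kernel_le_shift[OF t, of "y - c" "x - y"] S_norm[OF that] by (simp add: K_def)
    then show "indicator S (y - c) * (ennreal (heat_kernel t (x - y)) * g y)
        \<le> ennreal (K * heat_kernel (2 * t) (x - c)) * (indicator S (y - c) * g y)"
      by (auto simp: indicator_def intro!: mult_right_mono ennreal_leI)
  qed
  also have "\<dots> = (\<integral>\<^sup>+c. \<integral>\<^sup>+y. ennreal (K * heat_kernel (2 * t) (x - c)) * (indicator S (y - c) * g y) \<partial>lborel \<partial>lborel)"
    by (rule lborel_pair.Fubini') measurable
  also have "\<dots> = (\<integral>\<^sup>+c. ennreal (K * heat_kernel (2 * t) (x - c)) *
      (\<integral>\<^sup>+y. indicator (cube c (sqrt t)) y * g y \<partial>lborel) \<partial>lborel)"
    by (simp add: nn_integral_cmult indicator_def mem_cube_iff S_def l_def)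
  also have "\<dots> \<le> (\<integral>\<^sup>+c. ennreal (heat_kernel (2 * t) (x - c)) * (ennreal K * (A * ennreal (l ^ CARD('d)))) \<partial>lborel)"
  proof (intro nn_integral_mono)
    fix c
    have "ennreal (K * heat_kernel (2 * t) (x - c)) = ennreal (heat_kernel (2 * t) (x - c)) * ennreal K"
      by (simp add: K_def mult.commute flip: ennreal_mult)
    then show "ennreal (K * heat_kernel (2 * t) (x - c)) *
        (\<integral>\<^sup>+y. indicator (cube c (sqrt t)) y * g y \<partial>lborel)
      \<le> ennreal (heat_kernel (2 * t) (x - c)) * (ennreal K * (A * ennreal (l ^ CARD('d))))"
      using A[of c] by (simp add: mult.assoc mult_left_mono l_def)
  qed
  also have "\<dots> = ennreal K * A * ennreal (l ^ CARD('d))"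
    using t by (simp add: nn_integral_multc nn_integral_heat_kernel_diff mult.assoc)
  finally have "ennreal (l ^ CARD('d)) * heat t g x \<le> ennreal (l ^ CARD('d)) * (ennreal K * A)"
    by (simp only: mult_ac)
  moreover have "ennreal (l ^ CARD('d)) \<noteq> 0" "ennreal (l ^ CARD('d)) \<noteq> \<top>" using l by auto
  ultimately have "heat t g x \<le> ennreal K * A"
    using ennreal_mult_le_mult_iff by blast
  then show ?thesis by (simp add: K_def)
qed

text \<open>The cube of side sqrt t is the one that matters at time t; it turns l^(- \<alpha>) into
  t^(- \<alpha> / 2). This is the form in which the cube condition on the weight enters.\<close>

lemma heat_le_Morrey:
  fixes g :: "real^'d \<Rightarrow> ennreal"
  assumes [measurable]: "g \<in> borel_measurable borel" and t: "0 < t" "t \<le> \<delta>\<^sup>2" and \<delta>: "0 < \<delta>" and M: "0 \<le> M"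
    and A: "\<And>c l. 0 < l \<Longrightarrow> l \<le> \<delta> \<Longrightarrow> (\<integral>\<^sup>+y. indicator (cube c l) y * g y \<partial>lborel)
      \<le> ennreal ((M * l powr (- \<alpha>)) powr a) * ennreal (l ^ CARD('d))"
  shows "heat t g x \<le> ennreal (2 powr (real CARD('d) / 2) * exp (real CARD('d) / 4) *
      (M * t powr (- \<alpha> / 2)) powr a)"
proof -
  have "0 < sqrt t" "sqrt t \<le> \<delta>" using t \<delta> by (auto intro: real_le_lsqrt)
  moreover have "sqrt t powr (- \<alpha>) = t powr (- \<alpha> / 2)"
    using t by (simp add: powr_half_sqrt[symmetric] powr_powr)
  ultimately have "heat t g x \<le> ennreal (2 powr (real CARD('d) / 2) * exp (real CARD('d) / 4)) *
      ennreal ((M * t powr (- \<alpha> / 2)) powr a)"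
    using heat_le_cube_average[of g t "ennreal ((M * t powr (- \<alpha> / 2)) powr a)" x] A[of "sqrt t"] t
    by simp
  then show ?thesis by (simp add: ennreal_mult)
qed

section \<open>A dyadic trace inequality\<close>

text \<open>Two geometric series: the first sums the terms below the crossing scale, counted
  downwards from it, the second the terms above.\<close>

definition geo_sum_bound :: "real \<Rightarrow> real \<Rightarrow> real \<Rightarrow> real" where
  "geo_sum_bound Y A B = 1 / (1 - Y powr (- A)) + 1 / (1 - Y powr (- B))"

lemma powr_neg_lt_1: "1 < Y \<Longrightarrow> 0 < A \<Longrightarrow> Y powr (- A) < (1::real)"
  by (simp add: powr_minus inverse_less_1_iff)

lemma geo_sum_bound_pos: "1 < Y \<Longrightarrow> 0 < A \<Longrightarrow> 0 < B \<Longrightarrow> 0 < geo_sum_bound Y A B"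
  using powr_neg_lt_1[of Y A] powr_neg_lt_1[of Y B] by (simp add: geo_sum_bound_def add_pos_pos)

lemma suminf_ennreal_power:
  assumes "0 \<le> q" "q < (1::real)"
  shows "(\<Sum>k. ennreal (q ^ k)) = ennreal (1 / (1 - q))"
  using assms by (subst suminf_ennreal2) (auto simp: suminf_geometric)

text \<open>Two geometric bounds that cross at the scale \<open>Y ^ k = w\<close>.\<close>

lemma suminf_le_geo_sum_bound:
  fixes c :: "nat \<Rightarrow> ennreal"
  assumes Y: "1 < Y" and A: "0 < A" and B: "0 < B" and w: "1 \<le> w" and K: "0 \<le> K"
    and c1: "\<And>k. c k \<le> ennreal (K * Y powr (A * real k))"
    and c2: "\<And>k. c k \<le> ennreal (K * (Y powr (- B * real k) * w powr (A + B)))"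
  shows "(\<Sum>k. c k) \<le> ennreal (K * geo_sum_bound Y A B * w powr A)"
proof -
  define n where "n = nat \<lfloor>log Y w\<rfloor>"
  have lg: "0 \<le> log Y w" using Y w by simp
  have n: "real n \<le> log Y w" "log Y w < real n + 1"
    using lg unfolding n_def by linarith+
  have wn: "Y powr real n \<le> w" "w \<le> Y powr (real n + 1)"
    using n Y w by (simp_all add: le_log_iff log_less_iff less_imp_le)
  define q where "q = Y powr (- A)"
  define q' where "q' = Y powr (- B)"
  have q: "0 \<le> q" "q < 1" "0 \<le> q'" "q' < 1"
    using powr_neg_lt_1[OF Y A] powr_neg_lt_1[OF Y B] by (auto simp: q_def q'_def)
  \<comment> \<open>Up to n the growing bound is largest at k = n, so the terms decay geometrically
    in n - k.\<close>
  have b1: "c k \<le> ennreal (K * w powr A) * ennreal (q ^ (n - k))" if "k < Suc n" for k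
  proof -
    have "A * real k = A * real n + (- A) * real (n - k)"
      using that by (simp add: of_nat_diff algebra_simps)
    then have "Y powr (A * real k) = (Y powr real n) powr A * q ^ (n - k)"
      using Y by (simp only: powr_add) (simp add: q_def powr_powr powr_realpow[symmetric] mult.commute)
    also have "\<dots> \<le> w powr A * q ^ (n - k)"
      using wn A q Y by (intro mult_right_mono powr_mono2) auto
    finally have "K * Y powr (A * real k) \<le> K * w powr A * q ^ (n - k)"
      using K by (simp add: mult.assoc mult_left_mono)
    then show ?thesis using c1[of k] K q
      by (subst ennreal_mult[symmetric]) (auto intro: order_trans ennreal_leI)
  qed
  \<comment> \<open>Beyond n the scale has passed w, so the surplus w^B is paid for by Y^(B (n + 1))
    and pure decay in k remains.\<close>
  have b2: "c (k + Suc n) \<le> ennreal (K * w powr A) * ennreal (q' ^ k)" for k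
  proof -
    have "Y powr (- B * real (k + Suc n)) * w powr (A + B)
        = w powr A * (Y powr (- B * real (k + Suc n)) * w powr B)"
      by (simp add: powr_add)
    also have "w powr B \<le> (Y powr (real n + 1)) powr B"
      using wn B w by (intro powr_mono2) auto
    also have "(Y powr (real n + 1)) powr B = Y powr (B * (real n + 1))"
      by (simp add: powr_powr mult.commute)
    also have "Y powr (- B * real (k + Suc n)) * Y powr (B * (real n + 1)) = Y powr (- B * real k)"
      by (subst powr_add[symmetric]) (simp add: algebra_simps)
    also have "\<dots> = q' ^ k" using Y by (simp add: q'_def powr_powr flip: powr_realpow)
    finally have "K * (Y powr (- B * real (k + Suc n)) * w powr (A + B)) \<le> K * w powr A * q' ^ k"
      using K by (simp add: mult.assoc mult_left_mono)
    then show ?thesis using c2[of "k + Suc n"] K q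
      by (subst ennreal_mult[symmetric]) (auto intro: order_trans ennreal_leI)
  qed
  have "(\<Sum>k. c k) = (\<Sum>k. c (k + Suc n)) + (\<Sum>k<Suc n. c k)"
    by (rule suminf_offset) simp
  also have "(\<Sum>k. c (k + Suc n)) \<le> (\<Sum>k. ennreal (K * w powr A) * ennreal (q' ^ k))"
    by (intro suminf_le b2) auto
  also have "\<dots> = ennreal (K * w powr A) * ennreal (1 / (1 - q'))"
    using q by (simp only: ennreal_suminf_cmult suminf_ennreal_power)
  also have "(\<Sum>k<Suc n. c k) \<le> (\<Sum>k<Suc n. ennreal (K * w powr A) * ennreal (q ^ (n - k)))"
    by (intro sum_mono b1) auto
  also have "\<dots> = ennreal (K * w powr A) * (\<Sum>k<Suc n. ennreal (q ^ k))"
    using sum.nat_diff_reindex[of "\<lambda>k. ennreal (q ^ k)" "Suc n"]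
    by (simp only: sum_distrib_left[symmetric] diff_Suc_Suc)
  also have "(\<Sum>k<Suc n. ennreal (q ^ k)) \<le> (\<Sum>k. ennreal (q ^ k))"
    by (intro sum_le_suminf) auto
  also have "\<dots> = ennreal (1 / (1 - q))" using q by (simp only: suminf_ennreal_power)
  finally have "(\<Sum>k. c k) \<le> ennreal (K * w powr A) * ennreal (1 / (1 - q'))
      + ennreal (K * w powr A) * ennreal (1 / (1 - q))"
    by (simp add: mult_left_mono add_mono)
  also have "\<dots> = ennreal (K * geo_sum_bound Y A B * w powr A)"
    using K q by (simp add: geo_sum_bound_def q_def q'_def algebra_simps flip: ennreal_mult ennreal_plus)
  finally show ?thesis .
qed

text \<open>The function \<open>F\<close> is a discretised Riesz potential of \<open>u\<close> of small order; it behaves like an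
  \<open>A\<^sub>1\<close> weight (\<open>P_F_le_F\<close>) and inherits the Morrey bound of \<open>u\<close> (\<open>P_F_le_powr\<close>), which makes
  its powers usable as Schur test functions without any maximal function.\<close>

locale dyadic_heat =
  fixes u :: "'a::euclidean_space \<Rightarrow> ennreal" and \<tau> Y a \<sigma> :: real
  assumes measurable_u [measurable]: "u \<in> borel_measurable borel"
    and tau: "0 < \<tau>" and Y: "1 < Y" and \<sigma>: "0 < \<sigma>" "\<sigma> < a"
    and heat_u_le: "\<And>k x. heat (\<tau> / 4 ^ k) u x \<le> ennreal (Y powr (a * real k))"
begin

definition P :: "nat \<Rightarrow> ('a \<Rightarrow> ennreal) \<Rightarrow> 'a \<Rightarrow> ennreal" where
  "P k = heat (\<tau> / 4 ^ k)"

text \<open>Four times the time of \<open>P k\<close>, so that \<open>R (Suc k)\<close> is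
  \<open>P k\<close>. The composition of \<open>P j\<close> and \<open>P k\<close> runs for a time
  between \<tau> / 4^i and 2 \<tau> / 4^i with i = min j k, which lies below the time of
  \<open>R i\<close> and within a factor 4 of it.\<close>

definition R :: "nat \<Rightarrow> ('a \<Rightarrow> ennreal) \<Rightarrow> 'a \<Rightarrow> ennreal" where
  "R k = heat (4 * \<tau> / 4 ^ k)"

definition F :: "'a \<Rightarrow> ennreal" where
  "F x = 1 + (\<Sum>k. ennreal (Y powr (- \<sigma> * real k)) * P k u x)"

text \<open>For Y = 2^\<alpha> this is the dyadic form of the integral of s^(\<alpha>/2 - 1)
  \<open>heat (\<tau> * s) f\<close> over 0 < s \<le> 1, that is, of a Riesz potential localised to
  times below \<tau>.\<close>

definition T :: "('a \<Rightarrow> ennreal) \<Rightarrow> 'a \<Rightarrow> ennreal" where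
  "T f x = (\<Sum>k. ennreal (Y powr (- real k)) * P k f x)"

text \<open>The A_1-type constant of F in \<open>P_F_le_F\<close>. The leading 1 comes from the
  constant summand of F and 4^(d/2) from comparing heat times; inside the bracket, 1 accounts for
  the full sum and the fraction for the geometric tail from index j on.\<close>

definition C1 :: real where
  "C1 = 1 + 4 powr (real DIM('a) / 2) * (1 + 1 / (1 - Y powr (- \<sigma>)))"

definition C2 :: real where
  "C2 = 1 + geo_sum_bound Y (a - \<sigma>) \<sigma>"

lemma C1_ge: "1 \<le> C1" and C2_ge: "1 \<le> C2"
  using powr_neg_lt_1[OF Y \<sigma>(1)] geo_sum_bound_pos[of Y "a - \<sigma>" \<sigma>] Y \<sigma>
  by (simp_all add: C1_def C2_def)

section \<open>Heat averages of u and of the potential F\<close>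

lemma measurable_P [measurable]:
  assumes [measurable]: "f \<in> borel_measurable borel"
  shows "P k f \<in> borel_measurable borel"
  unfolding P_def by measurable

lemma measurable_F [measurable]: "F \<in> borel_measurable borel"
  unfolding F_def by measurable

lemma measurable_T [measurable]:
  assumes [measurable]: "f \<in> borel_measurable borel"
  shows "T f \<in> borel_measurable borel"
  unfolding T_def by measurable

text \<open>The reason for the summand 1 in F: powers of F serve as test functions, which must not
  vanish, and as the crossing scale w in \<open>suminf_le_geo_sum_bound\<close>, which must be at
  least 1.\<close>

lemma F_ge_1: "1 \<le> F x"
  by (simp add: F_def)

lemma P_P_u: "P j (P k u) x = P k (P j u) x"
  using tau unfolding P_def by (simp add: heat_heat add.commute)

lemma P_u_le: "P k u x \<le> ennreal (Y powr (a * real k))"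
  using heat_u_le by (simp add: P_def)

text \<open>The two averages commute and averaging does not raise an upper bound, so the bound of
  either index is available. Having both produces the two crossing estimates in
  \<open>P_F_le_powr\<close>.\<close>

lemma P_P_u_le_left: "P j (P k u) x \<le> ennreal (Y powr (a * real j))"
  unfolding P_P_u[of j k] unfolding P_def[of k] using tau by (intro heat_le P_u_le) simp

lemma P_P_u_le_right: "P j (P k u) x \<le> ennreal (Y powr (a * real k))"
  unfolding P_def[of j] using tau by (intro heat_le P_u_le) simp

lemma P_P_u_le_R: "P j (P k u) x \<le> ennreal (4 powr (real DIM('a) / 2)) * R (min j k) u x"
proof -
  define m where "m = min j k"
  define s where "s = \<tau> / 4 ^ j + \<tau> / 4 ^ k"
  have "\<tau> / 4 ^ m \<le> s"
    using tau by (auto simp: s_def m_def min_def)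
  moreover have "\<tau> / 4 ^ j \<le> \<tau> / 4 ^ m" "\<tau> / 4 ^ k \<le> \<tau> / 4 ^ m"
    using tau by (auto simp: m_def intro!: divide_left_mono power_increasing)
  then have "s \<le> 2 * (\<tau> / 4 ^ m)" by (simp add: s_def)
  moreover have "0 < \<tau> / 4 ^ m" using tau by simp
  ultimately have "heat s u x \<le> ennreal (4 powr (real DIM('a) / 2)) * heat (4 * \<tau> / 4 ^ m) u x"
    by (intro heat_le_heat) auto
  then show ?thesis using tau by (simp add: P_def R_def heat_heat s_def m_def)
qed

text \<open>Time 4 \<tau> lies outside the range of the hypothesis on u, but it is \<tau> followed
  by a further averaging of length 3 \<tau>, and the bound at time \<tau> is Y^0 = 1.\<close>

lemma R_0_u_le: "R 0 u x \<le> 1"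
proof -
  have "R 0 u x = heat (3 * \<tau>) (heat \<tau> u) x"
    using tau by (simp add: R_def heat_heat)
  also have "\<dots> \<le> 1"
    using tau heat_u_le[of 0] Y by (intro heat_le[of "heat \<tau> u"]) simp_all
  finally show ?thesis .
qed

lemma R_Suc: "R (Suc k) u = P k u"
  by (simp add: R_def P_def)

text \<open>Shifting the index turns R into P and only lowers the weights; the one term left over,
  \<open>R 0 u\<close>, is absorbed by the summand 1 of F.\<close>

lemma suminf_R_le_F: "(\<Sum>k. ennreal (Y powr (- \<sigma> * real k)) * R k u x) \<le> F x"
proof -
  have "(\<Sum>k. ennreal (Y powr (- \<sigma> * real k)) * R k u x)
    = (\<Sum>k. ennreal (Y powr (- \<sigma> * real (k + 1))) * R (k + 1) u x) + (\<Sum>k<1. ennreal (Y powr (- \<sigma> * real k)) * R k u x)"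
    by (rule suminf_offset) simp
  also have "\<dots> = (\<Sum>k. ennreal (Y powr (- \<sigma> * real (Suc k))) * P k u x) + R 0 u x"
    using Y by (simp add: R_Suc)
  also have "\<dots> \<le> (\<Sum>k. ennreal (Y powr (- \<sigma> * real k)) * P k u x) + 1"
    using Y \<sigma> by (intro add_mono suminf_le mult_right_mono R_0_u_le ennreal_leI powr_mono) auto
  finally show ?thesis by (simp add: F_def add.commute)
qed

lemma P_F: "P j F x = 1 + (\<Sum>k. ennreal (Y powr (- \<sigma> * real k)) * P j (P k u) x)"
proof -
  have [measurable]: "P k u \<in> borel_measurable borel" for k by measurable
  have "P j F x = heat (\<tau> / 4 ^ j) (\<lambda>x. 1) x
      + heat (\<tau> / 4 ^ j) (\<lambda>x. \<Sum>k. ennreal (Y powr (- \<sigma> * real k)) * P k u x) x"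
    unfolding P_def[of j] F_def by (rule heat_add) measurable
  then show ?thesis using tau
    by (simp add: heat_const heat_suminf heat_cmult P_def[of j])
qed

lemma P_F_le_F: "P j F x \<le> ennreal C1 * F x"
proof -
  define Q where "Q = Y powr (- \<sigma>)"
  define K where "K = 4 powr (real DIM('a) / 2)"
  have Q: "0 < Q" "Q < 1" using powr_neg_lt_1[OF Y \<sigma>(1)] Y by (auto simp: Q_def)
  have K: "0 \<le> K" by (simp add: K_def)
  have Qk: "Y powr (- \<sigma> * real k) = Q ^ k" for k
    using Y by (simp add: Q_def powr_powr flip: powr_realpow)
  define S where "S = (\<Sum>k. ennreal (Q ^ k) * R k u x)"
  have S: "S \<le> F x" unfolding S_def Qk[symmetric] by (rule suminf_R_le_F)
  have "(\<Sum>k. ennreal (Q ^ k) * P j (P k u) x)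
      \<le> (\<Sum>k. ennreal K * (ennreal (Q ^ k) * R (min j k) u x))"
    using P_P_u_le_R by (intro suminf_le) (auto simp: K_def mult.left_commute intro!: mult_left_mono)
  also have "\<dots> = ennreal K * (\<Sum>k. ennreal (Q ^ k) * R (min j k) u x)"
    by (rule ennreal_suminf_cmult)
  \<comment> \<open>Indices below j are covered by the full sum S. From j on the factor
    \<open>R j u\<close> is frozen, leaving the tail Q^j / (1 - Q), and Q^j \<open>R j u\<close> is
    a single term of S.\<close>
  also have "(\<Sum>k. ennreal (Q ^ k) * R (min j k) u x)
      \<le> (\<Sum>k. ennreal (Q ^ k) * R k u x + (if j \<le> k then ennreal (Q ^ k) * R j u x else 0))"
    by (intro suminf_le) (auto simp: min_def)
  also have "\<dots> = S + (\<Sum>k. if j \<le> k then ennreal (Q ^ k) * R j u x else 0)"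
    unfolding S_def by (subst suminf_add) auto
  also have "(\<Sum>k. if j \<le> k then ennreal (Q ^ k) * R j u x else 0)
     = (\<Sum>k. ennreal (Q ^ k) * (ennreal (Q ^ j) * R j u x))"
    using Q by (subst suminf_offset[where i = j])
       (auto simp: power_add ennreal_mult mult.assoc)
  also have "\<dots> = ennreal (1 / (1 - Q)) * (ennreal (Q ^ j) * R j u x)"
    using Q by (simp only: ennreal_suminf_multc suminf_ennreal_power less_imp_le)
  also have "ennreal (Q ^ j) * R j u x \<le> S"
    unfolding S_def using sum_le_suminf[of "\<lambda>k. ennreal (Q ^ k) * R k u x" "{j}"] by simp
  also have "S + ennreal (1 / (1 - Q)) * S \<le> F x + ennreal (1 / (1 - Q)) * F x"
    by (intro add_mono mult_left_mono S) auto
  finally have "(\<Sum>k. ennreal (Q ^ k) * P j (P k u) x) \<le> ennreal K * (F x + ennreal (1 / (1 - Q)) * F x)"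
    by (simp add: mult_left_mono)
  then have "P j F x \<le> F x + ennreal K * (F x + ennreal (1 / (1 - Q)) * F x)"
    unfolding P_F Qk by (intro add_mono F_ge_1)
  also have "\<dots> = (1 + ennreal K * (1 + ennreal (1 / (1 - Q)))) * F x"
    by (simp add: distrib_right distrib_left mult.assoc)
  also have "1 + ennreal K * (1 + ennreal (1 / (1 - Q))) = ennreal C1"
    using Q K unfolding C1_def K_def[symmetric] Q_def[symmetric]
    by (simp flip: ennreal_mult ennreal_plus ennreal_1)
  finally show ?thesis .
qed

text \<open>Small k are controlled by the growth Y^(a k) of \<open>P k u\<close>, large k by the
  fixed bound Y^(a j) against the weight Y^(- \<sigma> k). The two cross at k = j, that is at w =
  Y^j.\<close>

lemma P_F_le_powr: "P j F x \<le> ennreal (C2 * Y powr ((a - \<sigma>) * real j))"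
proof -
  have Yj: "1 \<le> Y powr real j" using Y by (simp add: ge_one_powr_ge_zero)
  have "(\<Sum>k. ennreal (Y powr (- \<sigma> * real k)) * P j (P k u) x)
      \<le> ennreal (1 * geo_sum_bound Y (a - \<sigma>) \<sigma> * (Y powr real j) powr (a - \<sigma>))"
  proof (rule suminf_le_geo_sum_bound)
    fix k
    have "ennreal (Y powr (- \<sigma> * real k)) * P j (P k u) x
        \<le> ennreal (Y powr (- \<sigma> * real k)) * ennreal (Y powr (a * real k))"
      by (intro mult_left_mono P_P_u_le_right) auto
    also have "\<dots> = ennreal (1 * Y powr ((a - \<sigma>) * real k))"
      by (simp add: algebra_simps flip: ennreal_mult powr_add)
    finally show "ennreal (Y powr (- \<sigma> * real k)) * P j (P k u) x
      \<le> ennreal (1 * Y powr ((a - \<sigma>) * real k))" .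
    have "ennreal (Y powr (- \<sigma> * real k)) * P j (P k u) x
        \<le> ennreal (Y powr (- \<sigma> * real k)) * ennreal (Y powr (a * real j))"
      by (intro mult_left_mono P_P_u_le_left) auto
    also have "\<dots> = ennreal (1 * (Y powr (- \<sigma> * real k) * (Y powr real j) powr (a - \<sigma> + \<sigma>)))"
      by (simp add: powr_powr mult.commute flip: ennreal_mult)
    finally show "ennreal (Y powr (- \<sigma> * real k)) * P j (P k u) x
      \<le> ennreal (1 * (Y powr (- \<sigma> * real k) * (Y powr real j) powr (a - \<sigma> + \<sigma>)))" .
  qed (use Y \<sigma> Yj in auto)
  moreover have "1 \<le> ennreal (Y powr ((a - \<sigma>) * real j))"
    using Y \<sigma> by (simp add: ge_one_powr_ge_zero)
  ultimately have "P j F x \<le> ennreal (Y powr ((a - \<sigma>) * real j))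
      + ennreal (geo_sum_bound Y (a - \<sigma>) \<sigma> * Y powr ((a - \<sigma>) * real j))"
    unfolding P_F by (intro add_mono) (simp_all add: powr_powr mult.commute)
  also have "\<dots> = ennreal (C2 * Y powr ((a - \<sigma>) * real j))"
    using geo_sum_bound_pos[of Y "a - \<sigma>" \<sigma>] Y \<sigma>
    by (simp add: C2_def distrib_right flip: ennreal_plus)
  finally show ?thesis .
qed

lemma P_u_le_F: "P j u x \<le> ennreal (Y powr (\<sigma> * real j)) * F x"
proof -
  have "ennreal (Y powr (- \<sigma> * real j)) * P j u x \<le> (\<Sum>k. ennreal (Y powr (- \<sigma> * real k)) * P k u x)"
    using sum_le_suminf[of "\<lambda>k. ennreal (Y powr (- \<sigma> * real k)) * P k u x" "{j}"] by simp
  also have "\<dots> \<le> F x" by (simp add: F_def)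
  finally have "ennreal (Y powr (\<sigma> * real j)) * (ennreal (Y powr (- \<sigma> * real j)) * P j u x)
      \<le> ennreal (Y powr (\<sigma> * real j)) * F x"
    by (rule mult_left_mono) simp
  moreover have "ennreal (Y powr (\<sigma> * real j)) * ennreal (Y powr (- \<sigma> * real j)) = 1"
    using Y by (simp flip: ennreal_mult powr_add)
  ultimately show ?thesis by (simp only: mult.assoc[symmetric] mult_1)
qed

text \<open>A single heat average of F is finite by \<open>P_F_le_powr\<close>, and the kernel is
  positive everywhere.\<close>

lemma AE_F_finite: "AE x in lborel. F x \<noteq> 0 \<and> F x \<noteq> \<top>"
proof -
  have "(\<integral>\<^sup>+y. ennreal (heat_kernel \<tau> (0 - y)) * F y \<partial>lborel) \<noteq> \<infinity>"
    using P_F_le_powr[of 0 0] by (auto simp: P_def heat_def top_unique)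
  then have "AE y in lborel. ennreal (heat_kernel \<tau> (0 - y)) * F y \<noteq> \<infinity>"
    by (intro nn_integral_PInf_AE) auto
  moreover have "ennreal (heat_kernel \<tau> (0 - y)) \<noteq> 0" for y :: 'a
    using heat_kernel_pos[OF tau, of "0 - y"] by simp
  moreover have "F x \<noteq> 0" for x using F_ge_1[of x] by auto
  ultimately show ?thesis by (auto simp: ennreal_mult_eq_top_iff)
qed

text \<open>One kernel for the whole sum makes \<open>nn_integral_Schur\<close> applicable to
  T.\<close>

lemma T_kernel:
  assumes [measurable]: "f \<in> borel_measurable borel"
  shows "T f x = (\<integral>\<^sup>+y. (\<Sum>k. ennreal (Y powr (- real k)) * ennreal (heat_kernel (\<tau> / 4 ^ k) (x - y))) * f y \<partial>lborel)"
  unfolding T_def P_def heat_def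
  by (subst nn_integral_cmult[symmetric], measurable, subst nn_integral_suminf[symmetric], measurable)
     (simp add: mult.assoc[symmetric])

lemma T_adjoint:
  assumes [measurable]: "f \<in> borel_measurable borel" "g \<in> borel_measurable borel"
  shows "(\<integral>\<^sup>+x. T f x * g x \<partial>lborel) = (\<integral>\<^sup>+x. f x * T g x \<partial>lborel)"
proof -
  have "(\<integral>\<^sup>+x. T f x * g x \<partial>lborel) = (\<Sum>k. \<integral>\<^sup>+x. ennreal (Y powr (- real k)) * (P k f x * g x) \<partial>lborel)"
    unfolding T_def by (subst nn_integral_suminf[symmetric]) (auto simp: mult.assoc[symmetric])
  also have "\<dots> = (\<Sum>k. \<integral>\<^sup>+x. ennreal (Y powr (- real k)) * (f x * P k g x) \<partial>lborel)"
    by (simp add: nn_integral_cmult P_def heat_adjoint)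
  also have "\<dots> = (\<integral>\<^sup>+x. f x * T g x \<partial>lborel)"
    unfolding T_def by (subst nn_integral_suminf[symmetric])
      (auto simp: mult.left_commute simp flip: ennreal_suminf_cmult)
  finally show ?thesis .
qed

text \<open>\<open>suminf_le_geo_sum_bound\<close> wants the same constant in both of its estimates,
  so the constants of \<open>P_F_le_F\<close> and \<open>P_F_le_powr\<close> are merged.\<close>

definition C3 :: real where
  "C3 = max C1 C2"

lemma C3_ge: "1 \<le> C3"
  using C1_ge by (simp add: C3_def)

lemma epowr_P_F_le_F:
  assumes "0 < s"
  shows "epowr (P j F x) s \<le> ennreal (C3 powr s) * epowr (F x) s"
proof -
  have "P j F x \<le> ennreal C3 * F x"
    by (rule order_trans[OF P_F_le_F]) (auto simp: C3_def intro!: mult_right_mono ennreal_leI)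
  then have "epowr (P j F x) s \<le> epowr (ennreal C3 * F x) s"
    using assms by (rule epowr_mono)
  then show ?thesis using assms C3_ge by (simp add: epowr_mult epowr_ennreal)
qed

lemma epowr_P_F_le_powr:
  assumes "0 < s"
  shows "epowr (P j F x) s \<le> ennreal (C3 powr s * Y powr ((a - \<sigma>) * s * real j))"
proof -
  have "P j F x \<le> ennreal (C3 * Y powr ((a - \<sigma>) * real j))"
    by (rule order_trans[OF P_F_le_powr]) (auto simp: C3_def intro!: mult_right_mono ennreal_leI)
  then have "epowr (P j F x) s \<le> epowr (ennreal (C3 * Y powr ((a - \<sigma>) * real j))) s"
    using assms by (rule epowr_mono)
  then show ?thesis using assms C3_ge
    by (simp add: epowr_ennreal powr_mult powr_powr mult_ac)
qed

text \<open>Put w = F^(1 / (a - \<sigma>)). The heat average at level k of w^\<gamma> is bounded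
  both by Y^(\<gamma> k) and by w^\<gamma>, because \<gamma> \<le> a - \<sigma> makes the power of F
  concave. With the weight Y^(- k) the first bound grows, as \<gamma> > 1, and the second decays;
  they cross at Y^k = w and leave w^(\<gamma> - 1).\<close>

lemma T_F_le:
  assumes \<gamma>: "1 < \<gamma>" "\<gamma> \<le> a - \<sigma>"
  shows "T (\<lambda>x. epowr (F x) (\<gamma> / (a - \<sigma>))) x
    \<le> ennreal (C3 powr (\<gamma> / (a - \<sigma>)) * geo_sum_bound Y (\<gamma> - 1) 1) * epowr (F x) ((\<gamma> - 1) / (a - \<sigma>))"
proof -
  define b where "b = a - \<sigma>"
  define K where "K = C3 powr (\<gamma> / b)"
  have b: "0 < b" "\<gamma> \<le> b" "1 < b" using \<gamma> by (auto simp: b_def)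
  have pos: "0 < K * geo_sum_bound Y (\<gamma> - 1) 1"
    using geo_sum_bound_pos[of Y "\<gamma> - 1" 1] Y \<gamma> C3_ge by (simp add: K_def)
  show ?thesis unfolding b_def[symmetric] K_def[symmetric]
  proof (cases "F x")
    \<comment> \<open>The estimate is pointwise, while F may be infinite on a null set; there the
      right-hand side is infinite since \<gamma> > 1.\<close>
    case top
    then have "epowr (F x) ((\<gamma> - 1) / b) = \<top>" using \<gamma> b by simp
    moreover have "ennreal (K * geo_sum_bound Y (\<gamma> - 1) 1) \<noteq> 0" using pos by (simp only: ennreal_eq_0_iff not_le)
    ultimately show "T (\<lambda>x. epowr (F x) (\<gamma> / b)) x \<le> ennreal (K * geo_sum_bound Y (\<gamma> - 1) 1) * epowr (F x) ((\<gamma> - 1) / b)"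
      by (simp only: ennreal_mult_top if_False top_greatest)
  next
    case (real f)
    have f: "1 \<le> f" using F_ge_1[of x] real by simp
    define w where "w = f powr (1 / b)"
    have w: "1 \<le> w" using f b by (simp add: w_def ge_one_powr_ge_zero)
    have "T (\<lambda>x. epowr (F x) (\<gamma> / b)) x \<le> ennreal (K * geo_sum_bound Y (\<gamma> - 1) 1 * w powr (\<gamma> - 1))"
      unfolding T_def
    proof (rule suminf_le_geo_sum_bound)
      fix k
      have 0: "P k (\<lambda>x. epowr (F x) (\<gamma> / b)) x \<le> epowr (P k F x) (\<gamma> / b)"
        unfolding P_def using b \<gamma> tau by (intro heat_epowr_le) auto
      also have "\<dots> \<le> ennreal (K * Y powr (b * (\<gamma> / b) * real k))"
        using epowr_P_F_le_powr[of "\<gamma> / b" k x] b \<gamma> by (simp add: b_def K_def)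
      finally have "ennreal (Y powr (- real k)) * P k (\<lambda>x. epowr (F x) (\<gamma> / b)) x
          \<le> ennreal (Y powr (- real k)) * ennreal (K * Y powr (\<gamma> * real k))"
        using b by (intro mult_left_mono) auto
      also have "\<dots> = ennreal (K * (Y powr (- real k) * Y powr (\<gamma> * real k)))"
        by (simp add: mult_ac K_def flip: ennreal_mult)
      also have "Y powr (- real k) * Y powr (\<gamma> * real k) = Y powr ((\<gamma> - 1) * real k)"
        by (simp add: algebra_simps flip: powr_add)
      finally show "ennreal (Y powr (- real k)) * P k (\<lambda>x. epowr (F x) (\<gamma> / b)) x
          \<le> ennreal (K * Y powr ((\<gamma> - 1) * real k))" .
      have "P k (\<lambda>x. epowr (F x) (\<gamma> / b)) x \<le> ennreal K * epowr (F x) (\<gamma> / b)"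
        using order_trans[OF 0 epowr_P_F_le_F] b \<gamma> by (simp add: K_def)
      also have "\<dots> = ennreal (K * w powr (\<gamma> - 1 + 1))"
        using f b \<gamma> unfolding real by (simp add: epowr_ennreal w_def powr_powr K_def flip: ennreal_mult)
      finally have "ennreal (Y powr (- real k)) * P k (\<lambda>x. epowr (F x) (\<gamma> / b)) x
          \<le> ennreal (Y powr (- real k)) * ennreal (K * w powr (\<gamma> - 1 + 1))"
        by (intro mult_left_mono) auto
      also have "\<dots> = ennreal (K * (Y powr (- 1 * real k) * w powr (\<gamma> - 1 + 1)))"
        by (simp add: mult_ac K_def flip: ennreal_mult)
      finally show "ennreal (Y powr (- real k)) * P k (\<lambda>x. epowr (F x) (\<gamma> / b)) x
          \<le> ennreal (K * (Y powr (- 1 * real k) * w powr (\<gamma> - 1 + 1)))" .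
    qed (use Y \<gamma> w in \<open>auto simp: K_def\<close>)
    also have "w powr (\<gamma> - 1) = f powr ((\<gamma> - 1) / b)" using f by (simp add: w_def powr_powr)
    also have "ennreal (K * geo_sum_bound Y (\<gamma> - 1) 1 * f powr ((\<gamma> - 1) / b))
        = ennreal (K * geo_sum_bound Y (\<gamma> - 1) 1) * epowr (F x) ((\<gamma> - 1) / b)"
      using f b \<gamma> pos unfolding real by (simp add: epowr_ennreal flip: ennreal_mult)
    finally show "T (\<lambda>x. epowr (F x) (\<gamma> / b)) x \<le> ennreal (K * geo_sum_bound Y (\<gamma> - 1) 1) * epowr (F x) ((\<gamma> - 1) / b)" .
  qed
qed

text \<open>The product has degree p + e and T lowers it by one. Hoelder separates u from F. For
  small k, \<open>P_u_le\<close> gives the growth Y^((p + e - 1) k); for large k,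
  \<open>P_u_le_F\<close> trades u for F at the price Y^(\<sigma> k), leaving the decay rate B = 1 -
  \<sigma> p / a, positive by hypothesis. The exponents match because b s + e = p + e - 1 + B, where
  b = a - \<sigma> and s = p / a.\<close>

lemma T_u_F_le:
  assumes p: "1 < p" "p < a" and e: "0 < e" "e / (1 - p / a) \<le> a - \<sigma>" and \<sigma>': "\<sigma> * p / a < 1"
  shows "T (\<lambda>x. epowr (u x) (p / a) * epowr (F x) (e / (a - \<sigma>))) x
    \<le> ennreal (C3 powr (e / (a - \<sigma>)) * geo_sum_bound Y (p + e - 1) (1 - \<sigma> * p / a)) *
       epowr (F x) ((p + e - 1) / (a - \<sigma>))"
proof -
  define b where "b = a - \<sigma>"
  define s where "s = p / a"
  define K where "K = C3 powr (e / b)"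
  define B where "B = 1 - \<sigma> * s"
  have b: "0 < b" using \<sigma> by (auto simp: b_def)
  have s: "0 < s" "s < 1" "a * s = p" using p by (auto simp: s_def)
  have B: "0 < B" using \<sigma>' by (simp add: B_def s_def)
  \<comment> \<open>The exponent left on F after Hoelder with s and 1 - s. Concave Jensen needs t
    \<le> 1, which is the hypothesis on e / (1 - p / a); it can be met because p < a.\<close>
  define t where "t = e / (b * (1 - s))"
  have "0 < b * (1 - s)" using b s by simp
  moreover have "e \<le> b * (1 - s)"
    using e(2) s unfolding s_def[symmetric] b_def[symmetric] by (simp add: pos_divide_le_eq)
  ultimately have t: "0 < t" "t \<le> 1" "t * (1 - s) = e / b"
    using e s b by (auto simp: t_def divide_le_eq_1_pos)
  have pos: "0 < K * geo_sum_bound Y (p + e - 1) B"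
    using geo_sum_bound_pos[of Y "p + e - 1" B] Y p e B C3_ge by (simp add: K_def)
  have 0: "P k (\<lambda>x. epowr (u x) s * epowr (F x) (e / b)) x \<le> epowr (P k u x) s * epowr (P k F x) (e / b)" for k x
  proof -
    have "P k (\<lambda>x. epowr (u x) s * epowr (F x) (e / b)) x
        = P k (\<lambda>x. epowr (u x) s * epowr (epowr (F x) t) (1 - s)) x"
      using s t by (simp add: epowr_epowr)
    also have "\<dots> \<le> epowr (P k u x) s * epowr (P k (\<lambda>x. epowr (F x) t) x) (1 - s)"
      unfolding P_def using s by (intro heat_Hoelder) auto
    also have "\<dots> \<le> epowr (P k u x) s * epowr (epowr (P k F x) t) (1 - s)"
      unfolding P_def using s t tau by (intro mult_left_mono epowr_mono heat_epowr_le) auto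
    finally show ?thesis using s t by (simp add: epowr_epowr)
  qed
  show ?thesis unfolding b_def[symmetric] K_def[symmetric] s_def[symmetric] times_divide_eq_right[symmetric] B_def[symmetric]
  proof (cases "F x")
    case top
    then have "epowr (F x) ((p + e - 1) / b) = \<top>" using p e b by simp
    moreover have "ennreal (K * geo_sum_bound Y (p + e - 1) B) \<noteq> 0" using pos by (simp only: ennreal_eq_0_iff not_le)
    ultimately show "T (\<lambda>x. epowr (u x) s * epowr (F x) (e / b)) x
        \<le> ennreal (K * geo_sum_bound Y (p + e - 1) B) * epowr (F x) ((p + e - 1) / b)"
      by (simp only: ennreal_mult_top if_False top_greatest)
  next
    case (real f)
    have f: "1 \<le> f" using F_ge_1[of x] real by simp
    define w where "w = f powr (1 / b)"
    have w: "1 \<le> w" using f b by (simp add: w_def ge_one_powr_ge_zero)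
    have "T (\<lambda>x. epowr (u x) s * epowr (F x) (e / b)) x \<le> ennreal (K * geo_sum_bound Y (p + e - 1) B * w powr (p + e - 1))"
      unfolding T_def
    proof (rule suminf_le_geo_sum_bound)
      fix k
      let ?X = "P k (\<lambda>x. epowr (u x) s * epowr (F x) (e / b)) x"
      have ask: "a * real k * s = p * real k" by (subst s(3)[symmetric]) simp
      have "epowr (P k u x) s \<le> epowr (ennreal (Y powr (a * real k))) s"
        using s by (intro epowr_mono P_u_le)
      also have "\<dots> = ennreal (Y powr (p * real k))"
        using s by (simp add: epowr_ennreal powr_powr ask)
      finally have "?X \<le> ennreal (Y powr (p * real k)) * ennreal (K * Y powr (b * (e / b) * real k))"
        using epowr_P_F_le_powr[of "e / b" k x] b e
        by (intro order_trans[OF 0] mult_mono) (simp_all add: b_def K_def)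
      then have "ennreal (Y powr (- real k)) * ?X
          \<le> ennreal (Y powr (- real k)) * (ennreal (Y powr (p * real k)) * ennreal (K * Y powr (e * real k)))"
        using b by (intro mult_left_mono) auto
      also have "\<dots> = ennreal (K * (Y powr (- real k) * Y powr (p * real k) * Y powr (e * real k)))"
        by (simp add: mult_ac K_def flip: ennreal_mult)
      also have "Y powr (- real k) * Y powr (p * real k) * Y powr (e * real k) = Y powr ((p + e - 1) * real k)"
        by (simp add: algebra_simps flip: powr_add)
      finally show "ennreal (Y powr (- real k)) * ?X \<le> ennreal (K * Y powr ((p + e - 1) * real k))" .
      have "epowr (P k u x) s \<le> epowr (ennreal (Y powr (\<sigma> * real k)) * F x) s"
        using s by (intro epowr_mono P_u_le_F)
      also have "\<dots> = ennreal (Y powr (\<sigma> * s * real k) * f powr s)"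
        using s f unfolding real by (simp add: epowr_ennreal powr_mult powr_powr mult_ac flip: ennreal_mult)
      finally have "?X \<le> ennreal (Y powr (\<sigma> * s * real k) * f powr s) * (ennreal K * ennreal (f powr (e / b)))"
        using epowr_P_F_le_F[of "e / b" k x] b e f unfolding real
        by (intro order_trans[OF 0] mult_mono) (simp_all add: K_def epowr_ennreal)
      then have "ennreal (Y powr (- real k)) * ?X
          \<le> ennreal (Y powr (- real k)) * (ennreal (Y powr (\<sigma> * s * real k) * f powr s) * (ennreal K * ennreal (f powr (e / b))))"
        by (intro mult_left_mono) auto
      also have "\<dots> = ennreal (K * ((Y powr (- real k) * Y powr (\<sigma> * s * real k)) * (f powr s * f powr (e / b))))"
        by (simp add: mult_ac K_def flip: ennreal_mult)
      also have "Y powr (- real k) * Y powr (\<sigma> * s * real k) = Y powr (- B * real k)"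
        by (simp add: B_def algebra_simps flip: powr_add)
      also have "f powr s * f powr (e / b) = w powr (p + e - 1 + B)"
      proof -
        have "p + e - 1 + B = b * s + e" by (simp add: B_def b_def left_diff_distrib s)
        then have "1 / b * (p + e - 1 + B) = s + e / b" using b by (simp add: field_simps)
        then show ?thesis unfolding w_def powr_powr by (simp only: powr_add)
      qed
      finally show "ennreal (Y powr (- real k)) * ?X \<le> ennreal (K * (Y powr (- B * real k) * w powr (p + e - 1 + B)))" .
    qed (use Y p e w B in \<open>auto simp: K_def\<close>)
    also have "w powr (p + e - 1) = f powr ((p + e - 1) / b)" using f by (simp add: w_def powr_powr)
    also have "ennreal (K * geo_sum_bound Y (p + e - 1) B * f powr ((p + e - 1) / b))
        = ennreal (K * geo_sum_bound Y (p + e - 1) B) * epowr (F x) ((p + e - 1) / b)"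
      using f b p e pos unfolding real by (simp add: epowr_ennreal flip: ennreal_mult)
    finally show "T (\<lambda>x. epowr (u x) s * epowr (F x) (e / b)) x
        \<le> ennreal (K * geo_sum_bound Y (p + e - 1) B) * epowr (F x) ((p + e - 1) / b)" .
  qed
qed

text \<open>Schur's test with U = F^(\<gamma> / b), b = a - \<sigma>. By \<open>T_F_le\<close> the
  factor (T U)^(p - 1) is at most a constant times F^(e / b), which dictates e = (\<gamma> - 1) (p -
  1). Moving T to the weight by symmetry and using \<open>T_u_F_le\<close> yields F^((p + e - 1) /
  b), and p + e - 1 = \<gamma> (p - 1), so this cancels U^(1 - p) exactly.\<close>

lemma trace_inequality:
  assumes p: "1 < p" "p < a" and \<gamma>: "1 < \<gamma>" "\<gamma> \<le> a - \<sigma>"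
    and e: "e = (\<gamma> - 1) * (p - 1)" "e / (1 - p / a) \<le> a - \<sigma>" and \<sigma>': "\<sigma> * p / a < 1"
    and [measurable]: "f \<in> borel_measurable borel"
  shows "(\<integral>\<^sup>+x. epowr (T f x) p * epowr (u x) (p / a) \<partial>lborel)
    \<le> ennreal ((C3 powr (\<gamma> / (a - \<sigma>)) * geo_sum_bound Y (\<gamma> - 1) 1) powr (p - 1) *
        (C3 powr (e / (a - \<sigma>)) * geo_sum_bound Y (p + e - 1) (1 - \<sigma> * p / a))) *
      (\<integral>\<^sup>+x. epowr (f x) p \<partial>lborel)"
proof -
  define b where "b = a - \<sigma>"
  define D where "D = C3 powr (\<gamma> / b) * geo_sum_bound Y (\<gamma> - 1) 1"
  define D' where "D' = C3 powr (e / b) * geo_sum_bound Y (p + e - 1) (1 - \<sigma> * p / a)"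
  have e0: "0 < e" using p \<gamma> by (simp add: e(1))
  have b: "0 < b" using \<sigma> by (simp add: b_def)
  have D: "0 < D" "0 < D'"
    using geo_sum_bound_pos[of Y "\<gamma> - 1" 1] geo_sum_bound_pos[of Y "p + e - 1" "1 - \<sigma> * p / a"] Y \<gamma> p e0 \<sigma>' C3_ge
    by (simp_all add: D_def D'_def)
  define U where "U x = epowr (F x) (\<gamma> / b)" for x
  have [measurable]: "U \<in> borel_measurable borel" unfolding U_def by measurable
  have U: "AE x in lborel. U x \<noteq> 0 \<and> U x \<noteq> \<top>"
    by (rule eventually_mono[OF AE_F_finite])
       (use b \<gamma> in \<open>simp add: U_def epowr_eq_0_iff epowr_eq_top_iff\<close>)
  define g where "g x = epowr (f x) p * epowr (U x) (1 - p)" for x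
  have [measurable]: "g \<in> borel_measurable borel" unfolding g_def by measurable
  have row: "epowr (T f x) p \<le> ennreal (D powr (p - 1)) * (epowr (F x) (e / b) * T g x)" for x
  proof -
    have "epowr (T f x) p \<le> epowr (T U x) (p - 1) * T g x"
      unfolding T_kernel[OF \<open>f \<in> borel_measurable borel\<close>] T_kernel[OF \<open>U \<in> borel_measurable borel\<close>]
        T_kernel[OF \<open>g \<in> borel_measurable borel\<close>] g_def
      using p U by (intro nn_integral_Schur) auto
    also have "T U x \<le> ennreal D * epowr (F x) ((\<gamma> - 1) / b)"
      using T_F_le[OF \<gamma>] by (simp add: U_def[abs_def] D_def b_def)
    then have "epowr (T U x) (p - 1) \<le> epowr (ennreal D * epowr (F x) ((\<gamma> - 1) / b)) (p - 1)"
      using p by (intro epowr_mono) auto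
    also have "\<dots> = ennreal (D powr (p - 1)) * epowr (F x) (e / b)"
      using p D \<gamma> b by (simp add: epowr_mult epowr_ennreal epowr_epowr e(1))
    finally show ?thesis by (simp add: mult_right_mono mult.assoc)
  qed
  \<comment> \<open>Where F is infinite, the negative power of U is 0 and the product is 0 by the
    convention 0 * \<infinity> = 0.\<close>
  have fin: "g x * epowr (F x) ((p + e - 1) / b) \<le> epowr (f x) p" for x
  proof -
    have "epowr (U x) (1 - p) * epowr (F x) ((p + e - 1) / b) \<le> 1"
    proof (cases "F x")
      case top
      then have "U x = \<top>" using b \<gamma> by (simp add: U_def)
      then show ?thesis using p by (simp add: epowr_def[of \<top>])
    next
      case (real h)
      have h: "1 \<le> h" using F_ge_1[of x] real by simp
      have "(p + e - 1) / b = \<gamma> / b * (p - 1)" by (simp add: e(1) field_simps)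
      then have "\<gamma> / b * (1 - p) + (p + e - 1) / b = 0"
        by (simp only: distrib_left[symmetric]) simp
      then have "(h powr (\<gamma> / b)) powr (1 - p) * h powr ((p + e - 1) / b) = 1"
        using h by (simp only: powr_powr powr_add[symmetric]) simp
      then show ?thesis using h unfolding U_def real
        by (simp add: epowr_ennreal_pos flip: ennreal_mult)
    qed
    from mult_left_mono[OF this, of "epowr (f x) p"] show ?thesis by (simp add: g_def mult.assoc)
  qed
  have "(\<integral>\<^sup>+x. epowr (T f x) p * epowr (u x) (p / a) \<partial>lborel)
    \<le> (\<integral>\<^sup>+x. ennreal (D powr (p - 1)) * (T g x * (epowr (u x) (p / a) * epowr (F x) (e / b))) \<partial>lborel)"
  proof (intro nn_integral_mono)
    fix x
    show "epowr (T f x) p * epowr (u x) (p / a)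
      \<le> ennreal (D powr (p - 1)) * (T g x * (epowr (u x) (p / a) * epowr (F x) (e / b)))"
      using mult_right_mono[OF row[of x], of "epowr (u x) (p / a)"] by (simp add: mult_ac)
  qed
  also have "\<dots> = ennreal (D powr (p - 1)) *
      (\<integral>\<^sup>+x. g x * T (\<lambda>x. epowr (u x) (p / a) * epowr (F x) (e / b)) x \<partial>lborel)"
    by (subst nn_integral_cmult) (auto simp: T_adjoint)
  also have "(\<integral>\<^sup>+x. g x * T (\<lambda>x. epowr (u x) (p / a) * epowr (F x) (e / b)) x \<partial>lborel)
      \<le> (\<integral>\<^sup>+x. ennreal D' * epowr (f x) p \<partial>lborel)"
  proof (intro nn_integral_mono)
    fix x
    have "g x * T (\<lambda>x. epowr (u x) (p / a) * epowr (F x) (e / b)) x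
        \<le> g x * (ennreal D' * epowr (F x) ((p + e - 1) / b))"
      using T_u_F_le[OF p e0 e(2) \<sigma>'] by (intro mult_left_mono) (simp_all add: D'_def b_def)
    also have "\<dots> = ennreal D' * (g x * epowr (F x) ((p + e - 1) / b))" by (simp only: mult_ac)
    also have "\<dots> \<le> ennreal D' * epowr (f x) p" by (intro mult_left_mono fin) auto
    finally show "g x * T (\<lambda>x. epowr (u x) (p / a) * epowr (F x) (e / b)) x \<le> ennreal D' * epowr (f x) p" .
  qed
  also have "\<dots> = ennreal D' * (\<integral>\<^sup>+x. epowr (f x) p \<partial>lborel)"
    by (rule nn_integral_cmult) measurable
  finally show ?thesis
    using D by (simp add: D_def D'_def b_def ennreal_mult mult_left_mono mult.assoc)
qed

end

text \<open>The point is the order of quantifiers: C depends on p, a, Y and the dimension only and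
  is fixed before u, f and \<tau>.\<close>

lemma dyadic_heat_trace:
  assumes p: "1 < p" "p < a" and Y: "1 < (Y::real)"
  shows "\<exists>C>0. \<forall>(u::'a::euclidean_space \<Rightarrow> ennreal) f \<tau>. u \<in> borel_measurable borel \<longrightarrow>
    f \<in> borel_measurable borel \<longrightarrow> 0 < \<tau> \<longrightarrow>
    (\<forall>k x. heat (\<tau> / 4 ^ k) u x \<le> ennreal (Y powr (a * real k))) \<longrightarrow>
    (\<integral>\<^sup>+x. epowr (\<Sum>k. ennreal (Y powr (- real k)) * heat (\<tau> / 4 ^ k) f x) p * epowr (u x) (p / a) \<partial>lborel)
      \<le> ennreal C * (\<integral>\<^sup>+x. epowr (f x) p \<partial>lborel)"
proof -
  \<comment> \<open>\<sigma> \<le> 1 together with p < a gives \<sigma> p / a < 1, and \<sigma>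
    \<le> (a - 1) / 2 gives a - \<sigma> > 1, which leaves room for \<gamma> > 1.\<close>
  define \<sigma> where "\<sigma> = min 1 ((a - 1) / 2)"
  define b where "b = a - \<sigma>"
  have \<sigma>: "0 < \<sigma>" "\<sigma> < a" "\<sigma> \<le> 1" "1 < b"
    using p by (auto simp: \<sigma>_def b_def min_def field_simps)
  have "\<sigma> * p \<le> 1 * p" using \<sigma> p by (intro mult_right_mono) auto
  then have "\<sigma> * p < a" using p by linarith
  then have \<sigma>': "\<sigma> * p / a < 1" using p by (simp add: divide_less_eq)
  \<comment> \<open>The first entry of the minimum ensures \<gamma> \<le> b, the second e \<le> b (1
    - p / a).\<close>
  define \<gamma> where "\<gamma> = 1 + min (b - 1) (b * (1 - p / a) / (p - 1))"
  define e where "e = (\<gamma> - 1) * (p - 1)"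
  have pa: "0 < 1 - p / a" using p by simp
  have \<gamma>: "1 < \<gamma>" "\<gamma> \<le> b" using \<sigma> p pa by (auto simp: \<gamma>_def)
  have "\<gamma> - 1 \<le> b * (1 - p / a) / (p - 1)" by (simp add: \<gamma>_def)
  then have "e \<le> b * (1 - p / a)" using p by (simp add: e_def pos_le_divide_eq)
  then have e: "e / (1 - p / a) \<le> b" using pa by (simp add: pos_divide_le_eq)
  \<comment> \<open>The locale constants do not depend on u, but C has to be named before u is
    fixed; hence they are spelled out here.\<close>
  define c1 where "c1 = 1 + 4 powr (real DIM('a) / 2) * (1 + 1 / (1 - Y powr (- \<sigma>)))"
  define c2 where "c2 = 1 + geo_sum_bound Y (a - \<sigma>) \<sigma>"
  define c3 where "c3 = max c1 c2"
  define C where "C = (c3 powr (\<gamma> / (a - \<sigma>)) * geo_sum_bound Y (\<gamma> - 1) 1) powr (p - 1) *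
        (c3 powr (e / (a - \<sigma>)) * geo_sum_bound Y (p + e - 1) (1 - \<sigma> * p / a))"
  have "1 \<le> c1" using powr_neg_lt_1[OF Y \<sigma>(1)] by (simp add: c1_def)
  then have "1 \<le> c3" by (simp add: c3_def)
  moreover have "0 < e" using \<gamma> p by (simp add: e_def)
  ultimately have "0 < C"
    using geo_sum_bound_pos[of Y "\<gamma> - 1" 1] geo_sum_bound_pos[of Y "p + e - 1" "1 - \<sigma> * p / a"] Y \<gamma> p \<sigma>'
    by (simp add: C_def)
  moreover have "(\<integral>\<^sup>+x. epowr (\<Sum>k. ennreal (Y powr (- real k)) * heat (\<tau> / 4 ^ k) f x) p * epowr (u x) (p / a) \<partial>lborel)
      \<le> ennreal C * (\<integral>\<^sup>+x. epowr (f x) p \<partial>lborel)"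
    if "u \<in> borel_measurable borel" "f \<in> borel_measurable borel" "0 < \<tau>"
      "\<forall>k x. heat (\<tau> / 4 ^ k) u x \<le> ennreal (Y powr (a * real k))"
    for u f :: "'a \<Rightarrow> ennreal" and \<tau>
  proof -
    interpret dyadic_heat u \<tau> Y a \<sigma>
      using that Y \<sigma> by unfold_locales auto
    show ?thesis
      using trace_inequality[OF p \<gamma>(1) \<gamma>(2)[unfolded b_def] e_def e[unfolded b_def] \<sigma>' that(2)]
      by (simp only: T_def P_def C_def c3_def c2_def c1_def C3_def C2_def C1_def)
  qed
  ultimately show ?thesis by blast
qed

section \<open>Differences of truncated powers\<close>

definition trunc_powr :: "real \<Rightarrow> real \<Rightarrow> real" where
  "trunc_powr \<beta> s = (if 0 < s then s powr \<beta> else 0)"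

lemma trunc_powr_nonneg [simp]: "0 \<le> trunc_powr \<beta> s"
  by (simp add: trunc_powr_def)

lemma measurable_trunc_powr [measurable]: "trunc_powr \<beta> \<in> borel_measurable borel"
  unfolding trunc_powr_def by measurable

text \<open>The backward difference makes the density integrable at infinity and multiplies the Laplace
  transform \<open>\<zeta> powr (- \<beta> - 1)\<close> of the truncated power by \<open>(1 - exp (- \<zeta>)) ^ m\<close>.\<close>

definition fdiff :: "nat \<Rightarrow> real \<Rightarrow> real \<Rightarrow> real" where
  "fdiff m \<beta> s = (\<Sum>j\<le>m. (- 1) ^ j * real (m choose j) * trunc_powr \<beta> (s - real j))"

lemma measurable_fdiff [measurable]: "fdiff m \<beta> \<in> borel_measurable borel"
  unfolding fdiff_def by measurable

text \<open>On this interval only j = 0 contributes. Below time \<tau> the representation is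
  therefore exactly the Riesz density, to which the dyadic trace inequality applies.\<close>

lemma fdiff_eq_powr:
  assumes "0 < s" "s \<le> 1" shows "fdiff m \<beta> s = s powr \<beta>"
proof -
  have "fdiff m \<beta> s = (\<Sum>j\<in>{0}. (- 1) ^ j * real (m choose j) * trunc_powr \<beta> (s - real j))"
    unfolding fdiff_def by (rule sum.mono_neutral_right) (use assms in \<open>auto simp: trunc_powr_def\<close>)
  then show ?thesis using assms by (simp add: trunc_powr_def)
qed

text \<open>Pascal's rule: a difference of order m + 1 is the first difference of one of order
  m.\<close>

lemma binomial_difference_Suc:
  fixes f :: "real \<Rightarrow> real"
  shows "(\<Sum>j\<le>Suc m. (- 1) ^ j * real (Suc m choose j) * f (s - real j))
    = (\<Sum>j\<le>m. (- 1) ^ j * real (m choose j) * f (s - real j))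
      - (\<Sum>j\<le>m. (- 1) ^ j * real (m choose j) * f (s - 1 - real j))"
proof -
  have "(\<Sum>j\<le>Suc m. (- 1) ^ j * real (m choose j) * f (s - real j))
      = f s + (\<Sum>j\<le>m. (- 1) ^ Suc j * real (m choose Suc j) * f (s - real (Suc j)))"
    by (subst sum.atMost_Suc_shift) simp
  moreover have "(\<Sum>j\<le>Suc m. (- 1) ^ j * real (m choose j) * f (s - real j))
      = (\<Sum>j\<le>m. (- 1) ^ j * real (m choose j) * f (s - real j))"
    by (simp add: binomial_eq_0)
  moreover have "(\<Sum>j\<le>Suc m. (- 1) ^ j * real (Suc m choose j) * f (s - real j))
      = f s + (\<Sum>j\<le>m. (- 1) ^ Suc j * real (Suc m choose Suc j) * f (s - real (Suc j)))"
    by (subst sum.atMost_Suc_shift) simp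
  moreover have "(\<Sum>j\<le>m. (- 1) ^ Suc j * real (Suc m choose Suc j) * f (s - real (Suc j)))
      = (\<Sum>j\<le>m. (- 1) ^ Suc j * real (m choose Suc j) * f (s - real (Suc j)))
        - (\<Sum>j\<le>m. (- 1) ^ j * real (m choose j) * f (s - 1 - real j))"
    unfolding sum_subtractf[symmetric]
    by (intro sum.cong) (auto simp: algebra_simps)
  ultimately show ?thesis by simp
qed

text \<open>By the mean value theorem each difference costs one derivative and so gains one power of
  decay. The intermediate point lies in (s - 1, s), which is why the bound is centred at m and not
  at 0; the condition on \<beta> makes the power decreasing there.\<close>

lemma binomial_difference_powr_le:
  "\<beta> \<le> real m \<Longrightarrow> \<exists>C\<ge>0. \<forall>s. real m < s \<longrightarrow>
    \<bar>\<Sum>j\<le>m. (- 1) ^ j * real (m choose j) * (s - real j) powr \<beta>\<bar> \<le> C * (s - real m) powr (\<beta> - real m)"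
proof (induction m arbitrary: \<beta>)
  case 0
  then show ?case by (intro exI[of _ 1]) auto
next
  case (Suc m)
  define \<Delta> where "\<Delta> \<beta> s = (\<Sum>j\<le>m. (- 1) ^ j * real (m choose j) * (s - real j) powr \<beta>)" for \<beta> s
  obtain C where C: "0 \<le> C" "\<And>s. real m < s \<Longrightarrow> \<bar>\<Delta> (\<beta> - 1) s\<bar> \<le> C * (s - real m) powr (\<beta> - 1 - real m)"
    using Suc.IH[of "\<beta> - 1"] Suc.prems unfolding \<Delta>_def by auto
  have der: "(\<Delta> \<beta> has_real_derivative \<beta> * \<Delta> (\<beta> - 1) z) (at z)" if "real m < z" for z
    unfolding \<Delta>_def sum_distrib_left
    using that by (auto intro!: derivative_eq_intros sum.cong simp: mult_ac)
  show ?case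
  proof (intro exI[of _ "\<bar>\<beta>\<bar> * C"] conjI allI impI)
    fix s assume s: "real (Suc m) < s"
    have "\<exists>z. s - 1 < z \<and> z < s \<and> \<Delta> \<beta> s - \<Delta> \<beta> (s - 1) = (s - (s - 1)) * (\<beta> * \<Delta> (\<beta> - 1) z)"
      by (rule MVT2) (use s in \<open>auto intro!: der\<close>)
    then obtain z where z: "s - 1 < z" "z < s" "\<Delta> \<beta> s - \<Delta> \<beta> (s - 1) = \<beta> * \<Delta> (\<beta> - 1) z"
      by auto
    have "\<bar>\<Delta> (\<beta> - 1) z\<bar> \<le> C * (z - real m) powr (\<beta> - 1 - real m)"
      using z s by (intro C) auto
    also have "\<dots> \<le> C * (s - real (Suc m)) powr (\<beta> - 1 - real m)"
      using z s Suc.prems C by (intro mult_left_mono powr_mono2') auto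
    finally have "\<bar>\<beta> * \<Delta> (\<beta> - 1) z\<bar> \<le> \<bar>\<beta>\<bar> * (C * (s - real (Suc m)) powr (\<beta> - 1 - real m))"
      by (simp add: abs_mult mult_left_mono)
    then show "\<bar>\<Sum>j\<le>Suc m. (- 1) ^ j * real (Suc m choose j) * (s - real j) powr \<beta>\<bar>
        \<le> \<bar>\<beta>\<bar> * C * (s - real (Suc m)) powr (\<beta> - real (Suc m))"
      unfolding binomial_difference_Suc[where f = "\<lambda>s. s powr \<beta>"] \<Delta>_def[symmetric] z(3)
      by (simp add: algebra_simps)
  qed (use C in simp)
qed

lemma has_bochner_integral_trunc_powr_exp:
  assumes \<beta>: "- 1 < \<beta>" and \<zeta>: "0 < \<zeta>"
  shows "has_bochner_integral lborel (\<lambda>s. trunc_powr \<beta> s * exp (- s * \<zeta>)) (Gamma (\<beta> + 1) * \<zeta> powr (- \<beta> - 1))"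
proof (rule has_bochner_integral_nn_integral)
  have "(\<integral>\<^sup>+s. ennreal (trunc_powr \<beta> s * exp (- s * \<zeta>)) \<partial>lborel)
      = ennreal \<bar>1 / \<zeta>\<bar> * (\<integral>\<^sup>+s. ennreal (trunc_powr \<beta> (0 + 1 / \<zeta> * s) * exp (- (0 + 1 / \<zeta> * s) * \<zeta>)) \<partial>lborel)"
    using \<zeta> by (intro nn_integral_real_affine) auto
  also have "(\<lambda>s. ennreal (trunc_powr \<beta> (0 + 1 / \<zeta> * s) * exp (- (0 + 1 / \<zeta> * s) * \<zeta>)))
      = (\<lambda>s. ennreal (\<zeta> powr (- \<beta>)) * ennreal (indicator {0..} s * s powr (\<beta> + 1 - 1) / exp s))"
    using \<zeta> by (intro ext, subst ennreal_mult[symmetric])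
      (auto simp: trunc_powr_def powr_divide powr_minus exp_minus field_simps indicator_def zero_less_mult_iff)
  also have "(\<integral>\<^sup>+s. ennreal (\<zeta> powr (- \<beta>)) * ennreal (indicator {0..} s * s powr (\<beta> + 1 - 1) / exp s) \<partial>lborel)
      = ennreal (\<zeta> powr (- \<beta>)) * ennreal (Gamma (\<beta> + 1))"
    using \<beta> Gamma_conv_nn_integral_real[of "\<beta> + 1"] by (subst nn_integral_cmult) auto
  also have "ennreal \<bar>1 / \<zeta>\<bar> * (ennreal (\<zeta> powr (- \<beta>)) * ennreal (Gamma (\<beta> + 1)))
      = ennreal (Gamma (\<beta> + 1) * \<zeta> powr (- \<beta> - 1))"
    using \<beta> \<zeta> Gamma_real_pos[of "\<beta> + 1"]
    by (simp add: powr_diff mult_ac flip: ennreal_mult)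
  finally show "(\<integral>\<^sup>+s. ennreal (trunc_powr \<beta> s * exp (- s * \<zeta>)) \<partial>lborel)
      = ennreal (Gamma (\<beta> + 1) * \<zeta> powr (- \<beta> - 1))" .
  show "0 \<le> Gamma (\<beta> + 1) * \<zeta> powr (- \<beta> - 1)"
    using \<beta> Gamma_real_pos[of "\<beta> + 1"] by simp
qed auto

lemma has_bochner_integral_trunc_powr_exp_shift:
  assumes \<beta>: "- 1 < \<beta>" and \<zeta>: "0 < \<zeta>"
  shows "has_bochner_integral lborel (\<lambda>s. trunc_powr \<beta> (s - c) * exp (- s * \<zeta>))
    (exp (- c * \<zeta>) * (Gamma (\<beta> + 1) * \<zeta> powr (- \<beta> - 1)))"
proof -
  note * = has_bochner_integral_trunc_powr_exp[OF assms]
  have "has_bochner_integral lborel (\<lambda>s. trunc_powr \<beta> (- c + 1 * s) * exp (- (- c + 1 * s) * \<zeta>))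
      (Gamma (\<beta> + 1) * \<zeta> powr (- \<beta> - 1))"
    using * lborel_has_bochner_integral_real_affine_iff[of 1 "\<lambda>s. trunc_powr \<beta> s * exp (- s * \<zeta>)" _ "- c"]
    by simp
  then have "has_bochner_integral lborel
      (\<lambda>s. exp (- c * \<zeta>) * (trunc_powr \<beta> (- c + 1 * s) * exp (- (- c + 1 * s) * \<zeta>)))
      (exp (- c * \<zeta>) * (Gamma (\<beta> + 1) * \<zeta> powr (- \<beta> - 1)))"
    by (rule has_bochner_integral_mult_right)
  moreover have "(\<lambda>s. exp (- c * \<zeta>) * (trunc_powr \<beta> (- c + 1 * s) * exp (- (- c + 1 * s) * \<zeta>)))
      = (\<lambda>s. trunc_powr \<beta> (s - c) * exp (- s * \<zeta>))"
  proof
    fix s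
    have "exp (- c * \<zeta>) * exp (- (- c + 1 * s) * \<zeta>) = exp (- s * \<zeta>)"
      by (simp add: algebra_simps flip: exp_add)
    then show "exp (- c * \<zeta>) * (trunc_powr \<beta> (- c + 1 * s) * exp (- (- c + 1 * s) * \<zeta>))
        = trunc_powr \<beta> (s - c) * exp (- s * \<zeta>)"
      by (simp add: mult.left_commute)
  qed
  ultimately show ?thesis by simp
qed

lemma power_one_minus_exp:
  fixes x :: real
  shows "(1 - exp (- x)) ^ m = (\<Sum>j\<le>m. (- 1) ^ j * real (m choose j) * exp (- real j * x))"
proof -
  have "(1 - exp (- x)) ^ m = (- exp (- x) + 1) ^ m" by simp
  also have "\<dots> = (\<Sum>j\<le>m. real (m choose j) * (- exp (- x)) ^ j)"
    by (subst binomial_ring) simp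
  also have "\<dots> = (\<Sum>j\<le>m. (- 1) ^ j * real (m choose j) * exp (- real j * x))"
  proof (intro sum.cong refl)
    fix j
    have "(- exp (- x)) ^ j = (- 1) ^ j * exp (- real j * x)"
      by (subst power_minus) (simp flip: exp_of_nat_mult)
    then show "real (m choose j) * (- exp (- x)) ^ j = (- 1) ^ j * real (m choose j) * exp (- real j * x)"
      by simp
  qed
  finally show ?thesis .
qed

lemma integral_fdiff_exp:
  assumes \<beta>: "- 1 < \<beta>" and \<zeta>: "0 < \<zeta>"
  shows "(\<integral>s. fdiff m \<beta> s * exp (- s * \<zeta>) \<partial>lborel)
    = Gamma (\<beta> + 1) * \<zeta> powr (- \<beta> - 1) * (1 - exp (- \<zeta>)) ^ m"
proof -
  have "has_bochner_integral lborel
      (\<lambda>s. \<Sum>j\<le>m. (- 1) ^ j * real (m choose j) * (trunc_powr \<beta> (s - real j) * exp (- s * \<zeta>)))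
      (\<Sum>j\<le>m. (- 1) ^ j * real (m choose j) * (exp (- real j * \<zeta>) * (Gamma (\<beta> + 1) * \<zeta> powr (- \<beta> - 1))))"
    by (intro has_bochner_integral_sum has_bochner_integral_mult_right has_bochner_integral_trunc_powr_exp_shift assms)
  moreover have "(\<Sum>j\<le>m. (- 1) ^ j * real (m choose j) * (exp (- real j * \<zeta>) * (Gamma (\<beta> + 1) * \<zeta> powr (- \<beta> - 1))))
      = Gamma (\<beta> + 1) * \<zeta> powr (- \<beta> - 1) * (1 - exp (- \<zeta>)) ^ m"
    by (simp only: power_one_minus_exp sum_distrib_left mult_ac)
  ultimately have "has_bochner_integral lborel (\<lambda>s. fdiff m \<beta> s * exp (- s * \<zeta>))
      (Gamma (\<beta> + 1) * \<zeta> powr (- \<beta> - 1) * (1 - exp (- \<zeta>)) ^ m)"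
    by (simp add: fdiff_def sum_distrib_right mult.assoc)
  then show ?thesis by (rule has_bochner_integral_integral_eq)
qed

lemma integrable_inverse_1_plus_square_lborel: "integrable lborel (\<lambda>x::real. inverse (1 + x\<^sup>2))"
  using integrable_inverse_1_plus_square by (simp add: set_integrable_def)

text \<open>Up to s = m + 1 the shifted powers are dominated by their Laplace integrands, already
  known to be integrable: the factor exp (m + 1) exp (- s) is at least 1 there. Beyond,
  \<open>binomial_difference_powr_le\<close> gives decay of order (s - m)^(- 2), compared with 2 /
  (1 + (s - m)^2).\<close>

lemma integrable_fdiff:
  assumes \<beta>: "- 1 < \<beta>" and m: "\<beta> + 2 \<le> real m"
  shows "integrable lborel (fdiff m \<beta>)"
proof -
  obtain C where C: "0 \<le> C" "\<And>s. real m < s \<Longrightarrow>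
    \<bar>\<Sum>j\<le>m. (- 1) ^ j * real (m choose j) * (s - real j) powr \<beta>\<bar> \<le> C * (s - real m) powr (\<beta> - real m)"
    using binomial_difference_powr_le[of \<beta> m] m by auto
  define G where "G s = (\<Sum>j\<le>m. exp (real m + 1) * real (m choose j) * (trunc_powr \<beta> (s - real j) * exp (- s * 1)))" for s
  define H where "H s = 2 * C * inverse (1 + (- real m + 1 * s)\<^sup>2)" for s
  have "integrable lborel G" unfolding G_def
    by (intro Bochner_Integration.integrable_sum integrable_mult_right
        has_bochner_integral_trunc_powr_exp_shift[THEN integrable.intros] \<beta>) auto
  moreover have "integrable lborel H" unfolding H_def
    by (intro integrable_mult_right
        lborel_integrable_real_affine[OF integrable_inverse_1_plus_square_lborel]) auto
  ultimately have int: "integrable lborel (\<lambda>s. G s + H s)" by simp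
  have G0: "0 \<le> G s" for s unfolding G_def by (intro sum_nonneg) auto
  have H0: "0 \<le> H s" for s using C unfolding H_def by (auto intro!: mult_nonneg_nonneg add_nonneg_nonneg)
  have bound: "\<bar>fdiff m \<beta> s\<bar> \<le> G s + H s" for s
  proof (cases "s \<le> real m + 1")
    case True
    have "\<bar>fdiff m \<beta> s\<bar> \<le> (\<Sum>j\<le>m. \<bar>(- 1) ^ j * real (m choose j) * trunc_powr \<beta> (s - real j)\<bar>)"
      unfolding fdiff_def by (rule sum_abs)
    also have "\<dots> \<le> G s" unfolding G_def
    proof (intro sum_mono)
      fix j
      have "1 \<le> exp (real m + 1) * exp (- s * 1)" using True by (simp flip: exp_add)
      then have "real (m choose j) * trunc_powr \<beta> (s - real j) * 1
          \<le> real (m choose j) * trunc_powr \<beta> (s - real j) * (exp (real m + 1) * exp (- s * 1))"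
        by (intro mult_left_mono) auto
      then show "\<bar>(- 1) ^ j * real (m choose j) * trunc_powr \<beta> (s - real j)\<bar>
        \<le> exp (real m + 1) * real (m choose j) * (trunc_powr \<beta> (s - real j) * exp (- s * 1))"
        by (simp add: abs_mult mult_ac)
    qed
    finally show ?thesis using H0[of s] by simp
  next
    case False
    then have s: "1 < s - real m" by simp
    have "fdiff m \<beta> s = (\<Sum>j\<le>m. (- 1) ^ j * real (m choose j) * (s - real j) powr \<beta>)"
      unfolding fdiff_def using s by (intro sum.cong) (auto simp: trunc_powr_def)
    then have "\<bar>fdiff m \<beta> s\<bar> \<le> C * (s - real m) powr (\<beta> - real m)"
      using C(2)[of s] s by simp
    also have "\<dots> \<le> C * (s - real m) powr (- 2)"
      using s m C by (intro mult_left_mono powr_mono) auto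
    also have "(s - real m) powr (- 2) = inverse ((s - real m)\<^sup>2)"
      using s by (simp add: powr_minus)
    also have "\<dots> \<le> 2 * inverse (1 + (s - real m)\<^sup>2)"
    proof -
      have "inverse y \<le> 2 * inverse (1 + y)" if "1 \<le> y" for y :: real
      proof -
        have "0 < y" "0 < 1 + y" using that by simp_all
        then show ?thesis using that by (simp add: field_simps)
      qed
      then show ?thesis using s by simp
    qed
    also have "C * (2 * inverse (1 + (s - real m)\<^sup>2)) = H s" by (simp add: H_def algebra_simps)
    finally show ?thesis using G0[of s] C by (simp add: mult_left_mono)
  qed
  show ?thesis
    by (rule Bochner_Integration.integrable_bound[OF int])
       (use bound G0 H0 in \<open>auto simp: abs_of_nonneg add_nonneg_nonneg\<close>)
qed

section \<open>Fourier inversion\<close>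

definition ee :: "real \<Rightarrow> complex" where
  "ee \<theta> = exp (2 * of_real pi * \<i> * of_real \<theta>)"

lemma ee_0 [simp]: "ee 0 = 1" by (simp add: ee_def)

lemma norm_ee [simp]: "norm (ee \<theta>) = 1"
  by (simp add: ee_def)

lemma ee_add: "ee (a + b) = ee a * ee b"
  by (simp add: ee_def exp_add distrib_left)

lemma ee_inner: "ee (x \<bullet> \<xi>) = iexp (x \<bullet> ((2 * pi) *\<^sub>R \<xi>))"
  by (simp add: ee_def mult_ac)

lemma continuous_ee [continuous_intros]:
  "continuous_on A f \<Longrightarrow> continuous_on A (\<lambda>x. ee (f x))"
  unfolding ee_def by (intro continuous_intros)

lemma measurable_ee [measurable]: "ee \<in> borel_measurable borel"
  by (intro borel_measurable_continuous_onI continuous_intros)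

text \<open>Passage from the completed measure of the definition to \<open>lborel\<close>, on which
  the Fubini arguments are carried out.\<close>

lemma fourier_eq:
  assumes [measurable]: "f \<in> borel_measurable borel"
  shows "fourier f \<xi> = (\<integral>x. f x * ee (- (x \<bullet> \<xi>)) \<partial>lborel)"
  unfolding fourier_def ee_def by (subst integral_completion) simp_all

lemma inverse_fourier_eq:
  assumes [measurable]: "g \<in> borel_measurable borel"
  shows "inverse_fourier g x = (\<integral>\<xi>. g \<xi> * ee (x \<bullet> \<xi>) \<partial>lborel)"
  unfolding inverse_fourier_def ee_def by (subst integral_completion) simp_all

lemma integrable_mult_ee:
  assumes "integrable lborel f" and [measurable]: "g \<in> borel_measurable borel"
  shows "integrable lborel (\<lambda>x. f x * ee (g x))"
proof (rule Bochner_Integration.integrable_bound[OF assms(1)])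
  have [measurable]: "f \<in> borel_measurable borel"
    using borel_measurable_integrable[OF assms(1)] by simp
  show "(\<lambda>x. f x * ee (g x)) \<in> borel_measurable lborel" by simp
qed (simp add: norm_mult)

lemma integral_heat_kernel_ee:
  fixes \<xi> :: "'a::euclidean_space"
  assumes "0 < t"
  shows "(\<integral>x. complex_of_real (heat_kernel t x) * ee (x \<bullet> \<xi>) \<partial>lborel)
    = complex_of_real (exp (- t * (2 * pi * norm \<xi>)\<^sup>2))"
  unfolding ee_inner by (subst integral_heat_kernel_iexp[OF assms]) simp

lemma
  fixes w :: "'a::euclidean_space"
  assumes t: "0 < t"
  shows integrable_exp_ee: "integrable lborel (\<lambda>\<xi>. complex_of_real (exp (- t * (2 * pi * norm \<xi>)\<^sup>2)) * ee (w \<bullet> \<xi>))"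
    and integral_exp_ee: "(\<integral>\<xi>. complex_of_real (exp (- t * (2 * pi * norm \<xi>)\<^sup>2)) * ee (w \<bullet> \<xi>) \<partial>lborel)
    = complex_of_real (heat_kernel t w)"
proof -
  \<comment> \<open>Chosen so that t (2 pi)^2 = 1 / (4 s), which brings the Gaussian in \<xi> into
    the form of \<open>integral_gaussian\<close>.\<close>
  define s where "s = 1 / (16 * pi\<^sup>2 * t)"
  have s: "0 < s" using t by (simp add: s_def)
  have *: "complex_of_real (exp (- t * (2 * pi * norm \<xi>)\<^sup>2)) * ee (w \<bullet> \<xi>)
    = complex_of_real (exp (- (norm \<xi>)\<^sup>2 / (4 * s))) * iexp (\<xi> \<bullet> ((2 * pi) *\<^sub>R w))" for \<xi> :: 'a
    using t unfolding inner_commute[of w] ee_inner by (simp add: s_def power_mult_distrib mult_ac)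
  show "integrable lborel (\<lambda>\<xi>. complex_of_real (exp (- t * (2 * pi * norm \<xi>)\<^sup>2)) * ee (w \<bullet> \<xi>))"
    unfolding * using s by (rule integrable_gaussian)
  have 2: "inverse y powr a = y powr (- a)" if "0 < y" for y a :: real
    using that by (simp add: inverse_powr powr_minus)
  have 1: "4 * pi * s = inverse (4 * pi * t)"
    using t by (simp add: s_def field_simps power2_eq_square)
  have "(4 * pi * s) powr (real DIM('a) / 2) = (4 * pi * t) powr (- real DIM('a) / 2)"
    unfolding 1 minus_divide_left[symmetric] using t by (intro 2) simp
  moreover have "- s * (norm ((2 * pi) *\<^sub>R w))\<^sup>2 = - (norm w)\<^sup>2 / (4 * t)"
    using t by (simp add: s_def power_mult_distrib)
  ultimately show "(\<integral>\<xi>. complex_of_real (exp (- t * (2 * pi * norm \<xi>)\<^sup>2)) * ee (w \<bullet> \<xi>) \<partial>lborel)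
    = complex_of_real (heat_kernel t w)"
    unfolding * integral_gaussian[OF s] heat_kernel_def by (simp only:)
qed

text \<open>Every exchange of Bochner integrals below has an integrand dominated by a product of
  integrable functions of one variable, the remaining factors having modulus at most 1.\<close>

lemma integrable_pair_lborel_mult:
  fixes f :: "'a::euclidean_space \<Rightarrow> 'c::{real_normed_field, banach, second_countable_topology}"
    and g :: "'b::euclidean_space \<Rightarrow> 'c"
  assumes f: "integrable lborel f" and g: "integrable lborel g"
    and [measurable]: "(\<lambda>p. h (fst p) (snd p)) \<in> borel_measurable (borel \<Otimes>\<^sub>M borel)"
    and h: "\<And>x y. norm (h x y) \<le> norm (f x) * norm (g y)"
  shows "integrable (lborel \<Otimes>\<^sub>M lborel) (\<lambda>(x, y). h x y :: 'c)"
proof (rule lborel_pair.Fubini_integrable)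
  have [measurable]: "f \<in> borel_measurable borel" "g \<in> borel_measurable borel"
    using f g borel_measurable_integrable by fastforce+
  have hm: "(\<lambda>y. h x y) \<in> borel_measurable borel" for x
    using measurable_compose[OF measurable_Pair1'[of x borel borel], of "\<lambda>p. h (fst p) (snd p)" borel] assms(3)
    by simp
  show "(\<lambda>(x, y). h x y) \<in> borel_measurable (lborel \<Otimes>\<^sub>M lborel)"
    using assms(3) by (simp add: split_beta' measurable_cong_sets[OF sets_pair_measure_cong[OF sets_lborel sets_lborel] refl])
  have int: "integrable lborel (\<lambda>y. h x y)" for x
    by (rule Bochner_Integration.integrable_bound[where f = "\<lambda>y. norm (f x) * norm (g y)"])
       (use h g hm in \<open>auto intro: integrable_norm\<close>)
  then show "AE x in lborel. integrable lborel (\<lambda>y. (\<lambda>(x, y). h x y) (x, y))" by simp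
  show "integrable lborel (\<lambda>x. \<integral>y. norm ((\<lambda>(x, y). h x y) (x, y)) \<partial>lborel)"
  proof (rule Bochner_Integration.integrable_bound[where f = "\<lambda>x. norm (f x) * (\<integral>y. norm (g y) \<partial>lborel)"])
    show "integrable lborel (\<lambda>x. norm (f x) * (\<integral>y. norm (g y) \<partial>lborel))"
      using f by (intro integrable_mult_left integrable_norm)
    have "(\<lambda>(x, y). norm (h x y)) \<in> borel_measurable (borel \<Otimes>\<^sub>M lborel)"
      using assms(3) by (simp add: split_beta' measurable_cong_sets[OF sets_pair_measure_cong[OF refl sets_lborel] refl])
    from lborel.borel_measurable_lebesgue_integral[OF this]
    show "(\<lambda>x. \<integral>y. norm ((\<lambda>(x, y). h x y) (x, y)) \<partial>lborel) \<in> borel_measurable lborel"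
      by simp
    show "AE x in lborel. norm (\<integral>y. norm ((\<lambda>(x, y). h x y) (x, y)) \<partial>lborel)
        \<le> norm (norm (f x) * (\<integral>y. norm (g y) \<partial>lborel))"
    proof (intro AE_I2)
      fix x
      have "(\<integral>y. norm (h x y) \<partial>lborel) \<le> (\<integral>y. norm (f x) * norm (g y) \<partial>lborel)"
        using int g h by (intro integral_mono) (auto intro: integrable_norm)
      then show "norm (\<integral>y. norm ((\<lambda>(x, y). h x y) (x, y)) \<partial>lborel)
        \<le> norm (norm (f x) * (\<integral>y. norm (g y) \<partial>lborel))"
        by (simp add: abs_mult)
    qed
  qed
qed

text \<open>Fubini and the transform of the kernel. The density G is arbitrary because the lemma
  serves both for the transform of \<phi> and for its product with |2 pi \<xi>|^\<alpha>.\<close>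

lemma heat_kernel_integral_ee:
  fixes G :: "'a::euclidean_space \<Rightarrow> complex"
  assumes G: "integrable lborel G" and t: "0 < t"
  shows "(\<integral>y. complex_of_real (heat_kernel t (x - y)) * (\<integral>\<xi>. G \<xi> * ee (y \<bullet> \<xi>) \<partial>lborel) \<partial>lborel)
    = (\<integral>\<xi>. complex_of_real (exp (- t * (2 * pi * norm \<xi>)\<^sup>2)) * (G \<xi> * ee (x \<bullet> \<xi>)) \<partial>lborel)"
proof -
  have [measurable]: "G \<in> borel_measurable borel" using borel_measurable_integrable[OF G] by simp
  have h: "integrable lborel (\<lambda>y. complex_of_real (heat_kernel t (x - y)))"
    using integrable_affine[OF integrable_heat_kernel[OF t, where 'a = 'a], of "- 1" x]
    by (simp add: complex_of_real_integrable_eq)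
  have int: "integrable (lborel \<Otimes>\<^sub>M lborel)
     (\<lambda>(y, \<xi>). complex_of_real (heat_kernel t (x - y)) * (G \<xi> * ee (y \<bullet> \<xi>)))"
    by (rule integrable_pair_lborel_mult[OF h G]) (simp_all add: norm_mult)
  have "(\<integral>y. complex_of_real (heat_kernel t (x - y)) * (\<integral>\<xi>. G \<xi> * ee (y \<bullet> \<xi>) \<partial>lborel) \<partial>lborel)
      = (\<integral>y. (\<integral>\<xi>. complex_of_real (heat_kernel t (x - y)) * (G \<xi> * ee (y \<bullet> \<xi>)) \<partial>lborel) \<partial>lborel)"
    by simp
  also have "\<dots> = (\<integral>\<xi>. (\<integral>y. complex_of_real (heat_kernel t (x - y)) * (G \<xi> * ee (y \<bullet> \<xi>)) \<partial>lborel) \<partial>lborel)"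
    by (rule lborel_pair.Fubini_integral[OF int, symmetric])
  also have "\<dots> = (\<integral>\<xi>. complex_of_real (exp (- t * (2 * pi * norm \<xi>)\<^sup>2)) * (G \<xi> * ee (x \<bullet> \<xi>)) \<partial>lborel)"
  proof (intro Bochner_Integration.integral_cong refl)
    fix \<xi> :: 'a
    have "(\<integral>y. complex_of_real (heat_kernel t (x - y)) * (G \<xi> * ee (y \<bullet> \<xi>)) \<partial>lborel)
        = \<bar>- 1\<bar> ^ DIM('a) *\<^sub>R (\<integral>y. complex_of_real (heat_kernel t (x - (x + (- 1) *\<^sub>R y))) * (G \<xi> * ee ((x + (- 1) *\<^sub>R y) \<bullet> \<xi>)) \<partial>lborel)"
      by (rule integral_affine) simp_all
    also have "\<dots> = (\<integral>y. (complex_of_real (heat_kernel t y) * ee (y \<bullet> (- \<xi>))) * (G \<xi> * ee (x \<bullet> \<xi>)) \<partial>lborel)"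
    proof -
      have "complex_of_real (heat_kernel t (x - (x + (- 1) *\<^sub>R y))) * (G \<xi> * ee ((x + (- 1) *\<^sub>R y) \<bullet> \<xi>))
          = (complex_of_real (heat_kernel t y) * ee (y \<bullet> (- \<xi>))) * (G \<xi> * ee (x \<bullet> \<xi>))" for y
        using ee_add[of "x \<bullet> \<xi>" "- (y \<bullet> \<xi>)"] by (simp add: inner_diff_left mult_ac)
      then show ?thesis by (simp only: abs_minus_cancel abs_one power_one scaleR_one)
    qed
    also have "\<dots> = complex_of_real (exp (- t * (2 * pi * norm \<xi>)\<^sup>2)) * (G \<xi> * ee (x \<bullet> \<xi>))"
      by (subst integral_mult_left_zero, subst integral_heat_kernel_ee[OF t]) simp
    finally show "(\<integral>y. complex_of_real (heat_kernel t (x - y)) * (G \<xi> * ee (y \<bullet> \<xi>)) \<partial>lborel)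
      = complex_of_real (exp (- t * (2 * pi * norm \<xi>)\<^sup>2)) * (G \<xi> * ee (x \<bullet> \<xi>))" .
  qed
  finally show ?thesis .
qed

text \<open>The times are squares so that the substitution y = x - z / (n + 1) turns the kernel into
  the fixed one at time 1. Dominated convergence then only needs continuity and boundedness of
  f.\<close>

lemma heat_kernel_integral_tendsto:
  fixes f :: "'a::euclidean_space \<Rightarrow> complex"
  assumes f: "continuous_on UNIV f" and B: "\<And>x. norm (f x) \<le> B"
  shows "(\<lambda>n. \<integral>y. complex_of_real (heat_kernel ((1 / real (Suc n))\<^sup>2) (x - y)) * f y \<partial>lborel) \<longlonglongrightarrow> f x"
proof -
  have [measurable]: "f \<in> borel_measurable borel" using f by (rule borel_measurable_continuous_onI)
  have eq: "(\<integral>y. complex_of_real (heat_kernel ((1 / real (Suc n))\<^sup>2) (x - y)) * f y \<partial>lborel)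
      = (\<integral>y. complex_of_real (heat_kernel 1 y) * f (x + (- (1 / real (Suc n))) *\<^sub>R y) \<partial>lborel)" for n
  proof -
    define c where "c = - (1 / real (Suc n))"
    have c: "c \<noteq> 0" "\<bar>c\<bar> = 1 / real (Suc n)" by (auto simp: c_def)
    have hk: "heat_kernel (\<bar>c\<bar>\<^sup>2) (c *\<^sub>R y) * \<bar>c\<bar> ^ DIM('a) = heat_kernel 1 y" for y :: 'a
    proof -
      have "(4 * pi * c\<^sup>2) powr (- real DIM('a) / 2) = (4 * pi) powr (- real DIM('a) / 2) * (\<bar>c\<bar> powr 2) powr (- real DIM('a) / 2)"
        using c(1) by (subst powr_mult) (auto simp: powr_realpow)
      also have "(\<bar>c\<bar> powr 2) powr (- real DIM('a) / 2) * \<bar>c\<bar> ^ DIM('a) = 1"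
      proof -
        have p: "\<bar>c\<bar> ^ DIM('a) = \<bar>c\<bar> powr real DIM('a)"
          using c(1) by (subst powr_realpow) auto
        have "(\<bar>c\<bar> powr 2) powr (- real DIM('a) / 2) * \<bar>c\<bar> ^ DIM('a)
            = \<bar>c\<bar> powr (2 * (- real DIM('a) / 2) + real DIM('a))"
          unfolding p by (simp only: powr_powr powr_add)
        also have "\<dots> = 1" using c(1) by simp
        finally show ?thesis .
      qed
      then have "(4 * pi) powr (- real DIM('a) / 2) * (\<bar>c\<bar> powr 2) powr (- real DIM('a) / 2) * \<bar>c\<bar> ^ DIM('a)
         = (4 * pi) powr (- real DIM('a) / 2)" by (simp add: mult.assoc)
      finally have A1: "(4 * pi * c\<^sup>2) powr (- real DIM('a) / 2) * \<bar>c\<bar> ^ DIM('a) = (4 * pi) powr (- real DIM('a) / 2)" .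
      have A2: "- (norm (c *\<^sub>R y))\<^sup>2 / (4 * c\<^sup>2) = - (norm y)\<^sup>2 / 4"
        using c(1) by (simp add: power_mult_distrib)
      show ?thesis
        unfolding heat_kernel_def power2_abs mult_1_right A2 A1[symmetric] by (simp only: mult_ac)
    qed
    have "(\<integral>y. complex_of_real (heat_kernel (\<bar>c\<bar>\<^sup>2) (x - y)) * f y \<partial>lborel)
      = \<bar>c\<bar> ^ DIM('a) *\<^sub>R (\<integral>y. complex_of_real (heat_kernel (\<bar>c\<bar>\<^sup>2) (x - (x + c *\<^sub>R y))) * f (x + c *\<^sub>R y) \<partial>lborel)"
      using c by (intro integral_affine) simp_all
    also have "\<dots> = (\<integral>y. complex_of_real (heat_kernel (\<bar>c\<bar>\<^sup>2) (c *\<^sub>R y) * \<bar>c\<bar> ^ DIM('a)) * f (x + c *\<^sub>R y) \<partial>lborel)"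
      unfolding integral_scaleR_right[symmetric]
      by (intro Bochner_Integration.integral_cong refl) (simp add: scaleR_conv_of_real)
    finally show ?thesis unfolding hk unfolding c(2) unfolding c_def .
  qed
  have "(\<lambda>n. \<integral>y. complex_of_real (heat_kernel 1 y) * f (x + (- (1 / real (Suc n))) *\<^sub>R y) \<partial>lborel)
     \<longlonglongrightarrow> (\<integral>y. complex_of_real (heat_kernel 1 (y::'a)) * f x \<partial>lborel)"
  proof (rule integral_dominated_convergence[where w = "\<lambda>y::'a. heat_kernel 1 y * B"])
    show "integrable lborel (\<lambda>y::'a. heat_kernel 1 y * B)"
      using integrable_heat_kernel[of 1, where 'a = 'a] by simp
    show "AE y in lborel. norm (complex_of_real (heat_kernel 1 y) * f (x + (- (1 / real (Suc n))) *\<^sub>R y)) \<le> heat_kernel 1 y * B" for n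
      using B by (auto simp: norm_mult mult_left_mono)
    have c: "isCont f x" using f by (simp add: continuous_on_eq_continuous_at)
    have "(\<lambda>n. x + (- (1 / real (Suc n))) *\<^sub>R y) \<longlonglongrightarrow> x + (- 0) *\<^sub>R y" for y
      by (intro tendsto_intros LIMSEQ_Suc[OF lim_1_over_n])
    then have "(\<lambda>n. x + (- (1 / real (Suc n))) *\<^sub>R y) \<longlonglongrightarrow> x" for y
      by simp
    then have "(\<lambda>n. f (x + (- (1 / real (Suc n))) *\<^sub>R y)) \<longlonglongrightarrow> f x" for y
      by (rule isCont_tendsto_compose[OF c])
    then show "AE y in lborel. (\<lambda>n. complex_of_real (heat_kernel 1 y) * f (x + (- (1 / real (Suc n))) *\<^sub>R y))
        \<longlonglongrightarrow> complex_of_real (heat_kernel 1 y) * f x"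
      by (intro AE_I2 tendsto_intros)
  qed measurable
  also have "(\<integral>y. complex_of_real (heat_kernel 1 (y::'a)) * f x \<partial>lborel) = f x"
    by (simp add: integral_heat_kernel)
  finally show ?thesis unfolding eq .
qed

text \<open>Gaussian regularisation: with the factor exp (- t |2 pi \<xi>|^2) inserted, Fubini
  applies and the frequency integral becomes the heat average of f at time t. As t tends to 0, one
  side converges to the Fourier integral and the other to f x.\<close>

lemma fourier_inversion:
  fixes f :: "real^'d \<Rightarrow> complex"
  assumes f: "continuous_on UNIV f" and B: "\<And>x. norm (f x) \<le> B"
    and int_f: "integrable lborel f" and int_F: "integrable lborel (fourier f)"
  shows "(\<integral>\<xi>. fourier f \<xi> * ee (x \<bullet> \<xi>) \<partial>lborel) = f x"
proof (rule LIMSEQ_unique)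
  have [measurable]: "f \<in> borel_measurable borel" using f by (rule borel_measurable_continuous_onI)
  have [measurable]: "fourier f \<in> borel_measurable borel" using borel_measurable_integrable[OF int_F] by simp
  define t where "t n = (1 / real (Suc n))\<^sup>2" for n
  have t: "0 < t n" for n by (simp add: t_def)
  have eq: "(\<integral>\<xi>. complex_of_real (exp (- t n * (2 * pi * norm \<xi>)\<^sup>2)) * (fourier f \<xi> * ee (x \<bullet> \<xi>)) \<partial>lborel)
     = (\<integral>y. complex_of_real (heat_kernel (t n) (x - y)) * f y \<partial>lborel)" for n
  proof -
    define k where "k \<xi> = complex_of_real (exp (- t n * (2 * pi * norm \<xi>)\<^sup>2))" for \<xi> :: "real^'d"
    have k: "integrable lborel k" using integrable_exp_ee[OF t[of n], of "0 :: real^'d"] by (simp add: k_def[abs_def])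
    have [measurable]: "k \<in> borel_measurable borel" by (simp add: k_def[abs_def])
    have int: "integrable (lborel \<Otimes>\<^sub>M lborel) (\<lambda>(\<xi>, y). k \<xi> * (f y * ee ((x - y) \<bullet> \<xi>)))"
      by (rule integrable_pair_lborel_mult[OF k int_f]) (simp_all add: norm_mult)
    have "(\<integral>\<xi>. k \<xi> * (fourier f \<xi> * ee (x \<bullet> \<xi>)) \<partial>lborel)
       = (\<integral>\<xi>. (\<integral>y. k \<xi> * (f y * ee ((x - y) \<bullet> \<xi>)) \<partial>lborel) \<partial>lborel)"
    proof (intro Bochner_Integration.integral_cong refl)
      fix \<xi>
      have "k \<xi> * (f y * ee ((x - y) \<bullet> \<xi>)) = (k \<xi> * ee (x \<bullet> \<xi>)) * (f y * ee (- (y \<bullet> \<xi>)))" for y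
        using ee_add[of "x \<bullet> \<xi>" "- (y \<bullet> \<xi>)"] by (simp add: inner_diff_left)
      then show "k \<xi> * (fourier f \<xi> * ee (x \<bullet> \<xi>)) = (\<integral>y. k \<xi> * (f y * ee ((x - y) \<bullet> \<xi>)) \<partial>lborel)"
        by (simp only: integral_mult_right_zero fourier_eq[OF \<open>f \<in> borel_measurable borel\<close>])
           (simp only: mult_ac)
    qed
    also have "\<dots> = (\<integral>y. (\<integral>\<xi>. k \<xi> * (f y * ee ((x - y) \<bullet> \<xi>)) \<partial>lborel) \<partial>lborel)"
      by (rule lborel_pair.Fubini_integral[OF int, symmetric])
    also have "\<dots> = (\<integral>y. (\<integral>\<xi>. f y * (k \<xi> * ee ((x - y) \<bullet> \<xi>)) \<partial>lborel) \<partial>lborel)"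
      by (simp only: mult.left_commute)
    also have "\<dots> = (\<integral>y. complex_of_real (heat_kernel (t n) (x - y)) * f y \<partial>lborel)"
      unfolding integral_mult_right_zero k_def integral_exp_ee[OF t] by (simp only: mult.commute)
    finally show ?thesis by (simp add: k_def)
  qed
  show "(\<lambda>n. \<integral>\<xi>. complex_of_real (exp (- t n * (2 * pi * norm \<xi>)\<^sup>2)) * (fourier f \<xi> * ee (x \<bullet> \<xi>)) \<partial>lborel) \<longlonglongrightarrow> f x"
    unfolding eq unfolding t_def by (rule heat_kernel_integral_tendsto[OF f B])
  show "(\<lambda>n. \<integral>\<xi>. complex_of_real (exp (- t n * (2 * pi * norm \<xi>)\<^sup>2)) * (fourier f \<xi> * ee (x \<bullet> \<xi>)) \<partial>lborel)
      \<longlonglongrightarrow> (\<integral>\<xi>. fourier f \<xi> * ee (x \<bullet> \<xi>) \<partial>lborel)"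
  proof (rule integral_dominated_convergence[where w = "\<lambda>\<xi>. norm (fourier f \<xi>)"])
    show "integrable lborel (\<lambda>\<xi>. norm (fourier f \<xi>))" using int_F by (rule integrable_norm)
    show "AE \<xi> in lborel. norm (complex_of_real (exp (- t n * (2 * pi * norm \<xi>)\<^sup>2)) * (fourier f \<xi> * ee (x \<bullet> \<xi>))) \<le> norm (fourier f \<xi>)" for n
      using t[of n] by (auto simp: norm_mult intro!: mult_left_le_one_le)
    have "(\<lambda>n. 1 / real (Suc n)) \<longlonglongrightarrow> 0" by (intro LIMSEQ_Suc lim_1_over_n)
    then have "t \<longlonglongrightarrow> 0\<^sup>2" unfolding t_def by (rule tendsto_power)
    then have "(\<lambda>n. complex_of_real (exp (- t n * (2 * pi * norm \<xi>)\<^sup>2)) * (fourier f \<xi> * ee (x \<bullet> \<xi>)))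
        \<longlonglongrightarrow> complex_of_real (exp (- (0\<^sup>2) * (2 * pi * norm \<xi>)\<^sup>2)) * (fourier f \<xi> * ee (x \<bullet> \<xi>))" for \<xi>
      by (intro tendsto_intros)
    then show "AE \<xi> in lborel. (\<lambda>n. complex_of_real (exp (- t n * (2 * pi * norm \<xi>)\<^sup>2)) * (fourier f \<xi> * ee (x \<bullet> \<xi>)))
        \<longlonglongrightarrow> fourier f \<xi> * ee (x \<bullet> \<xi>)"
      by simp
  qed measurable
qed

section \<open>Test functions\<close>

lemma has_vector_derivative_sequential:
  assumes "(f has_vector_derivative D) (at (0::real))"
  shows "(\<lambda>n. real (Suc n) *\<^sub>R (f (1 / real (Suc n)) - f 0)) \<longlonglongrightarrow> D"
proof -
  have "((\<lambda>h. norm (f (0 + h) - f 0 - h *\<^sub>R D) / norm h) \<longlongrightarrow> 0) (at 0)"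
    using assms unfolding has_vector_derivative_def has_derivative_at by simp
  moreover have "filterlim (\<lambda>n. 1 / real (Suc n)) (at 0) sequentially"
    by (intro filterlim_atI LIMSEQ_Suc[OF lim_1_over_n]) auto
  ultimately have "(\<lambda>n. norm (f (0 + 1 / real (Suc n)) - f 0 - (1 / real (Suc n)) *\<^sub>R D) / norm (1 / real (Suc n))) \<longlonglongrightarrow> 0"
    by (rule filterlim_compose)
  also have "(\<lambda>n. norm (f (0 + 1 / real (Suc n)) - f 0 - (1 / real (Suc n)) *\<^sub>R D) / norm (1 / real (Suc n)))
      = (\<lambda>n. norm (real (Suc n) *\<^sub>R (f (1 / real (Suc n)) - f 0) - D))"
  proof
    fix n
    have "real (Suc n) *\<^sub>R (f (1 / real (Suc n)) - f 0) - D
        = real (Suc n) *\<^sub>R (f (0 + 1 / real (Suc n)) - f 0 - (1 / real (Suc n)) *\<^sub>R D)"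
      by (simp add: scaleR_diff_right del: of_nat_Suc)
    then show "norm (f (0 + 1 / real (Suc n)) - f 0 - (1 / real (Suc n)) *\<^sub>R D) / norm (1 / real (Suc n))
        = norm (real (Suc n) *\<^sub>R (f (1 / real (Suc n)) - f 0) - D)"
      by (simp only: norm_scaleR) (simp del: of_nat_Suc)
  qed
  finally show ?thesis by (simp only: LIM_zero_iff tendsto_norm_zero_iff)
qed

lemma integrable_continuous_compact_support:
  fixes h :: "'a::euclidean_space \<Rightarrow> complex"
  assumes "continuous_on UNIV h" "compact K" "\<And>x. x \<notin> K \<Longrightarrow> h x = 0"
  shows "integrable lborel h"
proof -
  have "integrable lborel (\<lambda>x. indicator K x *\<^sub>R h x)"
    using assms by (intro borel_integrable_compact) (auto intro: continuous_on_subset)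
  also have "(\<lambda>x. indicator K x *\<^sub>R h x) = h"
    using assms(3) by (auto simp: indicator_def fun_eq_iff)
  finally show ?thesis .
qed

lemma bounded_continuous_compact_support:
  fixes h :: "'a::euclidean_space \<Rightarrow> complex"
  assumes "continuous_on UNIV h" "compact K" "\<And>x. x \<notin> K \<Longrightarrow> h x = 0"
  obtains B where "0 \<le> B" "\<And>x. norm (h x) \<le> B"
proof -
  have "compact (h ` K)"
    using assms by (intro compact_continuous_image) (auto intro: continuous_on_subset)
  then obtain b where b: "\<And>x. x \<in> K \<Longrightarrow> norm (h x) \<le> b"
    using compact_imp_bounded bounded_iff by (metis imageI)
  have "norm (h x) \<le> max b 0" for x
    using b[of x] assms(3)[of x] by (cases "x \<in> K") auto
  then show thesis using that[of "max b 0"] by auto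
qed

text \<open>Difference quotients integrate to 0 by translation invariance. They are bounded by the
  supremum of h' and vanish off one compact set, so dominated convergence passes the identity to the
  derivative.\<close>

lemma integral_directional_derivative:
  fixes h h' :: "'a::euclidean_space \<Rightarrow> complex"
  assumes der: "\<And>x s. ((\<lambda>s. h (x + s *\<^sub>R e)) has_vector_derivative h' (x + s *\<^sub>R e)) (at s)"
    and cont: "continuous_on UNIV h" "continuous_on UNIV h'"
    and K: "compact K" "\<And>x. x \<notin> K \<Longrightarrow> h x = 0" "\<And>x. x \<notin> K \<Longrightarrow> h' x = 0"
  shows "(\<integral>x. h' x \<partial>lborel) = 0"
proof -
  obtain B where B: "0 \<le> B" "\<And>x. norm (h' x) \<le> B"
    using bounded_continuous_compact_support[OF cont(2) K(1,3)] by blast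
  have [measurable]: "h \<in> borel_measurable borel" "h' \<in> borel_measurable borel"
    using cont by (auto intro: borel_measurable_continuous_onI)
  have int: "integrable lborel h" by (rule integrable_continuous_compact_support[OF cont(1) K(1,2)])
  \<comment> \<open>Contains the supports of all difference quotients with step between 0 and
    1.\<close>
  define K' where "K' = (\<lambda>(x, t). x - t *\<^sub>R e) ` (K \<times> {0..1::real})"
  have K': "compact K'"
    unfolding K'_def split_beta' using K
    by (intro compact_continuous_image compact_Times continuous_intros) auto
  define g where "g n x = real (Suc n) *\<^sub>R (h (x + (1 / real (Suc n)) *\<^sub>R e) - h x)" for n x
  have [measurable]: "g n \<in> borel_measurable borel" for n unfolding g_def by measurable
  have tr: "(\<integral>x. h (x + c) \<partial>lborel) = (\<integral>x. h x \<partial>lborel)" "integrable lborel (\<lambda>x. h (x + c))" for c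
    using integral_affine[of h 1 c] integrable_affine[OF int, of 1 c] by (simp_all add: add.commute)
  have g0: "(\<integral>x. g n x \<partial>lborel) = 0" for n
    unfolding g_def using int tr by simp
  have bound: "norm (g n x) \<le> B * indicator K' x" for n x
  proof (cases "x \<in> K'")
    case True
    have "norm (h (x + (1 / real (Suc n)) *\<^sub>R e) - h (x + 0 *\<^sub>R e)) \<le> B * norm (1 / real (Suc n) - 0)"
    proof (rule differentiable_bound[of UNIV "\<lambda>s. h (x + s *\<^sub>R e)" "\<lambda>s v. v *\<^sub>R h' (x + s *\<^sub>R e)"])
      show "((\<lambda>s. h (x + s *\<^sub>R e)) has_derivative (\<lambda>v. v *\<^sub>R h' (x + s *\<^sub>R e))) (at s within UNIV)" for s
        using der by (simp add: has_vector_derivative_def)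
      show "onorm (\<lambda>v. v *\<^sub>R h' (x + s *\<^sub>R e)) \<le> B" for s
        using B by (intro onorm_le) (simp add: mult.commute[of B] mult_left_mono)
    qed auto
    then have "real (Suc n) * norm (h (x + (1 / real (Suc n)) *\<^sub>R e) - h x) \<le> real (Suc n) * (B * (1 / real (Suc n)))"
      by (intro mult_left_mono) simp_all
    then show ?thesis using True by (simp add: g_def del: of_nat_Suc)
  next
    case False
    have shift: "x - t *\<^sub>R e \<in> K'" if "x \<in> K" "0 \<le> t" "t \<le> 1" for x t
      using that unfolding K'_def by force
    then have "x \<notin> K" "x + (1 / real (Suc n)) *\<^sub>R e \<notin> K"
      using False shift[of x 0] shift[of "x + (1 / real (Suc n)) *\<^sub>R e" "1 / real (Suc n)"]
      by (auto simp del: of_nat_Suc)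
    then show ?thesis using False K(2) by (simp add: g_def)
  qed
  have "(\<lambda>n. \<integral>x. g n x \<partial>lborel) \<longlonglongrightarrow> (\<integral>x. h' x \<partial>lborel)"
  proof (rule integral_dominated_convergence[where w = "\<lambda>x. B * indicator K' x"])
    show "integrable lborel (\<lambda>x. B * indicator K' x)"
      using K' emeasure_compact_finite[OF K'] compact_imp_closed[OF K'] by (intro integrable_mult_right) auto
    have "(\<lambda>n. g n x) \<longlonglongrightarrow> h' x" for x
      using has_vector_derivative_sequential[OF der[of x 0]] by (simp add: g_def)
    then show "AE x in lborel. (\<lambda>n. g n x) \<longlonglongrightarrow> h' x" by simp
    show "AE x in lborel. norm (g n x) \<le> B * indicator K' x" for n using bound by simp
  qed measurable
  then show ?thesis by (simp add: g0 LIMSEQ_const_iff)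
qed

section \<open>Partial derivatives and the decay of Fourier transforms\<close>

definition partial_deriv :: "'d \<Rightarrow> (real^'d \<Rightarrow> complex) \<Rightarrow> real^'d \<Rightarrow> complex" where
  "partial_deriv i f x = frechet_derivative f (at x) (axis i 1)"

lemma test_functionD:
  assumes "test_function f"
  shows "continuous_on UNIV f" "f differentiable (at x)" "compact (closure {x. f x \<noteq> 0})"
    "x \<notin> closure {x. f x \<noteq> 0} \<Longrightarrow> f x = 0"
proof -
  have "C_diff 0 f" "C_diff (Suc 0) f" using assms unfolding test_function_def by blast+
  then show "continuous_on UNIV f" "f differentiable (at x)" by auto
  show "x \<notin> closure {x. f x \<noteq> 0} \<Longrightarrow> f x = 0" using closure_subset[of "{x. f x \<noteq> 0}"] by blast
qed (use assms in \<open>simp add: test_function_def\<close>)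

lemma partial_deriv_eq_0:
  assumes "x \<notin> closure {x. f x \<noteq> 0}"
  shows "partial_deriv i f x = 0"
proof -
  have "(f has_derivative (\<lambda>_. 0)) (at x)"
  proof (rule has_derivative_transform_within_open[where f = "\<lambda>_. 0" and s = "- closure {x. f x \<noteq> 0}"])
    show "0 = f y" if "y \<in> - closure {x. f x \<noteq> 0}" for y
      using that closure_subset[of "{x. f x \<noteq> 0}"] by auto
  qed (use assms in auto)
  from frechet_derivative_at[OF this] show ?thesis by (simp add: partial_deriv_def fun_eq_iff)
qed

lemma test_function_partial_deriv:
  assumes f: "test_function f" shows "test_function (partial_deriv i f)"
proof -
  have "C_diff k (partial_deriv i f)" for k
  proof -
    have "C_diff (Suc k) f" using f unfolding test_function_def by blast
    then show ?thesis by (simp add: partial_deriv_def[abs_def])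
  qed
  moreover have "closure {x. partial_deriv i f x \<noteq> 0} \<subseteq> closure {x. f x \<noteq> 0}"
    using partial_deriv_eq_0 by (intro closure_minimal) auto
  then have "compact (closure {x. partial_deriv i f x \<noteq> 0})"
    using closed_Int_compact[OF closed_closure[of "{x. partial_deriv i f x \<noteq> 0}"] test_functionD(3)[OF f]]
    by (simp add: inf.absorb1)
  ultimately show ?thesis by (simp add: test_function_def)
qed

lemma test_function_integrable:
  assumes f: "test_function f" shows "integrable lborel f"
  by (rule integrable_continuous_compact_support[OF test_functionD(1,3)[OF f] test_functionD(4)[OF f]])

text \<open>Integration by parts: the directional derivative of f x times the character has integral
  0 by \<open>integral_directional_derivative\<close>.\<close>

lemma fourier_partial_deriv:
  fixes f :: "real^'d \<Rightarrow> complex"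
  assumes f: "test_function f"
  shows "fourier (partial_deriv i f) \<xi> = 2 * of_real pi * \<i> * of_real (\<xi> $ i) * fourier f \<xi>"
proof -
  define e :: "real^'d" where "e = axis i 1"
  define c where "c = - 2 * of_real pi * \<i> * complex_of_real (\<xi> $ i)"
  define K where "K = closure {x. f x \<noteq> 0}"
  note tf' = test_function_partial_deriv[OF f, of i]
  note cont = test_functionD(1)[OF f] test_functionD(1)[OF tf']
  have [measurable]: "f \<in> borel_measurable borel" "partial_deriv i f \<in> borel_measurable borel"
    using cont by (auto intro: borel_measurable_continuous_onI)
  have ei: "e \<bullet> \<xi> = \<xi> $ i" by (simp add: e_def inner_axis')
  have "(\<integral>x. partial_deriv i f x * ee (- (x \<bullet> \<xi>)) + f x * (c * ee (- (x \<bullet> \<xi>))) \<partial>lborel) = 0"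
  proof (rule integral_directional_derivative[where h = "\<lambda>x. f x * ee (- (x \<bullet> \<xi>))" and e = e and K = K])
    fix x s
    let ?y = "x + s *\<^sub>R e"
    have "(f has_derivative frechet_derivative f (at ?y)) (at ?y)"
      using test_functionD(2)[OF f] frechet_derivative_works by blast
    then have "((\<lambda>s. f (x + s *\<^sub>R e)) has_derivative (\<lambda>t. frechet_derivative f (at ?y) (t *\<^sub>R e))) (at s)"
      by (intro has_derivative_compose[where f = "\<lambda>s. x + s *\<^sub>R e" and g = f]) (auto intro!: derivative_eq_intros)
    moreover have "frechet_derivative f (at ?y) (t *\<^sub>R e) = t *\<^sub>R partial_deriv i f ?y" for t
      using linear_frechet_derivative[OF test_functionD(2)[OF f]] by (simp add: linear_scale partial_deriv_def e_def)
    ultimately have 1: "((\<lambda>s. f (x + s *\<^sub>R e)) has_vector_derivative partial_deriv i f ?y) (at s)"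
      by (simp add: has_vector_derivative_def)
    have eq: "ee (- ((x + s *\<^sub>R e) \<bullet> \<xi>)) = ee (- (x \<bullet> \<xi>)) * exp (c * of_real s)" for s
      by (simp add: ee_def c_def inner_add_left ei algebra_simps flip: exp_add)
    have "((\<lambda>s. ee (- (x \<bullet> \<xi>)) * exp (c * of_real s)) has_vector_derivative ee (- (x \<bullet> \<xi>)) * (c * exp (c * of_real s))) (at s)"
      by (rule has_vector_derivative_real_field) (auto intro!: derivative_eq_intros)
    then have 2: "((\<lambda>s. ee (- ((x + s *\<^sub>R e) \<bullet> \<xi>))) has_vector_derivative c * ee (- (?y \<bullet> \<xi>))) (at s)"
      unfolding eq by (simp add: mult_ac)
    show "((\<lambda>s. f (x + s *\<^sub>R e) * ee (- ((x + s *\<^sub>R e) \<bullet> \<xi>))) has_vector_derivative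
        partial_deriv i f ?y * ee (- (?y \<bullet> \<xi>)) + f ?y * (c * ee (- (?y \<bullet> \<xi>)))) (at s)"
      using has_vector_derivative_mult[OF 1 2] by (simp add: add.commute)
  next
    show "compact K" using test_functionD(3)[OF f] by (simp add: K_def)
    show "f x * ee (- (x \<bullet> \<xi>)) = 0" if "x \<notin> K" for x
      using test_functionD(4)[OF f that[unfolded K_def]] by simp
    show "partial_deriv i f x * ee (- (x \<bullet> \<xi>)) + f x * (c * ee (- (x \<bullet> \<xi>))) = 0" if "x \<notin> K" for x
      using test_functionD(4)[OF f that[unfolded K_def]] partial_deriv_eq_0[OF that[unfolded K_def]]
      by simp
  qed (use cont in \<open>auto intro!: continuous_intros\<close>)
  moreover have "integrable lborel (\<lambda>x. partial_deriv i f x * ee (- (x \<bullet> \<xi>)))"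
    by (intro integrable_mult_ee test_function_integrable tf') simp
  moreover have int: "integrable lborel (\<lambda>x. f x * ee (- (x \<bullet> \<xi>)))"
    by (intro integrable_mult_ee test_function_integrable f) simp
  have "integrable lborel (\<lambda>x. f x * (c * ee (- (x \<bullet> \<xi>))))"
    using integrable_mult_right[OF int, of c] by (simp add: mult_ac)
  ultimately have "fourier (partial_deriv i f) \<xi> + (\<integral>x. f x * (c * ee (- (x \<bullet> \<xi>))) \<partial>lborel) = 0"
    by (simp add: fourier_eq)
  moreover have "(\<integral>x. f x * (c * ee (- (x \<bullet> \<xi>))) \<partial>lborel) = c * fourier f \<xi>"
    by (simp add: fourier_eq mult.left_commute)
  ultimately have "fourier (partial_deriv i f) \<xi> = - c * fourier f \<xi>"
    by (simp add: eq_neg_iff_add_eq_0)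
  then show ?thesis by (simp add: c_def)
qed

lemma norm_fourier_le:
  assumes "integrable lborel f" shows "norm (fourier f \<xi>) \<le> (\<integral>x. norm (f x) \<partial>lborel)"
proof -
  have [measurable]: "f \<in> borel_measurable borel" using borel_measurable_integrable[OF assms] by simp
  have "norm (fourier f \<xi>) \<le> (\<integral>x. norm (f x * ee (- (x \<bullet> \<xi>))) \<partial>lborel)"
    unfolding fourier_eq[OF \<open>f \<in> borel_measurable borel\<close>] by (rule integral_norm_bound)
  then show ?thesis by (simp add: norm_mult)
qed

text \<open>Induction over all test functions at once: one factor 1 + |\<xi>|^2 is paid for by the
  transforms of f and of its pure second derivatives, which are test functions again. The factors (2
  pi)^2 are at least 1 and are dropped.\<close>

lemma fourier_rapidly_decreasing:
  fixes f :: "real^'d \<Rightarrow> complex"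
  shows "test_function f \<Longrightarrow> \<exists>C\<ge>0. \<forall>\<xi>. (1 + (norm \<xi>)\<^sup>2) ^ N * norm (fourier f \<xi>) \<le> C"
proof (induction N arbitrary: f)
  case 0
  then show ?case
    using norm_fourier_le[OF test_function_integrable[OF 0]]
    by (intro exI[of _ "\<integral>x. norm (f x) \<partial>lborel"]) auto
next
  case (Suc N)
  obtain C where C: "0 \<le> C" "\<And>\<xi>. (1 + (norm \<xi>)\<^sup>2) ^ N * norm (fourier f \<xi>) \<le> C"
    using Suc by blast
  define d where "d i = partial_deriv i (partial_deriv i f)" for i
  have d: "test_function (d i)" for i
    using Suc.prems by (simp add: d_def test_function_partial_deriv)
  obtain D where D: "\<And>i. 0 \<le> D i" "\<And>i \<xi>. (1 + (norm \<xi>)\<^sup>2) ^ N * norm (fourier (d i) \<xi>) \<le> D i"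
    using Suc.IH[OF d] by metis
  have fd: "norm (fourier (d i) \<xi>) = (2 * pi)\<^sup>2 * (\<xi> $ i)\<^sup>2 * norm (fourier f \<xi>)" for i \<xi>
    unfolding d_def using Suc.prems
    by (simp add: fourier_partial_deriv test_function_partial_deriv norm_mult power2_eq_square)
  have "1 \<le> 2 * pi" using pi_gt3 by simp
  then have "1\<^sup>2 \<le> (2 * pi)\<^sup>2" by (rule power_mono) simp
  then have fd': "(\<xi> $ i)\<^sup>2 * norm (fourier f \<xi>) \<le> norm (fourier (d i) \<xi>)" for i \<xi>
    unfolding fd using mult_right_mono[of 1 "(2 * pi)\<^sup>2" "(\<xi> $ i)\<^sup>2 * norm (fourier f \<xi>)"]
    by (simp add: mult.assoc)
  show ?case
  proof (intro exI[of _ "C + (\<Sum>i\<in>UNIV. D i)"] conjI allI)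
    show "0 \<le> C + (\<Sum>i\<in>UNIV. D i)" using C D by (simp add: sum_nonneg)
    fix \<xi> :: "real^'d"
    have "(norm \<xi>)\<^sup>2 = (\<Sum>i\<in>UNIV. (\<xi> $ i)\<^sup>2)"
      unfolding power2_norm_eq_inner inner_vec_def by (simp add: power2_eq_square)
    then have "(1 + (norm \<xi>)\<^sup>2) * norm (fourier f \<xi>)
        = norm (fourier f \<xi>) + (\<Sum>i\<in>UNIV. (\<xi> $ i)\<^sup>2 * norm (fourier f \<xi>))"
      by (simp add: distrib_right sum_distrib_right)
    also have "\<dots> \<le> norm (fourier f \<xi>) + (\<Sum>i\<in>UNIV. norm (fourier (d i) \<xi>))"
      by (intro add_left_mono sum_mono fd')
    finally have "(1 + (norm \<xi>)\<^sup>2) ^ N * ((1 + (norm \<xi>)\<^sup>2) * norm (fourier f \<xi>))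
        \<le> (1 + (norm \<xi>)\<^sup>2) ^ N * (norm (fourier f \<xi>) + (\<Sum>i\<in>UNIV. norm (fourier (d i) \<xi>)))"
      by (rule mult_left_mono) simp
    also have "\<dots> = (1 + (norm \<xi>)\<^sup>2) ^ N * norm (fourier f \<xi>)
        + (\<Sum>i\<in>UNIV. (1 + (norm \<xi>)\<^sup>2) ^ N * norm (fourier (d i) \<xi>))"
      by (simp add: distrib_left sum_distrib_left)
    also have "\<dots> \<le> C + (\<Sum>i\<in>UNIV. D i)"
      by (intro add_mono C sum_mono D)
    finally show "(1 + (norm \<xi>)\<^sup>2) ^ Suc N * norm (fourier f \<xi>) \<le> C + (\<Sum>i\<in>UNIV. D i)"
      by (simp add: mult_ac)
  qed
qed

text \<open>Each |x \<bullet> b| is at most |x|, so the function lies below a product of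
  one-dimensional functions 1 / (1 + y^2).\<close>

lemma integrable_inverse_norm_power:
  "integrable lborel (\<lambda>x::'a::euclidean_space. inverse ((1 + (norm x)\<^sup>2) ^ DIM('a)))"
proof (rule Bochner_Integration.integrable_bound)
  show "integrable lborel (\<lambda>x::'a. \<Prod>b\<in>Basis. inverse (1 + (x \<bullet> b)\<^sup>2))"
    by (rule integrable_lborel_prod) (rule integrable_inverse_1_plus_square_lborel)
  show "AE x::'a in lborel. norm (inverse ((1 + (norm x)\<^sup>2) ^ DIM('a))) \<le> norm (\<Prod>b\<in>Basis. inverse (1 + (x \<bullet> b)\<^sup>2))"
  proof (intro AE_I2)
    fix x :: 'a
    have "(\<Prod>b\<in>(Basis::'a set). inverse (1 + (norm x)\<^sup>2)) \<le> (\<Prod>b\<in>Basis. inverse (1 + (x \<bullet> b)\<^sup>2))"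
    proof (intro prod_mono conjI)
      fix b :: 'a assume "b \<in> Basis"
      then have "\<bar>x \<bullet> b\<bar> \<le> norm x" by (rule Basis_le_norm)
      then have "(x \<bullet> b)\<^sup>2 \<le> (norm x)\<^sup>2" by (metis abs_ge_zero power2_abs power_mono)
      then show "inverse (1 + (norm x)\<^sup>2) \<le> inverse (1 + (x \<bullet> b)\<^sup>2)"
        by (intro le_imp_inverse_le) (auto simp: add_pos_nonneg)
    qed auto
    then show "norm (inverse ((1 + (norm x)\<^sup>2) ^ DIM('a))) \<le> norm (\<Prod>b\<in>Basis. inverse (1 + (x \<bullet> b)\<^sup>2))"
      by (simp add: power_inverse)
  qed
qed simp

lemma measurable_fourier [measurable]:
  assumes [measurable]: "f \<in> borel_measurable borel"
  shows "fourier f \<in> borel_measurable borel"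
  unfolding fourier_eq[OF assms, abs_def] by measurable

lemma integrable_powr_fourier:
  fixes f :: "real^'d \<Rightarrow> complex"
  assumes f: "test_function f" and a: "0 < \<alpha>"
  shows "integrable lborel (\<lambda>\<xi>. complex_of_real ((2 * pi * norm \<xi>) powr \<alpha>) * fourier f \<xi>)"
    and "integrable lborel (fourier f)"
proof -
  have [measurable]: "f \<in> borel_measurable borel"
    using test_functionD(1)[OF f] by (rule borel_measurable_continuous_onI)
  define M where "M = nat \<lceil>\<alpha>\<rceil>"
  have M: "\<alpha> \<le> real M" unfolding M_def by linarith
  \<comment> \<open>Growth of order n is beaten by asking for decay of order n + d, whose last d
    factors are integrable.\<close>
  have bd: "integrable lborel (\<lambda>\<xi>. g \<xi> * fourier f \<xi>)"
    if [measurable]: "g \<in> borel_measurable borel" and g: "\<And>\<xi>. norm (g \<xi>) \<le> c * (1 + (norm \<xi>)\<^sup>2) ^ n" "0 \<le> c"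
    for g :: "real^'d \<Rightarrow> complex" and c n
  proof -
    obtain C where C: "0 \<le> C" "\<And>\<xi>. (1 + (norm \<xi>)\<^sup>2) ^ (n + CARD('d)) * norm (fourier f \<xi>) \<le> C"
      using fourier_rapidly_decreasing[OF f] by blast
    show ?thesis
    proof (rule Bochner_Integration.integrable_bound)
      show "integrable lborel (\<lambda>x::real^'d. c * C * inverse ((1 + (norm x)\<^sup>2) ^ DIM(real^'d)))"
        by (intro integrable_mult_right integrable_inverse_norm_power)
      show "AE \<xi> in lborel. norm (g \<xi> * fourier f \<xi>)
          \<le> norm (c * C * inverse ((1 + (norm \<xi>)\<^sup>2) ^ DIM(real^'d)))"
      proof (intro AE_I2)
        fix \<xi> :: "real^'d"
        define y where "y = 1 + (norm \<xi>)\<^sup>2"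
        have y: "0 < y" by (simp add: y_def add_pos_nonneg)
        have "norm (g \<xi> * fourier f \<xi>) \<le> c * (y ^ n * norm (fourier f \<xi>))"
          using mult_right_mono[OF g(1)[of \<xi>], of "norm (fourier f \<xi>)"] by (simp add: norm_mult y_def mult.assoc)
        also have "y ^ n * norm (fourier f \<xi>) \<le> C * inverse (y ^ CARD('d))"
          using C(2)[of \<xi>] y by (simp add: y_def[symmetric] power_add field_simps)
        finally show "norm (g \<xi> * fourier f \<xi>) \<le> norm (c * C * inverse ((1 + (norm \<xi>)\<^sup>2) ^ DIM(real^'d)))"
          using y C g(2) by (simp add: y_def[symmetric] mult_left_mono mult.assoc)
      qed
    qed measurable
  qed
  show "integrable lborel (fourier f)"
    using bd[of "\<lambda>_. 1" 1 0] by simp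
  show "integrable lborel (\<lambda>\<xi>. complex_of_real ((2 * pi * norm \<xi>) powr \<alpha>) * fourier f \<xi>)"
  proof (rule bd)
    fix \<xi> :: "real^'d"
    have "0 \<le> (1 - norm \<xi>)\<^sup>2" by simp
    then have n: "norm \<xi> \<le> 1 + (norm \<xi>)\<^sup>2"
      by (simp add: power2_eq_square algebra_simps) (smt (verit) zero_le_square)
    have "norm \<xi> powr \<alpha> \<le> (1 + (norm \<xi>)\<^sup>2) powr \<alpha>" using n a by (intro powr_mono2) auto
    also have "\<dots> \<le> (1 + (norm \<xi>)\<^sup>2) powr real M" using M by (intro powr_mono) auto
    also have "\<dots> = (1 + (norm \<xi>)\<^sup>2) ^ M" by (subst powr_realpow) (auto simp: add_pos_nonneg)
    finally show "norm (complex_of_real ((2 * pi * norm \<xi>) powr \<alpha>)) \<le> (2 * pi) powr \<alpha> * (1 + (norm \<xi>)\<^sup>2) ^ M"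
      unfolding norm_of_real by (subst powr_mult) (auto simp: abs_mult mult_left_mono)
  qed auto
qed

section \<open>Representation of test functions\<close>

text \<open>Holds without integrability: the Bochner integral of a non-integrable function is 0 by
  default.\<close>

lemma ennreal_norm_integral_le:
  fixes f :: "'a \<Rightarrow> 'b::{banach, second_countable_topology}"
  shows "ennreal (norm (integral\<^sup>L M f)) \<le> (\<integral>\<^sup>+x. ennreal (norm (f x)) \<partial>M)"
  by (cases "integrable M f") (auto simp: integral_norm_bound_ennreal not_integrable_integral_eq)

lemma measurable_frac_laplacian:
  assumes f: "test_function f" and a: "0 < \<alpha>"
  shows "frac_laplacian \<alpha> f \<in> borel_measurable borel"
proof -
  have [measurable]: "f \<in> borel_measurable borel"
    using test_functionD(1)[OF f] by (rule borel_measurable_continuous_onI)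
  have [measurable]: "(\<lambda>\<xi>. complex_of_real ((2 * pi * norm \<xi>) powr \<alpha>) * fourier f \<xi>) \<in> borel_measurable borel"
    by measurable
  have "frac_laplacian \<alpha> f = (\<lambda>x. \<integral>\<xi>. complex_of_real ((2 * pi * norm \<xi>) powr \<alpha>) * fourier f \<xi> * ee (x \<bullet> \<xi>) \<partial>lborel)"
    unfolding frac_laplacian_def by (intro ext inverse_fourier_eq) measurable
  then show ?thesis by simp
qed

text \<open>The left-hand side averages the heat flow of the fractional Laplacian against the
  difference density. Exchanging the integrals, the integral over s equals Gamma (\<alpha>/2)
  \<tau>^(- \<alpha>/2) |2 pi \<xi>|^(- \<alpha>) (1 - exp (- \<tau> |2 pi \<xi>|^2))^m. The
  negative power cancels the symbol, and the binomial expansion gives \<phi> for j = 0 by inversion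
  and heat averages for the other j.\<close>

lemma test_function_representation:
  fixes \<phi> :: "real^'d \<Rightarrow> complex"
  assumes \<phi>: "test_function \<phi>" and \<alpha>: "0 < \<alpha>" and \<tau>: "0 < \<tau>" and m: "\<alpha> / 2 + 1 \<le> real m"
  shows "(\<integral>s. complex_of_real (fdiff m (\<alpha> / 2 - 1) s) *
        (\<integral>\<xi>. complex_of_real (exp (- (\<tau> * s) * (2 * pi * norm \<xi>)\<^sup>2)) *
          (complex_of_real ((2 * pi * norm \<xi>) powr \<alpha>) * fourier \<phi> \<xi> * ee (x \<bullet> \<xi>)) \<partial>lborel) \<partial>lborel)
    = complex_of_real (Gamma (\<alpha> / 2) * \<tau> powr (- \<alpha> / 2)) *
      (\<phi> x + (\<Sum>j=1..m. (- 1) ^ j * of_nat (m choose j) *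
        (\<integral>y. complex_of_real (heat_kernel (real j * \<tau>) (x - y)) * \<phi> y \<partial>lborel)))"
proof -
  define \<beta> where "\<beta> = \<alpha> / 2 - 1"
  have \<beta>: "- 1 < \<beta>" "\<beta> + 2 \<le> real m" using \<alpha> m by (auto simp: \<beta>_def)
  have m0: "0 < m" using m \<alpha> by (cases m) auto
  define z where "z \<xi> = (2 * pi * norm \<xi>)\<^sup>2" for \<xi> :: "real^'d"
  have [measurable]: "z \<in> borel_measurable borel" unfolding z_def by measurable
  define G where "G \<xi> = complex_of_real ((2 * pi * norm \<xi>) powr \<alpha>) * fourier \<phi> \<xi> * ee (x \<bullet> \<xi>)" for \<xi>
  define H where "H \<xi> = fourier \<phi> \<xi> * ee (x \<bullet> \<xi>)" for \<xi>
  have G: "integrable lborel G" unfolding G_def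
    by (intro integrable_mult_ee integrable_powr_fourier \<phi> \<alpha>) simp
  have H: "integrable lborel H" unfolding H_def
    by (intro integrable_mult_ee integrable_powr_fourier(2)[OF \<phi> \<alpha>]) simp
  have [measurable]: "G \<in> borel_measurable borel" "H \<in> borel_measurable borel"
    using borel_measurable_integrable[OF G] borel_measurable_integrable[OF H] by simp_all
  define D where "D s = fdiff m \<beta> s" for s
  have [measurable]: "D \<in> borel_measurable borel" unfolding D_def[abs_def] by measurable
  have D: "integrable lborel (\<lambda>s. complex_of_real (D s))"
    using integrable_fdiff[OF \<beta>] by (simp add: D_def[abs_def] complex_of_real_integrable_eq)
  \<comment> \<open>For negative s the exponential factor would exceed every bound; the density
    vanishes there, which saves the domination needed for Fubini.\<close>
  have D0: "D s = 0" if "s \<le> 0" for s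
    using that unfolding D_def fdiff_def by (intro sum.neutral) (auto simp: trunc_powr_def)
  have inv: "(\<integral>\<xi>. fourier \<phi> \<xi> * ee (y \<bullet> \<xi>) \<partial>lborel) = \<phi> y" for y
  proof -
    obtain B where "\<And>x. norm (\<phi> x) \<le> B"
      using bounded_continuous_compact_support[OF test_functionD(1,3)[OF \<phi>] test_functionD(4)[OF \<phi>]] by blast
    then show ?thesis
      by (rule fourier_inversion[OF test_functionD(1)[OF \<phi>] _ test_function_integrable[OF \<phi>]
            integrable_powr_fourier(2)[OF \<phi> \<alpha>]])
  qed
  have heat_H: "(\<integral>\<xi>. complex_of_real (exp (- t * z \<xi>)) * H \<xi> \<partial>lborel)
      = (\<integral>y. complex_of_real (heat_kernel t (x - y)) * \<phi> y \<partial>lborel)" if "0 < t" for t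
    using heat_kernel_integral_ee[OF integrable_powr_fourier(2)[OF \<phi> \<alpha>] that, of x]
    by (simp add: inv z_def H_def)
  have int: "integrable (lborel \<Otimes>\<^sub>M lborel)
      (\<lambda>(s, \<xi>). complex_of_real (D s) * (complex_of_real (exp (- (\<tau> * s) * z \<xi>)) * G \<xi>))"
  proof (rule integrable_pair_lborel_mult[OF D G])
    fix s \<xi>
    show "norm (complex_of_real (D s) * (complex_of_real (exp (- (\<tau> * s) * z \<xi>)) * G \<xi>))
        \<le> norm (complex_of_real (D s)) * norm (G \<xi>)"
    proof (cases "s \<le> 0")
      case False
      then have "exp (- (\<tau> * s) * z \<xi>) \<le> 1" using \<tau> by (simp add: z_def)
      then show ?thesis by (simp add: norm_mult mult_left_mono mult_left_le_one_le)
    qed (simp add: D0)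
  qed measurable
  have inner: "(\<integral>s. complex_of_real (D s) * (complex_of_real (exp (- (\<tau> * s) * z \<xi>)) * G \<xi>) \<partial>lborel)
      = complex_of_real (Gamma (\<alpha> / 2) * \<tau> powr (- \<alpha> / 2)) * (complex_of_real ((1 - exp (- \<tau> * z \<xi>)) ^ m) * H \<xi>)" for \<xi>
  proof (cases "\<xi> = 0")
    \<comment> \<open>At the origin both sides vanish, the left because
      \<open>0 powr \<alpha>\<close> is 0 and the right because m > 0.\<close>
    case True
    then show ?thesis using m0 \<alpha> by (simp add: G_def z_def)
  next
    case False
    then have n: "0 < norm \<xi>" by simp
    then have z: "0 < z \<xi>" by (simp add: z_def)
    have "(\<integral>s. complex_of_real (D s) * (complex_of_real (exp (- (\<tau> * s) * z \<xi>)) * G \<xi>) \<partial>lborel)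
        = (\<integral>s. complex_of_real (fdiff m \<beta> s * exp (- s * (\<tau> * z \<xi>))) * G \<xi> \<partial>lborel)"
      by (simp add: D_def mult_ac)
    also have "\<dots> = complex_of_real (\<integral>s. fdiff m \<beta> s * exp (- s * (\<tau> * z \<xi>)) \<partial>lborel) * G \<xi>"
      by (simp only: integral_mult_left_zero integral_complex_of_real)
    also have "(\<integral>s. fdiff m \<beta> s * exp (- s * (\<tau> * z \<xi>)) \<partial>lborel)
        = Gamma (\<alpha> / 2) * (\<tau> * z \<xi>) powr (- \<alpha> / 2) * (1 - exp (- \<tau> * z \<xi>)) ^ m"
      using integral_fdiff_exp[OF \<beta>(1), of "\<tau> * z \<xi>" m] \<tau> z by (simp add: \<beta>_def)
    also have "(\<tau> * z \<xi>) powr (- \<alpha> / 2) = \<tau> powr (- \<alpha> / 2) * (2 * pi * norm \<xi>) powr (- \<alpha>)"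
    proof -
      have "z \<xi> powr (- \<alpha> / 2) = ((2 * pi * norm \<xi>) powr 2) powr (- \<alpha> / 2)"
        using n by (simp add: z_def)
      also have "\<dots> = (2 * pi * norm \<xi>) powr (- \<alpha>)" by (simp only: powr_powr) simp
      finally show ?thesis using \<tau> z by (simp add: powr_mult)
    qed
    also have "complex_of_real (Gamma (\<alpha> / 2) * (\<tau> powr (- \<alpha> / 2) * (2 * pi * norm \<xi>) powr (- \<alpha>)) *
          (1 - exp (- \<tau> * z \<xi>)) ^ m) * G \<xi>
        = complex_of_real (Gamma (\<alpha> / 2) * \<tau> powr (- \<alpha> / 2)) * (complex_of_real ((1 - exp (- \<tau> * z \<xi>)) ^ m) *
          (complex_of_real ((2 * pi * norm \<xi>) powr (- \<alpha>) * (2 * pi * norm \<xi>) powr \<alpha>) * H \<xi>))"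
      by (simp only: G_def H_def of_real_mult mult_ac)
    also have "(2 * pi * norm \<xi>) powr (- \<alpha>) * (2 * pi * norm \<xi>) powr \<alpha> = 1"
      using n by (simp flip: powr_add)
    finally show ?thesis by (simp only: of_real_1 mult_1)
  qed
  have "(\<integral>s. complex_of_real (D s) * (\<integral>\<xi>. complex_of_real (exp (- (\<tau> * s) * z \<xi>)) * G \<xi> \<partial>lborel) \<partial>lborel)
      = (\<integral>s. (\<integral>\<xi>. complex_of_real (D s) * (complex_of_real (exp (- (\<tau> * s) * z \<xi>)) * G \<xi>) \<partial>lborel) \<partial>lborel)"
    by simp
  also have "\<dots> = (\<integral>\<xi>. (\<integral>s. complex_of_real (D s) * (complex_of_real (exp (- (\<tau> * s) * z \<xi>)) * G \<xi>) \<partial>lborel) \<partial>lborel)"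
    by (rule lborel_pair.Fubini_integral[OF int, symmetric])
  also have "\<dots> = complex_of_real (Gamma (\<alpha> / 2) * \<tau> powr (- \<alpha> / 2)) *
      (\<integral>\<xi>. complex_of_real ((1 - exp (- \<tau> * z \<xi>)) ^ m) * H \<xi> \<partial>lborel)"
    unfolding inner by (rule integral_mult_right_zero)
  also have "(\<integral>\<xi>. complex_of_real ((1 - exp (- \<tau> * z \<xi>)) ^ m) * H \<xi> \<partial>lborel)
      = (\<integral>\<xi>. (\<Sum>j\<le>m. (- 1) ^ j * of_nat (m choose j) * (complex_of_real (exp (- (real j * \<tau>) * z \<xi>)) * H \<xi>)) \<partial>lborel)"
  proof (intro Bochner_Integration.integral_cong refl)
    fix \<xi>
    have "(1 - exp (- \<tau> * z \<xi>)) ^ m = (\<Sum>j\<le>m. (- 1) ^ j * real (m choose j) * exp (- (real j * \<tau>) * z \<xi>))"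
      using power_one_minus_exp[of "\<tau> * z \<xi>" m] by (simp add: mult.assoc)
    then show "complex_of_real ((1 - exp (- \<tau> * z \<xi>)) ^ m) * H \<xi>
       = (\<Sum>j\<le>m. (- 1) ^ j * of_nat (m choose j) * (complex_of_real (exp (- (real j * \<tau>) * z \<xi>)) * H \<xi>))"
      by (simp add: sum_distrib_right mult.assoc)
  qed
  also have "\<dots> = (\<Sum>j\<le>m. (- 1) ^ j * of_nat (m choose j) * (\<integral>\<xi>. complex_of_real (exp (- (real j * \<tau>) * z \<xi>)) * H \<xi> \<partial>lborel))"
  proof -
    have int2: "integrable lborel (\<lambda>\<xi>. complex_of_real (exp (- (real j * \<tau>) * z \<xi>)) * H \<xi>)" for j
      by (rule Bochner_Integration.integrable_bound[OF H])
         (use \<tau> in \<open>auto simp: norm_mult z_def intro!: mult_left_le_one_le\<close>)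
    show ?thesis
      unfolding integral_mult_right_zero[symmetric]
      by (rule Bochner_Integration.integral_sum) (rule integrable_mult_right[OF int2])
  qed
  also have "\<dots> = (\<integral>\<xi>. H \<xi> \<partial>lborel) + (\<Sum>j=1..m. (- 1) ^ j * of_nat (m choose j) * (\<integral>\<xi>. complex_of_real (exp (- (real j * \<tau>) * z \<xi>)) * H \<xi> \<partial>lborel))"
    by (simp add: atMost_atLeast0 sum.atLeast_Suc_atMost)
  also have "(\<integral>\<xi>. H \<xi> \<partial>lborel) = \<phi> x" unfolding H_def by (rule inv)
  also have "(\<Sum>j=1..m. (- 1) ^ j * of_nat (m choose j) * (\<integral>\<xi>. complex_of_real (exp (- (real j * \<tau>) * z \<xi>)) * H \<xi> \<partial>lborel))
      = (\<Sum>j=1..m. (- 1) ^ j * of_nat (m choose j) * (\<integral>y. complex_of_real (heat_kernel (real j * \<tau>) (x - y)) * \<phi> y \<partial>lborel))"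
    using \<tau> by (intro sum.cong refl arg_cong2[where f = "(*)"] heat_H) auto
  finally show ?thesis by (simp only: D_def \<beta>_def z_def G_def)
qed

text \<open>Norms are taken in the representation, after which everything is a positive operator on
  [0, \<infinity>]-valued functions and cancellation is no longer used.\<close>

lemma test_function_heat_bound:
  fixes \<phi> :: "real^'d \<Rightarrow> complex"
  assumes \<phi>: "test_function \<phi>" and \<alpha>: "0 < \<alpha>" and \<tau>: "0 < \<tau>" and m: "\<alpha> / 2 + 1 \<le> real m"
  shows "ennreal (norm (\<phi> x)) \<le>
      (\<Sum>j=1..m. ennreal (real (m choose j)) * heat (real j * \<tau>) (\<lambda>y. ennreal (norm (\<phi> y))) x)
    + ennreal (\<tau> powr (\<alpha> / 2) / Gamma (\<alpha> / 2)) *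
      (\<integral>\<^sup>+s. indicator {0<..} s * ennreal \<bar>fdiff m (\<alpha> / 2 - 1) s\<bar> *
        heat (\<tau> * s) (\<lambda>y. ennreal (norm (frac_laplacian \<alpha> \<phi> y))) x \<partial>lborel)"
proof -
  define c where "c = Gamma (\<alpha> / 2) * \<tau> powr (- \<alpha> / 2)"
  have c: "0 < c" "1 / c = \<tau> powr (\<alpha> / 2) / Gamma (\<alpha> / 2)"
    using \<tau> \<alpha> Gamma_real_pos[of "\<alpha> / 2"] by (auto simp: c_def powr_minus field_simps)
  define A where "A t = (\<integral>y. complex_of_real (heat_kernel t (x - y)) * \<phi> y \<partial>lborel)" for t
  define S where "S = (\<Sum>j=1..m. (- 1) ^ j * of_nat (m choose j) * A (real j * \<tau>))"
  define G where "G \<xi> = complex_of_real ((2 * pi * norm \<xi>) powr \<alpha>) * fourier \<phi> \<xi>" for \<xi>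
  have G: "integrable lborel G" unfolding G_def by (rule integrable_powr_fourier(1)[OF \<phi> \<alpha>])
  have [measurable]: "G \<in> borel_measurable borel" using borel_measurable_integrable[OF G] by simp
  have g: "frac_laplacian \<alpha> \<phi> y = (\<integral>\<xi>. G \<xi> * ee (y \<bullet> \<xi>) \<partial>lborel)" for y
    unfolding frac_laplacian_def G_def[symmetric] by (rule inverse_fourier_eq) simp
  define I where "I s = (\<integral>\<xi>. complex_of_real (exp (- (\<tau> * s) * (2 * pi * norm \<xi>)\<^sup>2)) * (G \<xi> * ee (x \<bullet> \<xi>)) \<partial>lborel)" for s
  define X where "X = (\<integral>\<^sup>+s. indicator {0<..} s * ennreal \<bar>fdiff m (\<alpha> / 2 - 1) s\<bar> *
        heat (\<tau> * s) (\<lambda>y. ennreal (norm (frac_laplacian \<alpha> \<phi> y))) x \<partial>lborel)"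
  have rep: "(\<integral>s. complex_of_real (fdiff m (\<alpha> / 2 - 1) s) * I s \<partial>lborel) = complex_of_real c * (\<phi> x + S)"
    using test_function_representation[OF \<phi> \<alpha> \<tau> m, of x]
    unfolding I_def G_def c_def S_def A_def .
  have "ennreal (norm (complex_of_real c * (\<phi> x + S))) \<le> (\<integral>\<^sup>+s. ennreal (norm (complex_of_real (fdiff m (\<alpha> / 2 - 1) s) * I s)) \<partial>lborel)"
    unfolding rep[symmetric] by (rule ennreal_norm_integral_le)
  also have "\<dots> \<le> X" unfolding X_def
  proof (intro nn_integral_mono)
    fix s :: real
    show "ennreal (norm (complex_of_real (fdiff m (\<alpha> / 2 - 1) s) * I s))
        \<le> indicator {0<..} s * ennreal \<bar>fdiff m (\<alpha> / 2 - 1) s\<bar> * heat (\<tau> * s) (\<lambda>y. ennreal (norm (frac_laplacian \<alpha> \<phi> y))) x"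
    proof (cases "0 < s")
      case False
      then have "fdiff m (\<alpha> / 2 - 1) s = 0"
        unfolding fdiff_def by (intro sum.neutral) (auto simp: trunc_powr_def)
      then show ?thesis by simp
    next
      case True
      then have "I s = (\<integral>y. complex_of_real (heat_kernel (\<tau> * s) (x - y)) * frac_laplacian \<alpha> \<phi> y \<partial>lborel)"
        unfolding I_def g using \<tau> by (intro heat_kernel_integral_ee[symmetric] G) auto
      then have "ennreal (norm (I s)) \<le> heat (\<tau> * s) (\<lambda>y. ennreal (norm (frac_laplacian \<alpha> \<phi> y))) x"
        using ennreal_norm_integral_le[of lborel "\<lambda>y. complex_of_real (heat_kernel (\<tau> * s) (x - y)) * frac_laplacian \<alpha> \<phi> y"]
        by (simp add: heat_def norm_mult ennreal_mult)
      then show ?thesis using True by (simp add: norm_mult ennreal_mult mult_left_mono)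
    qed
  qed
  finally have 1: "ennreal c * ennreal (norm (\<phi> x + S)) \<le> X"
    using c by (simp add: norm_mult ennreal_mult)
  have "ennreal (norm (\<phi> x + S)) = ennreal (1 / c) * (ennreal c * ennreal (norm (\<phi> x + S)))"
    using c(1) by (simp add: mult.assoc[symmetric] flip: ennreal_mult)
  also have "\<dots> \<le> ennreal (1 / c) * X" by (intro mult_left_mono 1) simp
  finally have 2: "ennreal (norm (\<phi> x + S)) \<le> ennreal (1 / c) * X" .
  have 3: "ennreal (norm S) \<le> (\<Sum>j=1..m. ennreal (real (m choose j)) * heat (real j * \<tau>) (\<lambda>y. ennreal (norm (\<phi> y))) x)"
  proof -
    have "norm S \<le> (\<Sum>j=1..m. real (m choose j) * norm (A (real j * \<tau>)))"
      unfolding S_def by (rule order_trans[OF norm_sum]) (simp add: norm_mult norm_power)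
    then have "ennreal (norm S) \<le> (\<Sum>j=1..m. ennreal (real (m choose j)) * ennreal (norm (A (real j * \<tau>))))"
      by (subst ennreal_mult[symmetric], simp, simp, subst sum_ennreal) (auto intro: ennreal_leI)
    also have "\<dots> \<le> (\<Sum>j=1..m. ennreal (real (m choose j)) * heat (real j * \<tau>) (\<lambda>y. ennreal (norm (\<phi> y))) x)"
    proof (intro sum_mono mult_left_mono)
      fix j
      show "ennreal (norm (A (real j * \<tau>))) \<le> heat (real j * \<tau>) (\<lambda>y. ennreal (norm (\<phi> y))) x"
        unfolding A_def
        using ennreal_norm_integral_le[of lborel "\<lambda>y. complex_of_real (heat_kernel (real j * \<tau>) (x - y)) * \<phi> y"]
        by (simp add: heat_def norm_mult ennreal_mult)
    qed simp
    finally show ?thesis .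
  qed
  have "norm (\<phi> x) \<le> norm S + norm (\<phi> x + S)"
    using norm_triangle_ineq4[of "\<phi> x + S" S] by simp
  then have "ennreal (norm (\<phi> x)) \<le> ennreal (norm S) + ennreal (norm (\<phi> x + S))"
    by (simp add: ennreal_leI flip: ennreal_plus)
  also have "\<dots> \<le> (\<Sum>j=1..m. ennreal (real (m choose j)) * heat (real j * \<tau>) (\<lambda>y. ennreal (norm (\<phi> y))) x) + ennreal (1 / c) * X"
    by (intro add_mono 2 3)
  finally show ?thesis unfolding c(2) X_def .
qed

section \<open>Assembling the trace inequality\<close>

text \<open>Jensen moves the p-th power inside the average, symmetry moves the average onto the
  weight, and concave Jensen brings it inside the power s, where B applies. This settles all times
  at which the average of v is bounded.\<close>

lemma nn_integral_heat_epowr_le: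
  fixes f v :: "'a::euclidean_space \<Rightarrow> ennreal"
  assumes [measurable]: "f \<in> borel_measurable borel" "v \<in> borel_measurable borel"
    and p: "1 < p" and s: "0 < s" "s \<le> 1" and t: "0 < t" and B: "\<And>x. heat t v x \<le> B"
  shows "(\<integral>\<^sup>+x. epowr (heat t f x) p * epowr (v x) s \<partial>lborel) \<le> epowr B s * (\<integral>\<^sup>+x. epowr (f x) p \<partial>lborel)"
proof -
  have "(\<integral>\<^sup>+x. epowr (heat t f x) p * epowr (v x) s \<partial>lborel)
      \<le> (\<integral>\<^sup>+x. heat t (\<lambda>x. epowr (f x) p) x * epowr (v x) s \<partial>lborel)"
    using p t by (intro nn_integral_mono mult_right_mono epowr_heat_le) auto
  also have "\<dots> = (\<integral>\<^sup>+x. epowr (f x) p * heat t (\<lambda>x. epowr (v x) s) x \<partial>lborel)"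
    by (rule heat_adjoint) measurable
  also have "\<dots> \<le> (\<integral>\<^sup>+x. epowr (f x) p * epowr B s \<partial>lborel)"
    using s t by (intro nn_integral_mono mult_left_mono order_trans[OF heat_epowr_le] epowr_mono B) auto
  also have "\<dots> = epowr B s * (\<integral>\<^sup>+x. epowr (f x) p \<partial>lborel)"
    by (subst nn_integral_multc) (auto simp: mult.commute)
  finally show ?thesis .
qed

text \<open>The same bound for a superposition of times above \<tau>. Of the exponent p on the mass
  of k, p - 1 comes from Jensen and 1 from integrating over the times.\<close>

lemma nn_integral_mixed_heat_epowr_le:
  fixes f v :: "'a::euclidean_space \<Rightarrow> ennreal" and k :: "real \<Rightarrow> ennreal"
  assumes [measurable]: "f \<in> borel_measurable borel" "v \<in> borel_measurable borel" "k \<in> borel_measurable borel"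
    and p: "1 < p" and s: "0 < s" "s \<le> 1" and \<tau>: "0 < \<tau>"
    and k: "\<And>i. i \<le> 1 \<Longrightarrow> k i = 0" and B: "\<And>i x. 1 < i \<Longrightarrow> heat (\<tau> * i) v x \<le> B"
  shows "(\<integral>\<^sup>+x. epowr (\<integral>\<^sup>+i. k i * heat (\<tau> * i) f x \<partial>lborel) p * epowr (v x) s \<partial>lborel)
    \<le> epowr (\<integral>\<^sup>+i. k i \<partial>lborel) p * epowr B s * (\<integral>\<^sup>+x. epowr (f x) p \<partial>lborel)"
proof -
  define K where "K = (\<integral>\<^sup>+i. k i \<partial>lborel)"
  have "(\<integral>\<^sup>+x. epowr (\<integral>\<^sup>+i. k i * heat (\<tau> * i) f x \<partial>lborel) p * epowr (v x) s \<partial>lborel)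
    \<le> (\<integral>\<^sup>+x. epowr K (p - 1) * (\<integral>\<^sup>+i. k i * epowr (heat (\<tau> * i) f x) p \<partial>lborel) * epowr (v x) s \<partial>lborel)"
    unfolding K_def using p by (intro nn_integral_mono mult_right_mono nn_integral_epowr_le) auto
  also have "\<dots> = epowr K (p - 1) * (\<integral>\<^sup>+x. (\<integral>\<^sup>+i. k i * epowr (heat (\<tau> * i) f x) p * epowr (v x) s \<partial>lborel) \<partial>lborel)"
    by (simp add: mult.assoc nn_integral_cmult flip: nn_integral_multc)
  also have "(\<integral>\<^sup>+x. (\<integral>\<^sup>+i. k i * epowr (heat (\<tau> * i) f x) p * epowr (v x) s \<partial>lborel) \<partial>lborel)
      = (\<integral>\<^sup>+i. (\<integral>\<^sup>+x. k i * epowr (heat (\<tau> * i) f x) p * epowr (v x) s \<partial>lborel) \<partial>lborel)"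
    by (rule lborel_pair.Fubini') measurable
  also have "\<dots> = (\<integral>\<^sup>+i. k i * (\<integral>\<^sup>+x. epowr (heat (\<tau> * i) f x) p * epowr (v x) s \<partial>lborel) \<partial>lborel)"
    by (simp add: mult.assoc nn_integral_cmult)
  also have "\<dots> \<le> (\<integral>\<^sup>+i. k i * (epowr B s * (\<integral>\<^sup>+x. epowr (f x) p \<partial>lborel)) \<partial>lborel)"
  proof (intro nn_integral_mono)
    fix i
    show "k i * (\<integral>\<^sup>+x. epowr (heat (\<tau> * i) f x) p * epowr (v x) s \<partial>lborel)
        \<le> k i * (epowr B s * (\<integral>\<^sup>+x. epowr (f x) p \<partial>lborel))"
    proof (cases "1 < i")
      case True
      then show ?thesis using p s \<tau> B[of i] by (intro mult_left_mono nn_integral_heat_epowr_le) auto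
    qed (simp add: k)
  qed
  also have "\<dots> = K * (epowr B s * (\<integral>\<^sup>+x. epowr (f x) p \<partial>lborel))"
    unfolding K_def by (rule nn_integral_multc) measurable
  also have "epowr K (p - 1) * (K * (epowr B s * (\<integral>\<^sup>+x. epowr (f x) p \<partial>lborel)))
      = epowr K p * epowr B s * (\<integral>\<^sup>+x. epowr (f x) p \<partial>lborel)"
    using p epowr_add[of "p - 1" 1 K] by (simp add: mult.assoc)
  finally show ?thesis by (simp add: K_def mult_left_mono)
qed

text \<open>Applied only to the averages of \<phi> itself; its constant ends up in C(\<epsilon>), so
  the induction may lose a factor 2^p at each step.\<close>

lemma nn_integral_sum_heat_epowr_le:
  fixes v :: "'a::euclidean_space \<Rightarrow> ennreal"
  assumes [measurable]: "v \<in> borel_measurable borel"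
    and p: "1 < p" and s: "0 < s" "s \<le> 1" and B: "B < \<top>" and "finite J"
    and "\<And>j. j \<in> J \<Longrightarrow> 0 < t j" "\<And>j x. j \<in> J \<Longrightarrow> heat (t j) v x \<le> B" "\<And>j. j \<in> J \<Longrightarrow> 0 \<le> c j"
  shows "\<exists>C\<ge>0. \<forall>f. f \<in> borel_measurable borel \<longrightarrow>
    (\<integral>\<^sup>+x. epowr (\<Sum>j\<in>J. ennreal (c j) * heat (t j) f x) p * epowr (v x) s \<partial>lborel)
      \<le> ennreal C * (\<integral>\<^sup>+x. epowr (f x) p \<partial>lborel)"
  using \<open>finite J\<close> assms(7-)
proof (induction J)
  case empty
  then show ?case using p by (intro exI[of _ 0]) auto
next
  case (insert j J)
  obtain C where C: "0 \<le> C" "\<And>f. f \<in> borel_measurable borel \<Longrightarrow>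
    (\<integral>\<^sup>+x. epowr (\<Sum>j\<in>J. ennreal (c j) * heat (t j) f x) p * epowr (v x) s \<partial>lborel)
      \<le> ennreal C * (\<integral>\<^sup>+x. epowr (f x) p \<partial>lborel)"
    using insert.IH insert.prems by auto
  obtain b where b: "B = ennreal b" "0 \<le> b" using B by (cases B) auto
  define D where "D = 2 powr p * ((c j) powr p * b powr s + C)"
  show ?case
  proof (intro exI[of _ D] conjI allI impI)
    show "0 \<le> D" using C by (simp add: D_def)
    fix f :: "'a \<Rightarrow> ennreal" assume f [measurable]: "f \<in> borel_measurable borel"
    let ?N = "\<integral>\<^sup>+x. epowr (f x) p \<partial>lborel"
    let ?S = "\<lambda>x. \<Sum>j\<in>J. ennreal (c j) * heat (t j) f x"
    have "(\<integral>\<^sup>+x. epowr (\<Sum>j\<in>insert j J. ennreal (c j) * heat (t j) f x) p * epowr (v x) s \<partial>lborel)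
        \<le> (\<integral>\<^sup>+x. ennreal (2 powr p) * (ennreal (c j powr p) * (epowr (heat (t j) f x) p * epowr (v x) s)
              + epowr (?S x) p * epowr (v x) s) \<partial>lborel)"
    proof (intro nn_integral_mono)
      fix x
      have "epowr (ennreal (c j) * heat (t j) f x + ?S x) p
          \<le> ennreal (2 powr p) * (epowr (ennreal (c j) * heat (t j) f x) p + epowr (?S x) p)"
        by (rule epowr_add_le[OF p])
      also have "epowr (ennreal (c j) * heat (t j) f x) p = ennreal (c j powr p) * epowr (heat (t j) f x) p"
        using p insert.prems(3)[of j] by (simp add: epowr_mult epowr_ennreal)
      finally have "epowr (ennreal (c j) * heat (t j) f x + ?S x) p
          \<le> ennreal (2 powr p) * (ennreal (c j powr p) * epowr (heat (t j) f x) p + epowr (?S x) p)" .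
      from mult_right_mono[OF this, of "epowr (v x) s"]
      show "epowr (\<Sum>j\<in>insert j J. ennreal (c j) * heat (t j) f x) p * epowr (v x) s
        \<le> ennreal (2 powr p) * (ennreal (c j powr p) * (epowr (heat (t j) f x) p * epowr (v x) s)
              + epowr (?S x) p * epowr (v x) s)"
        using insert.hyps by (simp add: distrib_left distrib_right mult_ac)
    qed
    also have "\<dots> = ennreal (2 powr p) * (ennreal (c j powr p) * (\<integral>\<^sup>+x. epowr (heat (t j) f x) p * epowr (v x) s \<partial>lborel)
        + (\<integral>\<^sup>+x. epowr (?S x) p * epowr (v x) s \<partial>lborel))"
      by (subst nn_integral_cmult, measurable, subst nn_integral_add, measurable, subst nn_integral_cmult) measurable
    also have "\<dots> \<le> ennreal (2 powr p) * (ennreal (c j powr p) * (epowr B s * ?N) + ennreal C * ?N)"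
      using p s insert.prems by (intro mult_left_mono add_mono nn_integral_heat_epowr_le C f) auto
    also have "\<dots> = ennreal D * ?N"
    proof -
      have "ennreal D = ennreal (2 powr p) * (ennreal (c j powr p) * epowr B s + ennreal C)"
        using C b s by (simp add: D_def epowr_ennreal flip: ennreal_mult ennreal_plus)
      then show ?thesis by (simp add: distrib_right mult.assoc)
    qed
    finally show "(\<integral>\<^sup>+x. epowr (\<Sum>j\<in>insert j J. ennreal (c j) * heat (t j) f x) p * epowr (v x) s \<partial>lborel)
        \<le> ennreal D * ?N" .
  qed
qed

text \<open>The interval is cut at the powers of 1/4. On each piece s^\<beta> is bounded up to
  \<open>max 1 (4 powr (- \<beta>))\<close> and the heat average up to 4^(d/2) by their values at
  the right end r = 4^(- k). The length is at most r, so the weight is r^(\<beta> + 1), that is 2^(-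
  \<alpha> k) for \<beta> = \<alpha>/2 - 1.\<close>

lemma nn_integral_powr_heat_le_suminf:
  fixes f :: "'a::euclidean_space \<Rightarrow> ennreal"
  assumes [measurable]: "f \<in> borel_measurable borel" and \<tau>: "0 < \<tau>"
  shows "(\<integral>\<^sup>+s. indicator {0<..1} s * ennreal (s powr \<beta>) * heat (\<tau> * s) f x \<partial>lborel)
    \<le> ennreal (4 powr (real DIM('a) / 2) * max 1 (4 powr (- \<beta>))) *
      (\<Sum>k. ennreal ((2 powr (2 * (\<beta> + 1))) powr (- real k)) * heat (\<tau> / 4 ^ k) f x)"
proof -
  define K where "K = max 1 (4 powr (- \<beta>) :: real)"
  have K0: "0 \<le> K" by (simp add: K_def)
  define L where "L = (4::real) powr (real DIM('a) / 2)"
  define I where "I k = {1 / 4 ^ Suc k<..1 / 4 ^ k :: real}" for k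
  have [measurable]: "I k \<in> sets borel" for k by (simp add: I_def)
  have cover: "indicator {0<..1} s \<le> (\<Sum>k. indicator (I k) s :: ennreal)" for s :: real
  proof (cases "s \<in> {0<..1}")
    case True
    have "\<exists>n. (1 / 4) ^ n < s" using True by (intro real_arch_pow_inv) auto
    then have ex: "\<exists>n. 1 / 4 ^ n < s" by (simp add: power_divide)
    define n where "n = (LEAST n. 1 / 4 ^ n < s)"
    have n: "1 / 4 ^ n < s" unfolding n_def using ex by (rule LeastI_ex)
    have "n \<noteq> 0" using n True by (auto intro: ccontr)
    then obtain k where k: "n = Suc k" by (cases n) auto
    have "\<not> 1 / 4 ^ k < s" using not_less_Least[of k "\<lambda>n. 1 / 4 ^ n < s"] k n_def by simp
    then have "s \<in> I k" using n k by (simp add: I_def)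
    then have "indicator {0<..1} s \<le> (\<Sum>k\<in>{k}. indicator (I k) s :: ennreal)" by (simp add: indicator_def)
    also have "\<dots> \<le> (\<Sum>k. indicator (I k) s)" by (rule sum_le_suminf) auto
    finally show ?thesis .
  qed simp
  have piece: "(\<integral>\<^sup>+s. indicator (I k) s * (ennreal (s powr \<beta>) * heat (\<tau> * s) f x) \<partial>lborel)
     \<le> ennreal (L * K) * (ennreal ((2 powr (2 * (\<beta> + 1))) powr (- real k)) * heat (\<tau> / 4 ^ k) f x)" for k
  proof -
    define r where "r = 1 / (4::real) ^ k"
    have r: "0 < r" by (simp add: r_def)
    have Ir: "I k = {r / 4<..r}" by (simp add: I_def r_def mult.commute)
    have "(\<integral>\<^sup>+s. indicator (I k) s * (ennreal (s powr \<beta>) * heat (\<tau> * s) f x) \<partial>lborel)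
        \<le> (\<integral>\<^sup>+s. indicator (I k) s * (ennreal (K * r powr \<beta>) * (ennreal L * heat (\<tau> * r) f x)) \<partial>lborel)"
    proof (intro nn_integral_mono)
      fix s
      have "ennreal (s powr \<beta>) * heat (\<tau> * s) f x \<le> ennreal (K * r powr \<beta>) * (ennreal L * heat (\<tau> * r) f x)"
        if s: "r / 4 < s" "s \<le> r"
      proof (intro mult_mono ennreal_leI)
        show "s powr \<beta> \<le> K * r powr \<beta>"
        proof (cases "0 \<le> \<beta>")
          case True
          then have "s powr \<beta> \<le> r powr \<beta>" using s r by (intro powr_mono2) auto
          also have "\<dots> \<le> K * r powr \<beta>" using mult_right_mono[of 1 K "r powr \<beta>"] by (simp add: K_def)
          finally show ?thesis .
        next
          case False
          then have "s powr \<beta> \<le> (r / 4) powr \<beta>" using s r by (intro powr_mono2') auto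
          also have "\<dots> = 4 powr (- \<beta>) * r powr \<beta>" using r by (simp add: powr_divide powr_minus field_simps)
          also have "\<dots> \<le> K * r powr \<beta>" by (intro mult_right_mono) (auto simp: K_def)
          finally show ?thesis .
        qed
        show "heat (\<tau> * s) f x \<le> ennreal L * heat (\<tau> * r) f x"
          unfolding L_def using s r \<tau> by (intro heat_le_heat) (auto simp: mult.left_commute)
      qed auto
      then show "indicator (I k) s * (ennreal (s powr \<beta>) * heat (\<tau> * s) f x)
          \<le> indicator (I k) s * (ennreal (K * r powr \<beta>) * (ennreal L * heat (\<tau> * r) f x))"
        by (auto simp: indicator_def Ir)
    qed
    also have "\<dots> = emeasure lborel (I k) * (ennreal (K * r powr \<beta>) * (ennreal L * heat (\<tau> * r) f x))"
      by (simp add: nn_integral_multc)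
    also have "emeasure lborel (I k) \<le> ennreal r" using r by (simp add: Ir)
    also have "ennreal r * (ennreal (K * r powr \<beta>) * (ennreal L * heat (\<tau> * r) f x))
        = ennreal (L * K * (r * r powr \<beta>)) * heat (\<tau> * r) f x"
    proof -
      have "ennreal (L * K * (r * r powr \<beta>)) = ennreal r * (ennreal (K * r powr \<beta>) * ennreal L)"
        using r K0 by (simp add: L_def mult_ac flip: ennreal_mult)
      then show ?thesis by (simp only: mult.assoc)
    qed
    also have "r * r powr \<beta> = (2 powr (2 * (\<beta> + 1))) powr (- real k)"
    proof -
      have "r = 4 powr (- real k)" by (simp add: r_def powr_minus powr_realpow field_simps)
      also have "(4::real) = 2 powr 2" by simp
      finally have "r = 2 powr (- 2 * real k)" by (simp only: powr_powr) (simp add: mult.commute)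
      moreover have "r * r powr \<beta> = r powr (\<beta> + 1)" using r by (simp add: powr_add)
      ultimately show ?thesis by (simp add: powr_powr algebra_simps)
    qed
    finally show ?thesis
      by (simp add: r_def K_def L_def ennreal_mult mult.assoc mult_right_mono)
  qed
  have "(\<integral>\<^sup>+s. indicator {0<..1} s * ennreal (s powr \<beta>) * heat (\<tau> * s) f x \<partial>lborel)
      \<le> (\<integral>\<^sup>+s. (\<Sum>k. indicator (I k) s * (ennreal (s powr \<beta>) * heat (\<tau> * s) f x)) \<partial>lborel)"
    unfolding ennreal_suminf_multc mult.assoc by (intro nn_integral_mono mult_right_mono cover) simp
  also have "\<dots> = (\<Sum>k. \<integral>\<^sup>+s. indicator (I k) s * (ennreal (s powr \<beta>) * heat (\<tau> * s) f x) \<partial>lborel)"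
    by (rule nn_integral_suminf) measurable
  also have "\<dots> \<le> (\<Sum>k. ennreal (L * K) * (ennreal ((2 powr (2 * (\<beta> + 1))) powr (- real k)) * heat (\<tau> / 4 ^ k) f x))"
    by (intro suminf_le piece) auto
  finally show ?thesis by (simp only: ennreal_suminf_cmult L_def K_def)
qed

text \<open>The constant c is chosen before the weight, M and \<delta>, and M enters the main term
  only as M^p; C may depend on all of them.\<close>

lemma trace_inequality_small_cubes:
  fixes \<alpha> p a :: real
  assumes \<alpha>: "0 < \<alpha>" and p: "1 < p" "p < a"
  shows "\<exists>c>0. \<forall>(v::real^'d \<Rightarrow> ennreal) M \<delta>. v \<in> borel_measurable borel \<longrightarrow> 0 < M \<longrightarrow> 0 < \<delta> \<longrightarrow>
    (\<forall>c l. 0 < l \<longrightarrow> l \<le> \<delta> \<longrightarrow> (\<integral>\<^sup>+y. indicator (cube c l) y * v y \<partial>lborel)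
      \<le> ennreal ((M * l powr (- \<alpha>)) powr a) * ennreal (l ^ CARD('d))) \<longrightarrow>
    (\<exists>C\<ge>0. \<forall>\<phi>. test_function \<phi> \<longrightarrow>
      (\<integral>\<^sup>+x. epowr (ennreal (norm (\<phi> x))) p * epowr (v x) (p / a) \<partial>lborel)
      \<le> ennreal (c * M powr p) * (\<integral>\<^sup>+x. epowr (ennreal (norm (frac_laplacian \<alpha> \<phi> x))) p \<partial>lborel)
        + ennreal C * (\<integral>\<^sup>+x. epowr (ennreal (norm (\<phi> x))) p \<partial>lborel))"
proof -
  define \<beta> where "\<beta> = \<alpha> / 2 - 1"
  define m where "m = nat \<lceil>\<alpha> / 2 + 1\<rceil>"
  have m: "\<alpha> / 2 + 1 \<le> real m" unfolding m_def by linarith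
  define Y where "Y = 2 powr \<alpha>"
  have Y: "1 < Y" using \<alpha> by (simp add: Y_def)
  obtain Ct where Ct: "0 < Ct" and trace: "\<And>(u::real^'d \<Rightarrow> ennreal) f \<tau>. u \<in> borel_measurable borel \<Longrightarrow>
    f \<in> borel_measurable borel \<Longrightarrow> 0 < \<tau> \<Longrightarrow>
    (\<forall>k x. heat (\<tau> / 4 ^ k) u x \<le> ennreal (Y powr (a * real k))) \<Longrightarrow>
    (\<integral>\<^sup>+x. epowr (\<Sum>k. ennreal (Y powr (- real k)) * heat (\<tau> / 4 ^ k) f x) p * epowr (u x) (p / a) \<partial>lborel)
      \<le> ennreal Ct * (\<integral>\<^sup>+x. epowr (f x) p \<partial>lborel)"
    using dyadic_heat_trace[OF p Y, where 'a = "real^'d"] by blast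
  define K1 where "K1 = 2 powr (real CARD('d) / 2) * exp (real CARD('d) / 4)"
  have K1: "0 < K1" by (simp add: K1_def)
  define K2 where "K2 = 4 powr (real DIM(real^'d) / 2) * max 1 (4 powr (- \<beta>))"
  have K2: "0 < K2" by (simp add: K2_def)
  define G where "G = 1 / Gamma (\<alpha> / 2)"
  have G: "0 < G" using \<alpha> by (simp add: G_def Gamma_real_pos)
  define k where "k s = indicator {1<..} s * ennreal \<bar>fdiff m \<beta> s\<bar>" for s :: real
  have [measurable]: "k \<in> borel_measurable borel" unfolding k_def by measurable
  have "(\<integral>\<^sup>+s. k s \<partial>lborel) \<le> (\<integral>\<^sup>+s. ennreal (norm (fdiff m \<beta> s)) \<partial>lborel)"
    by (intro nn_integral_mono) (auto simp: k_def indicator_def)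
  also have "\<dots> < \<infinity>"
    using integrable_fdiff[of \<beta> m] \<alpha> m unfolding integrable_iff_bounded by (simp add: \<beta>_def)
  finally obtain \<kappa> where \<kappa>: "(\<integral>\<^sup>+s. k s \<partial>lborel) = ennreal \<kappa>" "0 \<le> \<kappa>"
    by (cases "\<integral>\<^sup>+s. k s \<partial>lborel") auto
  \<comment> \<open>One factor 2^p separates the averages of \<phi> from the potential, the other
    the times below \<tau> from those above. The product of the powers of G and K1 is what
    \<open>ZB\<close> leaves of Z^p B^(p/a) once M^p is taken out.\<close>
  define c where "c = 2 powr p * (2 powr p * (G powr p * K1 powr (p / a) * (K2 powr p * Ct + \<kappa> powr p)))"
  have c: "0 < c" using G K1 K2 Ct by (simp add: c_def add_pos_nonneg)
  have "\<exists>C\<ge>0. \<forall>\<phi>. test_function \<phi> \<longrightarrow>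
      (\<integral>\<^sup>+x. epowr (ennreal (norm (\<phi> x))) p * epowr (v x) (p / a) \<partial>lborel)
      \<le> ennreal (c * M powr p) * (\<integral>\<^sup>+x. epowr (ennreal (norm (frac_laplacian \<alpha> \<phi> x))) p \<partial>lborel)
        + ennreal C * (\<integral>\<^sup>+x. epowr (ennreal (norm (\<phi> x))) p \<partial>lborel)"
    if [measurable]: "v \<in> borel_measurable borel" and M: "0 < M" and \<delta>: "0 < \<delta>"
      and cubes: "\<And>c l. 0 < l \<Longrightarrow> l \<le> \<delta> \<Longrightarrow> (\<integral>\<^sup>+y. indicator (cube c l) y * v y \<partial>lborel)
        \<le> ennreal ((M * l powr (- \<alpha>)) powr a) * ennreal (l ^ CARD('d))"
    for v :: "real^'d \<Rightarrow> ennreal" and M \<delta>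
  proof -
    \<comment> \<open>Heat times up to \<tau> then correspond to cubes of side up to
      \<delta>.\<close>
    define \<tau> where "\<tau> = \<delta>\<^sup>2"
    have \<tau>: "0 < \<tau>" using \<delta> by (simp add: \<tau>_def)
    \<comment> \<open>Bounds the heat average of v at time \<tau>, and hence at every later time,
      since further averaging cannot raise it.\<close>
    define B where "B = K1 * (M * \<tau> powr (- \<alpha> / 2)) powr a"
    have B: "0 < B" using K1 M \<tau> by (simp add: B_def)
    have small: "heat t v x \<le> ennreal (K1 * (M * t powr (- \<alpha> / 2)) powr a)" if "0 < t" "t \<le> \<tau>" for t x
      unfolding K1_def using that \<delta> M cubes by (intro heat_le_Morrey[where \<delta> = \<delta>]) (auto simp: \<tau>_def)
    have large: "heat t v x \<le> ennreal B" if "\<tau> \<le> t" for t x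
    proof (cases "t = \<tau>")
      case True
      then show ?thesis using small[of \<tau> x] \<tau> by (simp add: B_def)
    next
      case False
      then have "heat t v x = heat (t - \<tau>) (heat \<tau> v) x" using that \<tau> by (simp add: heat_heat)
      also have "\<dots> \<le> ennreal B" using small[of \<tau>] \<tau> that False by (intro heat_le[of "heat \<tau> v"]) (auto simp: B_def)
      finally show ?thesis .
    qed
    \<comment> \<open>Normalised to have bound 1 at time \<tau>. Dividing the time by 4^k multiplies
      the bound by 4^(k a \<alpha>/2) = Y^(a k), as the dyadic inequality requires.\<close>
    define u where "u x = ennreal (1 / B) * v x" for x
    have [measurable]: "u \<in> borel_measurable borel" unfolding u_def by measurable
    have v_u: "v x = ennreal B * u x" for x
      using B by (simp add: u_def mult.assoc[symmetric] flip: ennreal_mult)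
    have u: "heat (\<tau> / 4 ^ k) u x \<le> ennreal (Y powr (a * real k))" for k x
    proof -
      have "\<tau> / 4 ^ k \<le> \<tau>" "0 < \<tau> / 4 ^ k" using \<tau> by (simp_all add: divide_le_eq)
      note sm = small[OF this(2,1), of x]
      have "heat (\<tau> / 4 ^ k) u x \<le> ennreal (1 / B) * ennreal (K1 * (M * (\<tau> / 4 ^ k) powr (- \<alpha> / 2)) powr a)"
        unfolding u_def[abs_def] heat_cmult[OF \<open>v \<in> borel_measurable borel\<close>]
        by (rule mult_left_mono[OF sm]) simp
      also have "(\<tau> / 4 ^ k) powr (- \<alpha> / 2) = \<tau> powr (- \<alpha> / 2) * Y powr real k"
      proof -
        have "(4::real) ^ k = 2 powr (2 * real k)"
          by (simp add: powr_realpow[symmetric] powr_powr[symmetric])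
        then have "((4::real) ^ k) powr (- \<alpha> / 2) = 2 powr (- (\<alpha> * real k))"
          by (simp only: powr_powr) (simp add: mult.commute)
        then have A: "((4::real) ^ k) powr (- \<alpha> / 2) = inverse (Y powr real k)"
          by (simp only: Y_def powr_powr powr_minus)
        have "(\<tau> / 4 ^ k) powr (- \<alpha> / 2) = \<tau> powr (- \<alpha> / 2) / ((4::real) ^ k) powr (- \<alpha> / 2)"
          by (rule powr_divide)
        also have "\<dots> = \<tau> powr (- \<alpha> / 2) * Y powr real k"
          unfolding A by (simp only: divide_inverse inverse_inverse_eq)
        finally show ?thesis .
      qed
      also have "K1 * (M * (\<tau> powr (- \<alpha> / 2) * Y powr real k)) powr a = B * Y powr (a * real k)"
        using M \<tau> Y by (simp add: B_def powr_mult powr_powr mult_ac)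
      also have "ennreal (1 / B) * ennreal (B * Y powr (a * real k)) = ennreal (Y powr (a * real k))"
        using B by (simp flip: ennreal_mult)
      finally show ?thesis .
    qed
    have pa: "0 < p / a" "p / a \<le> 1" using p by auto
    obtain CL where CL: "0 \<le> CL" "\<And>f. f \<in> borel_measurable borel \<Longrightarrow>
      (\<integral>\<^sup>+x. epowr (\<Sum>j=1..m. ennreal (real (m choose j)) * heat (real j * \<tau>) f x) p * epowr (v x) (p / a) \<partial>lborel)
        \<le> ennreal CL * (\<integral>\<^sup>+x. epowr (f x) p \<partial>lborel)"
    proof -
      have "\<tau> \<le> real j * \<tau>" if "j \<in> {1..m}" for j
        using that \<tau> mult_right_mono[of 1 "real j" \<tau>] by auto
      then show thesis
        using nn_integral_sum_heat_epowr_le[of v p "p / a" "ennreal B" "{1..m}" "\<lambda>j. real j * \<tau>" "\<lambda>j. real (m choose j)"]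
          p(1) pa \<tau> large that by auto
    qed
    define Z where "Z = G * \<tau> powr (\<alpha> / 2)"
    have Z: "0 < Z" using G \<tau> by (simp add: Z_def)
    \<comment> \<open>The scale-invariance at work: \<tau>^(\<alpha> p/2) from the subordination
      formula cancels the power of \<tau> in B^(p/a).\<close>
    have ZB: "Z powr p * B powr (p / a) = G powr p * K1 powr (p / a) * M powr p"
    proof -
      have "B powr (p / a) = K1 powr (p / a) * (M powr p * \<tau> powr (- (\<alpha> * p / 2)))"
        using K1 M \<tau> p by (simp add: B_def powr_mult powr_powr)
      moreover have "Z powr p = G powr p * \<tau> powr (\<alpha> * p / 2)"
        using G \<tau> by (simp add: Z_def powr_mult powr_powr)
      moreover have "\<tau> powr (\<alpha> * p / 2) * \<tau> powr (- (\<alpha> * p / 2)) = 1"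
        using \<tau> by (simp flip: powr_add)
      ultimately show ?thesis by algebra
    qed
    show ?thesis
    proof (intro exI[of _ "2 powr p * CL"] conjI allI impI)
      show "0 \<le> 2 powr p * CL" using CL by simp
      fix \<phi> :: "real^'d \<Rightarrow> complex" assume \<phi>: "test_function \<phi>"
      define f where "f x = ennreal (norm (\<phi> x))" for x
      define g where "g x = ennreal (norm (frac_laplacian \<alpha> \<phi> x))" for x
      have [measurable]: "\<phi> \<in> borel_measurable borel"
        using test_functionD(1)[OF \<phi>] by (rule borel_measurable_continuous_onI)
      have [measurable]: "frac_laplacian \<alpha> \<phi> \<in> borel_measurable borel"
        by (rule measurable_frac_laplacian[OF \<phi> \<alpha>])
      have [measurable]: "f \<in> borel_measurable borel" "g \<in> borel_measurable borel"
        unfolding f_def g_def by measurable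
      define N where "N h = (\<integral>\<^sup>+x. epowr (h x) p \<partial>lborel)" for h :: "real^'d \<Rightarrow> ennreal"
      define w where "w x = epowr (v x) (p / a)" for x
      have [measurable]: "w \<in> borel_measurable borel" unfolding w_def by measurable
      define L where "L x = (\<Sum>j=1..m. ennreal (real (m choose j)) * heat (real j * \<tau>) f x)" for x
      define S where "S x = (\<Sum>j. ennreal (Y powr (- real j)) * heat (\<tau> / 4 ^ j) g x)" for x
      define T where "T x = (\<integral>\<^sup>+s. k s * heat (\<tau> * s) g x \<partial>lborel)" for x
      have [measurable]: "L \<in> borel_measurable borel" "S \<in> borel_measurable borel" "T \<in> borel_measurable borel"
        unfolding L_def S_def T_def by measurable
      have f_le: "f x \<le> L x + ennreal Z * (ennreal K2 * S x + T x)" for x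
      proof -
        \<comment> \<open>Split at s = 1: below it the density is a pure power and is discretised
          into S; above it only the integrable tail k remains.\<close>
        have "(\<integral>\<^sup>+s. indicator {0<..} s * ennreal \<bar>fdiff m \<beta> s\<bar> * heat (\<tau> * s) g x \<partial>lborel)
            = (\<integral>\<^sup>+s. indicator {0<..1} s * ennreal (s powr \<beta>) * heat (\<tau> * s) g x + k s * heat (\<tau> * s) g x \<partial>lborel)"
          by (intro nn_integral_cong) (auto simp: indicator_def k_def fdiff_eq_powr)
        also have "\<dots> = (\<integral>\<^sup>+s. indicator {0<..1} s * ennreal (s powr \<beta>) * heat (\<tau> * s) g x \<partial>lborel) + T x"
          unfolding T_def by (rule nn_integral_add) measurable
        also have "\<dots> \<le> ennreal K2 * S x + T x"
        proof -
          have "2 powr (2 * (\<beta> + 1)) = Y" by (simp add: \<beta>_def Y_def)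
          then show ?thesis
            using nn_integral_powr_heat_le_suminf[of g \<tau> \<beta> x] \<tau> by (simp add: K2_def S_def add_right_mono)
        qed
        finally have "ennreal (\<tau> powr (\<alpha> / 2) / Gamma (\<alpha> / 2)) *
            (\<integral>\<^sup>+s. indicator {0<..} s * ennreal \<bar>fdiff m \<beta> s\<bar> * heat (\<tau> * s) g x \<partial>lborel)
            \<le> ennreal Z * (ennreal K2 * S x + T x)"
          by (intro mult_mono) (auto simp: Z_def G_def)
        then show ?thesis
          using test_function_heat_bound[OF \<phi> \<alpha> \<tau> m, of x]
          unfolding f_def[symmetric] g_def[symmetric] f_def[abs_def, symmetric] g_def[abs_def, symmetric] \<beta>_def[symmetric] L_def
          by (meson add_left_mono order_trans)
      qed
      have f_p: "epowr (f x) p * w x \<le> ennreal (2 powr p) * (epowr (L x) p * w x)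
          + ennreal (2 powr p * (2 powr p * Z powr p * K2 powr p)) * (epowr (S x) p * w x)
          + ennreal (2 powr p * (2 powr p * Z powr p)) * (epowr (T x) p * w x)" for x
      proof -
        have "epowr (f x) p \<le> epowr (L x + ennreal Z * (ennreal K2 * S x + T x)) p"
          using p by (intro epowr_mono f_le) auto
        also have "\<dots> \<le> ennreal (2 powr p) * (epowr (L x) p + epowr (ennreal Z * (ennreal K2 * S x + T x)) p)"
          by (rule epowr_add_le[OF p(1)])
        also have "epowr (ennreal Z * (ennreal K2 * S x + T x)) p = ennreal (Z powr p) * epowr (ennreal K2 * S x + T x) p"
          using p Z by (simp add: epowr_mult epowr_ennreal)
        also have "epowr (ennreal K2 * S x + T x) p \<le> ennreal (2 powr p) * (epowr (ennreal K2 * S x) p + epowr (T x) p)"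
          by (rule epowr_add_le[OF p(1)])
        also have "epowr (ennreal K2 * S x) p = ennreal (K2 powr p) * epowr (S x) p"
          using p K2 by (simp add: epowr_mult epowr_ennreal)
        finally have "epowr (f x) p \<le> ennreal (2 powr p) * (epowr (L x) p + ennreal (Z powr p) *
            (ennreal (2 powr p) * (ennreal (K2 powr p) * epowr (S x) p + epowr (T x) p)))"
          by (simp add: mult_left_mono add_left_mono)
        from mult_right_mono[OF this, of "w x"] show ?thesis
          by (simp add: ennreal_mult distrib_left distrib_right mult_ac add_ac)
      qed
      have LN: "(\<integral>\<^sup>+x. epowr (L x) p * w x \<partial>lborel) \<le> ennreal CL * N f"
        unfolding L_def w_def N_def by (rule CL) measurable
      have SN: "(\<integral>\<^sup>+x. epowr (S x) p * w x \<partial>lborel) \<le> ennreal (B powr (p / a) * Ct) * N g"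
      proof -
        have "(\<integral>\<^sup>+x. epowr (S x) p * w x \<partial>lborel)
            = (\<integral>\<^sup>+x. ennreal (B powr (p / a)) * (epowr (S x) p * epowr (u x) (p / a)) \<partial>lborel)"
          unfolding w_def v_u using pa B by (simp add: epowr_mult epowr_ennreal mult_ac)
        also have "\<dots> = ennreal (B powr (p / a)) * (\<integral>\<^sup>+x. epowr (S x) p * epowr (u x) (p / a) \<partial>lborel)"
          by (rule nn_integral_cmult) measurable
        also have "\<dots> \<le> ennreal (B powr (p / a)) * (ennreal Ct * N g)"
          unfolding S_def N_def using u \<tau> by (intro mult_left_mono trace) auto
        finally show ?thesis using Ct by (simp add: ennreal_mult mult.assoc)
      qed
      have TN: "(\<integral>\<^sup>+x. epowr (T x) p * w x \<partial>lborel) \<le> ennreal (B powr (p / a) * \<kappa> powr p) * N g"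
      proof -
        have "\<tau> \<le> \<tau> * i" if "1 < i" for i using \<tau> that mult_left_mono[of 1 i \<tau>] by simp
        then have "(\<integral>\<^sup>+x. epowr (T x) p * w x \<partial>lborel)
            \<le> epowr (\<integral>\<^sup>+s. k s \<partial>lborel) p * epowr (ennreal B) (p / a) * N g"
          unfolding T_def w_def N_def using p(1) pa \<tau>
          by (intro nn_integral_mixed_heat_epowr_le large) (auto simp: k_def)
        then show ?thesis using \<kappa> B p pa by (simp add: epowr_ennreal ennreal_mult mult.commute)
      qed
      have "(\<integral>\<^sup>+x. epowr (f x) p * w x \<partial>lborel) \<le> (\<integral>\<^sup>+x. ennreal (2 powr p) * (epowr (L x) p * w x)
          + ennreal (2 powr p * (2 powr p * Z powr p * K2 powr p)) * (epowr (S x) p * w x)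
          + ennreal (2 powr p * (2 powr p * Z powr p)) * (epowr (T x) p * w x) \<partial>lborel)"
        by (intro nn_integral_mono f_p)
      also have "\<dots> = ennreal (2 powr p) * (\<integral>\<^sup>+x. epowr (L x) p * w x \<partial>lborel)
          + ennreal (2 powr p * (2 powr p * Z powr p * K2 powr p)) * (\<integral>\<^sup>+x. epowr (S x) p * w x \<partial>lborel)
          + ennreal (2 powr p * (2 powr p * Z powr p)) * (\<integral>\<^sup>+x. epowr (T x) p * w x \<partial>lborel)"
        by (simp add: nn_integral_add nn_integral_cmult)
      also have "\<dots> \<le> ennreal (2 powr p) * (ennreal CL * N f)
          + ennreal (2 powr p * (2 powr p * Z powr p * K2 powr p)) * (ennreal (B powr (p / a) * Ct) * N g)
          + ennreal (2 powr p * (2 powr p * Z powr p)) * (ennreal (B powr (p / a) * \<kappa> powr p) * N g)"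
        by (intro add_mono mult_left_mono LN SN TN) auto
      also have "\<dots> = ennreal (c * M powr p) * N g + ennreal (2 powr p * CL) * N f"
      proof -
        have "c * M powr p = 2 powr p * (2 powr p * Z powr p * K2 powr p) * (B powr (p / a) * Ct)
            + 2 powr p * (2 powr p * Z powr p) * (B powr (p / a) * \<kappa> powr p)"
          unfolding c_def using ZB by algebra
        then have "ennreal (c * M powr p) = ennreal (2 powr p * (2 powr p * Z powr p * K2 powr p)) * ennreal (B powr (p / a) * Ct)
            + ennreal (2 powr p * (2 powr p * Z powr p)) * ennreal (B powr (p / a) * \<kappa> powr p)"
          using Ct by (simp flip: ennreal_mult ennreal_plus)
        moreover have "ennreal (2 powr p * CL) = ennreal (2 powr p) * ennreal CL"
          using CL by (simp add: ennreal_mult)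
        ultimately show ?thesis by (simp only: distrib_right mult.assoc add_ac)
      qed
      finally show "(\<integral>\<^sup>+x. epowr (ennreal (norm (\<phi> x))) p * epowr (v x) (p / a) \<partial>lborel)
        \<le> ennreal (c * M powr p) * (\<integral>\<^sup>+x. epowr (ennreal (norm (frac_laplacian \<alpha> \<phi> x))) p \<partial>lborel)
          + ennreal (2 powr p * CL) * (\<integral>\<^sup>+x. epowr (ennreal (norm (\<phi> x))) p \<partial>lborel)"
        by (simp only: f_def g_def w_def N_def)
    qed
  qed
  then show ?thesis using c by blast
qed

section \<open>Weights and suprema over small cubes\<close>

lemma measurable_weight:
  assumes "weight v" shows "v \<in> borel_measurable lebesgue"
proof (rule borel_measurable_LIMSEQ_real)
  \<comment> \<open>A weight is only given as integrable on compact sets, so measurability is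
    assembled from balls.\<close>
  show "(\<lambda>x. indicator (cball 0 (real n)) x *\<^sub>R v x) \<in> borel_measurable lebesgue" for n
    using assms unfolding weight_def set_integrable_def by (intro borel_measurable_integrable) simp
  show "(\<lambda>n. indicator (cball 0 (real n)) x *\<^sub>R v x) \<longlonglongrightarrow> v x" for x
  proof (rule tendsto_eventually)
    show "\<forall>\<^sub>F n in sequentially. indicator (cball 0 (real n)) x *\<^sub>R v x = v x"
      using eventually_ge_at_top[of "nat \<lceil>norm x\<rceil>"]
    proof eventually_elim
      case (elim n)
      then have "norm x \<le> real n" by linarith
      then show ?case by simp
    qed
  qed
qed

lemma small_cube_sup_mono_exponent:
  fixes v :: "real^'d \<Rightarrow> real"
  assumes v: "weight v" and \<theta>: "1 < \<theta>" and a: "0 < a"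
  shows "small_cube_sup \<alpha> (1 / a) v \<delta> \<le> small_cube_sup \<alpha> (1 / (\<theta> * a)) (\<lambda>x. v x powr \<theta>) \<delta>"
  unfolding small_cube_sup_def
proof (rule SUP_mono', rule SUP_mono)
  fix c :: "real^'d" and l assume l: "l \<in> {0<..\<delta>}"
  have [measurable]: "v \<in> borel_measurable lebesgue" using v by (rule measurable_weight)
  have v0: "0 \<le> v x" for x using v by (simp add: weight_def)
  define Q where "Q = cube c l"
  have Q [measurable]: "Q \<in> sets lebesgue" by (simp add: Q_def cube_def)
  have E: "emeasure lebesgue Q = ennreal (l ^ CARD('d))" "0 < l ^ CARD('d)"
    using emeasure_cube[of l c] l by (auto simp: Q_def cube_def)
  \<comment> \<open>The average over Q as integration against a density of mass 1, so that Jensen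
    holds with constant 1.\<close>
  define k where "k x = (indicator Q x / emeasure lebesgue Q :: ennreal)" for x
  have [measurable]: "k \<in> borel_measurable lebesgue" unfolding k_def by measurable
  have avg: "average Q g = (\<integral>\<^sup>+x. k x * g x \<partial>lebesgue)" if [measurable]: "g \<in> borel_measurable lebesgue" for g
    unfolding average_def k_def
    by (subst nn_integral_divide[symmetric]) (auto simp: divide_ennreal_def mult_ac)
  have k1: "(\<integral>\<^sup>+x. k x \<partial>lebesgue) = 1"
  proof -
    have "(\<integral>\<^sup>+x. k x \<partial>lebesgue) = emeasure lebesgue Q / emeasure lebesgue Q"
      unfolding k_def by (subst nn_integral_divide) auto
    also have "\<dots> = 1" unfolding E(1) using l by (intro ennreal_divide_self) auto
    finally show ?thesis .
  qed
  have "epowr (average Q (\<lambda>x. ennreal (v x))) \<theta> \<le> average Q (\<lambda>x. ennreal (v x powr \<theta>))"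
    using nn_integral_epowr_le[of "\<lambda>x. ennreal (v x)" lebesgue k \<theta>] \<theta> v0
    by (simp add: avg k1 epowr_ennreal)
  then have "epowr (epowr (average Q (\<lambda>x. ennreal (v x))) \<theta>) (1 / (\<theta> * a)) \<le> epowr (average Q (\<lambda>x. ennreal (v x powr \<theta>))) (1 / (\<theta> * a))"
    using \<theta> a by (intro epowr_mono) auto
  also have "epowr (epowr (average Q (\<lambda>x. ennreal (v x))) \<theta>) (1 / (\<theta> * a)) = epowr (average Q (\<lambda>x. ennreal (v x))) (1 / a)"
    using \<theta> a by (subst epowr_epowr) auto
  finally have "ennreal (l powr \<alpha>) * epowr (average Q (\<lambda>x. ennreal (v x))) (1 / a)
      \<le> ennreal (l powr \<alpha>) * epowr (average Q (\<lambda>x. ennreal (v x powr \<theta>))) (1 / (\<theta> * a))"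
    by (rule mult_left_mono) simp
  then show "\<exists>l'\<in>{0<..\<delta>}. ennreal (l powr \<alpha>) * epowr (average (cube c l) (\<lambda>x. ennreal (v x))) (1 / a)
      \<le> ennreal (l' powr \<alpha>) * epowr (average (cube c l') (\<lambda>x. ennreal (v x powr \<theta>))) (1 / (\<theta> * a))"
    using l by (auto simp: Q_def)
qed

text \<open>Solves the bound on the supremum for v(Q), undoing the power 1 / a, to reach the form
  expected by \<open>trace_inequality_small_cubes\<close>.\<close>

lemma small_cube_sup_imp_nn_integral_le:
  fixes v :: "real^'d \<Rightarrow> real"
  assumes sup: "small_cube_sup \<alpha> (1 / a) v \<delta> \<le> ennreal M" and a: "0 < a" and M: "0 \<le> M"
    and l: "0 < l" "l \<le> \<delta>"
  shows "(\<integral>\<^sup>+x\<in>cube c l. ennreal (v x) \<partial>lebesgue) \<le> ennreal ((M * l powr (- \<alpha>)) powr a) * ennreal (l ^ CARD('d))"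
proof -
  define A where "A = average (cube c l) (\<lambda>x. ennreal (v x))"
  have "l \<in> {0<..\<delta>}" using l by simp
  then have "ennreal (l powr \<alpha>) * epowr A (1 / a) \<le> small_cube_sup \<alpha> (1 / a) v \<delta>"
    unfolding A_def small_cube_sup_def by (intro SUP_upper2[OF UNIV_I[of c]] SUP_upper2[of l] order_refl)
  from order_trans[OF this sup] have "ennreal (l powr (- \<alpha>)) * (ennreal (l powr \<alpha>) * epowr A (1 / a)) \<le> ennreal (l powr (- \<alpha>)) * ennreal M"
    by (rule mult_left_mono) simp
  also have "ennreal (l powr (- \<alpha>)) * (ennreal (l powr \<alpha>) * epowr A (1 / a)) = epowr A (1 / a)"
  proof -
    have "ennreal (l powr (- \<alpha>)) * ennreal (l powr \<alpha>) = 1"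
      using l by (simp flip: ennreal_mult powr_add)
    then show ?thesis by (simp only: mult.assoc[symmetric] mult_1)
  qed
  also have "ennreal (l powr (- \<alpha>)) * ennreal M = ennreal (M * l powr (- \<alpha>))"
    using M by (simp only: ennreal_mult powr_ge_zero mult.commute)
  finally have "epowr (epowr A (1 / a)) a \<le> epowr (ennreal (M * l powr (- \<alpha>))) a"
    using a by (rule epowr_mono)
  then have A: "A \<le> ennreal ((M * l powr (- \<alpha>)) powr a)"
    using a M by (simp add: epowr_epowr epowr_ennreal)
  have E: "emeasure lebesgue (cube c l) = ennreal (l ^ CARD('d))"
    using emeasure_cube[of l c] l by (simp add: cube_def)
  have "(\<integral>\<^sup>+x\<in>cube c l. ennreal (v x) \<partial>lebesgue) = A * ennreal (l ^ CARD('d))"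
    unfolding A_def average_def E using l by (subst ennreal_divide_times) (simp add: mult_divide_eq_ennreal)
  also have "\<dots> \<le> ennreal ((M * l powr (- \<alpha>)) powr a) * ennreal (l ^ CARD('d))"
    by (intro mult_right_mono A) simp
  finally show ?thesis .
qed

theorem theorem1p5:
  fixes v :: "real^'d \<Rightarrow> real"
    and \<alpha> p q r \<theta>1 \<theta>2 :: real
  assumes "0 < \<alpha>" and "\<alpha> < real CARD('d)"
    and "1 < q" and "q < p"
    and "weight v"
    and "1 / r = 1 / q - 1 / p"
    and "1 < \<theta>1" and "1 < \<theta>2"
    and "1 / q = 1 / (\<theta>2 * p) + \<theta>1 / r"
    and "epowr (Lnorm \<theta>1 v) (\<theta>1 / r) < \<infinity>"
    and "(A_infinity v \<and>
          small_cube_sup \<alpha> (1 / (\<theta>2 * p)) v 1 < \<infinity> \<and>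
          ((\<lambda>t. small_cube_sup \<alpha> (1 / (\<theta>2 * p)) v (1 / t)) \<longlongrightarrow> 0) at_top)
       \<or> (\<exists>\<theta>. 1 < \<theta> \<and> \<theta> < \<theta>1 \<and>
          small_cube_sup \<alpha> (1 / (\<theta> * \<theta>2 * p)) (\<lambda>x. v x powr \<theta>) 1 < \<infinity> \<and>
          ((\<lambda>t. small_cube_sup \<alpha> (1 / (\<theta> * \<theta>2 * p)) (\<lambda>x. v x powr \<theta>) (1 / t)) \<longlongrightarrow> 0) at_top)"
  shows "\<exists>c::real. 0 \<le> c \<and>
    (\<forall>\<epsilon>::real. 0 < \<epsilon> \<longrightarrow> (\<exists>C::real. 0 < C \<and>
      (\<forall>\<phi> :: real^'d \<Rightarrow> complex. test_function \<phi> \<longrightarrow>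
        weighted_Lnorm q v \<phi> \<le>
          ennreal c * (ennreal \<epsilon> * Lnorm p (frac_laplacian \<alpha> \<phi>) + ennreal C * Lnorm p \<phi>))))"
proof -
  define a where "a = \<theta>2 * p"
  have p: "1 < p" "p < a" "0 < q" using assms(3,4,8) by (auto simp: a_def)
  have r1: "0 < 1 / r" unfolding assms(6) using assms(3,4) by (simp add: field_simps)
  then have r: "0 < r" by simp
  have v0: "0 \<le> v x" for x using assms(5) by (simp add: weight_def)
  have [measurable]: "v \<in> borel_measurable lebesgue" using assms(5) by (rule measurable_weight)

  have lim: "((\<lambda>t. small_cube_sup \<alpha> (1 / a) v (1 / t)) \<longlongrightarrow> 0) at_top"
    using assms(11)
  proof (elim disjE exE conjE)
    fix \<theta> assume \<theta>: "1 < \<theta>" and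
      lim: "((\<lambda>t. small_cube_sup \<alpha> (1 / (\<theta> * \<theta>2 * p)) (\<lambda>x. v x powr \<theta>) (1 / t)) \<longlongrightarrow> 0) at_top"
    show ?thesis
    proof (rule tendsto_sandwich[OF _ _ tendsto_const lim])
      show "\<forall>\<^sub>F t in at_top. small_cube_sup \<alpha> (1 / a) v (1 / t)
          \<le> small_cube_sup \<alpha> (1 / (\<theta> * \<theta>2 * p)) (\<lambda>x. v x powr \<theta>) (1 / t)"
        using small_cube_sup_mono_exponent[OF assms(5) \<theta>, of a] p
        by (intro always_eventually allI) (simp add: a_def mult.assoc)
    qed simp
  qed (simp add: a_def)
  have small: "\<exists>\<delta>>0. small_cube_sup \<alpha> (1 / a) v \<delta> \<le> ennreal M" if "0 < M" for M
  proof -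
    have "\<forall>\<^sub>F t in at_top. small_cube_sup \<alpha> (1 / a) v (1 / t) < ennreal M"
      using that by (intro order_tendstoD(2)[OF lim]) simp
    moreover have "\<forall>\<^sub>F t in at_top. (0::real) < t" by (rule eventually_gt_at_top)
    ultimately have "\<forall>\<^sub>F t in at_top. 0 < t \<and> small_cube_sup \<alpha> (1 / a) v (1 / t) < ennreal M"
      by eventually_elim simp
    then obtain t where "0 < t" "small_cube_sup \<alpha> (1 / a) v (1 / t) < ennreal M"
      unfolding eventually_at_top_linorder by blast
    then show ?thesis by (intro exI[of _ "1 / t"]) auto
  qed

  \<comment> \<open>A Borel function almost everywhere equal to the weight: v is only Lebesgue
    measurable, while the heat operators act on Borel functions.\<close>
  obtain u where u [measurable]: "u \<in> borel_measurable lborel" and AE_u: "AE x in lborel. ennreal (v x) = u x"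
    using completion_ex_borel_measurable[of "\<lambda>x. ennreal (v x)" lborel] by auto
  have u' [measurable]: "u \<in> borel_measurable borel" using u by simp

  \<comment> \<open>The assumed norm is W^(1 / \<theta>1), so its power \<theta>1 / r is W^(1 / r),
    the factor that Hoelder's inequality produces.\<close>
  define W where "W = (\<integral>\<^sup>+x. epowr (u x) \<theta>1 \<partial>lborel)"
  have "W = (\<integral>\<^sup>+x. ennreal (norm (v x) powr \<theta>1 * 1) \<partial>lebesgue)"
    unfolding W_def nn_integral_completion
  proof (intro nn_integral_cong_AE, use AE_u in eventually_elim)
    fix x assume vu: "ennreal (v x) = u x"
    show "epowr (u x) \<theta>1 = ennreal (norm (v x) powr \<theta>1 * 1)"
      using v0[of x] assms(7) by (simp add: vu[symmetric] epowr_ennreal)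
  qed
  then have "epowr (epowr W (1 / \<theta>1)) (\<theta>1 / r) < \<infinity>"
    using assms(10) by (simp add: weighted_Lnorm_def)
  then have "epowr W (1 / r) < \<infinity>"
    using assms(7) r by (simp add: epowr_epowr)
  then obtain w where w: "epowr W (1 / r) = ennreal w" "0 \<le> w"
    by (cases "epowr W (1 / r)") auto

  have Hoelder: "weighted_Lnorm q v \<phi>
      \<le> epowr (\<integral>\<^sup>+x. epowr (ennreal (norm (\<phi> x))) p * epowr (u x) (p / a) \<partial>lborel) (1 / p) * ennreal w"
    if \<phi>: "test_function \<phi>" for \<phi> :: "real^'d \<Rightarrow> complex"
  proof -
    have [measurable]: "\<phi> \<in> borel_measurable borel"
      using test_functionD(1)[OF \<phi>] by (rule borel_measurable_continuous_onI)
    \<comment> \<open>Hoelder with exponents p / q and r / q. The relation between q, \<theta>1 and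
      \<theta>2, multiplied by q, says that the powers (p / a) s and \<theta>1 (1 - s) of the weight
      add up to 1.\<close>
    define s where "s = q / p"
    have s: "0 < s" "s < 1" using assms(3,4) by (auto simp: s_def)
    have qr: "1 - s = q / r" using assms(6) p(3) by (simp add: s_def divide_inverse[of q r] inverse_eq_divide right_diff_distrib)
    have "q / a + \<theta>1 * (q / r) = q * (1 / q)"
      unfolding assms(9) a_def by (simp add: distrib_left)
    then have ex: "p / a * s + \<theta>1 * (1 - s) = 1" using p by (simp add: qr) (simp add: s_def)
    have I: "(\<integral>\<^sup>+x. ennreal (norm (\<phi> x) powr q * v x) \<partial>lebesgue)
        = (\<integral>\<^sup>+x. epowr (epowr (ennreal (norm (\<phi> x))) p * epowr (u x) (p / a)) s
            * epowr (epowr (u x) \<theta>1) (1 - s) \<partial>lborel)"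
      unfolding nn_integral_completion
    proof (intro nn_integral_cong_AE, use AE_u in eventually_elim)
      fix x assume vu: "ennreal (v x) = u x"
      have "epowr (epowr (ennreal (norm (\<phi> x))) p * epowr (u x) (p / a)) s * epowr (epowr (u x) \<theta>1) (1 - s)
          = epowr (ennreal (norm (\<phi> x))) (p * s) * (epowr (u x) (p / a * s) * epowr (u x) (\<theta>1 * (1 - s)))"
        using p s assms(7) by (simp add: epowr_mult epowr_epowr mult.assoc)
      also have "epowr (u x) (p / a * s) * epowr (u x) (\<theta>1 * (1 - s)) = u x"
        using p s assms(7) ex by (subst epowr_add[symmetric]) auto
      also have "p * s = q" using p by (simp add: s_def)
      finally show "ennreal (norm (\<phi> x) powr q * v x) = epowr (epowr (ennreal (norm (\<phi> x))) p * epowr (u x) (p / a)) s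
          * epowr (epowr (u x) \<theta>1) (1 - s)"
        using v0[of x] p by (simp add: vu[symmetric] epowr_ennreal ennreal_mult)
    qed
    have "(\<integral>\<^sup>+x. ennreal (norm (\<phi> x) powr q * v x) \<partial>lebesgue)
      \<le> epowr (\<integral>\<^sup>+x. epowr (ennreal (norm (\<phi> x))) p * epowr (u x) (p / a) \<partial>lborel) s * epowr W (1 - s)"
      unfolding I W_def by (rule nn_integral_Hoelder) (use s in auto)
    then have "weighted_Lnorm q v \<phi>
      \<le> epowr (epowr (\<integral>\<^sup>+x. epowr (ennreal (norm (\<phi> x))) p * epowr (u x) (p / a) \<partial>lborel) s * epowr W (1 - s)) (1 / q)"
      unfolding weighted_Lnorm_def using p by (intro epowr_mono) auto
    also have "\<dots> = epowr (\<integral>\<^sup>+x. epowr (ennreal (norm (\<phi> x))) p * epowr (u x) (p / a) \<partial>lborel) (1 / p) * epowr W (1 / r)"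
    proof -
      have "s * (1 / q) = 1 / p" "(1 - s) * (1 / q) = 1 / r" using p by (simp add: s_def, simp add: qr)
      then show ?thesis using s p by (simp only: epowr_mult epowr_epowr divide_pos_pos zero_less_one diff_gt_0_iff_gt)
    qed
    finally show ?thesis by (simp add: w)
  qed

  obtain c where c: "0 < c" and trace: "\<And>(v::real^'d \<Rightarrow> ennreal) M \<delta>. v \<in> borel_measurable borel \<Longrightarrow> 0 < M \<Longrightarrow> 0 < \<delta> \<Longrightarrow>
    (\<forall>c l. 0 < l \<longrightarrow> l \<le> \<delta> \<longrightarrow> (\<integral>\<^sup>+y. indicator (cube c l) y * v y \<partial>lborel)
      \<le> ennreal ((M * l powr (- \<alpha>)) powr a) * ennreal (l ^ CARD('d))) \<Longrightarrow>
    (\<exists>C\<ge>0. \<forall>\<phi>. test_function \<phi> \<longrightarrow>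
      (\<integral>\<^sup>+x. epowr (ennreal (norm (\<phi> x))) p * epowr (v x) (p / a) \<partial>lborel)
      \<le> ennreal (c * M powr p) * (\<integral>\<^sup>+x. epowr (ennreal (norm (frac_laplacian \<alpha> \<phi> x))) p \<partial>lborel)
        + ennreal C * (\<integral>\<^sup>+x. epowr (ennreal (norm (\<phi> x))) p \<partial>lborel))"
    using trace_inequality_small_cubes[OF assms(1) p(1,2), where 'd = 'd] by blast
  have Lp: "Lnorm p f = epowr (\<integral>\<^sup>+x. epowr (ennreal (norm (f x))) p \<partial>lborel) (1 / p)" for f :: "real^'d \<Rightarrow> complex"
    using p by (simp add: weighted_Lnorm_def nn_integral_completion epowr_ennreal)

  show ?thesis
  \<comment> \<open>w comes from Hoelder and the root of c from the trace inequality. The extra 1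
    lets this common factor also dominate the coefficient of the second norm.\<close>
  proof (rule exI[of _ "w * (c powr (1 / p) + 1)"], intro conjI allI impI)
    show "0 \<le> w * (c powr (1 / p) + 1)" using w by simp
    fix \<epsilon> :: real assume \<epsilon>: "0 < \<epsilon>"
    \<comment> \<open>The trace inequality is used with M = \<epsilon>; the vanishing limit supplies
      the scale \<delta>.\<close>
    obtain \<delta> where \<delta>: "0 < \<delta>" "small_cube_sup \<alpha> (1 / a) v \<delta> \<le> ennreal \<epsilon>" using small[OF \<epsilon>] by blast
    have "(\<integral>\<^sup>+y. indicator (cube c l) y * u y \<partial>lborel) \<le> ennreal ((\<epsilon> * l powr (- \<alpha>)) powr a) * ennreal (l ^ CARD('d))"
      if l: "0 < l" "l \<le> \<delta>" for c :: "real^'d" and l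
    proof -
      have "(\<integral>\<^sup>+y. indicator (cube c l) y * u y \<partial>lborel) = (\<integral>\<^sup>+x\<in>cube c l. ennreal (v x) \<partial>lebesgue)"
        unfolding nn_integral_completion using AE_u
        by (intro nn_integral_cong_AE) (auto simp: mult.commute elim!: eventually_mono)
      then show ?thesis
        using small_cube_sup_imp_nn_integral_le[OF \<delta>(2) _ _ l, of c] p \<epsilon> by simp
    qed
    then obtain C where C: "0 \<le> C" "\<And>\<phi>. test_function \<phi> \<Longrightarrow>
      (\<integral>\<^sup>+x. epowr (ennreal (norm (\<phi> x))) p * epowr (u x) (p / a) \<partial>lborel)
      \<le> ennreal (c * \<epsilon> powr p) * (\<integral>\<^sup>+x. epowr (ennreal (norm (frac_laplacian \<alpha> \<phi> x))) p \<partial>lborel)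
        + ennreal C * (\<integral>\<^sup>+x. epowr (ennreal (norm (\<phi> x))) p \<partial>lborel)"
      using trace[OF u' \<epsilon> \<delta>(1)] by blast
    show "\<exists>C>0. \<forall>\<phi> :: real^'d \<Rightarrow> complex. test_function \<phi> \<longrightarrow> weighted_Lnorm q v \<phi> \<le>
          ennreal (w * (c powr (1 / p) + 1)) * (ennreal \<epsilon> * Lnorm p (frac_laplacian \<alpha> \<phi>) + ennreal C * Lnorm p \<phi>)"
    \<comment> \<open>The trace constant C may be 0, while a positive one is demanded; hence the
      summand 1.\<close>
    proof (intro exI[of _ "C powr (1 / p) + 1"] conjI allI impI)
      show "0 < C powr (1 / p) + 1" by (simp add: add_nonneg_pos)
      fix \<phi> :: "real^'d \<Rightarrow> complex" assume \<phi>: "test_function \<phi>"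
      let ?g = "\<integral>\<^sup>+x. epowr (ennreal (norm (frac_laplacian \<alpha> \<phi> x))) p \<partial>lborel"
      let ?f = "\<integral>\<^sup>+x. epowr (ennreal (norm (\<phi> x))) p \<partial>lborel"
      have "weighted_Lnorm q v \<phi> \<le> epowr (\<integral>\<^sup>+x. epowr (ennreal (norm (\<phi> x))) p * epowr (u x) (p / a) \<partial>lborel) (1 / p) * ennreal w"
        by (rule Hoelder[OF \<phi>])
      also have "\<dots> \<le> epowr (ennreal (c * \<epsilon> powr p) * ?g + ennreal C * ?f) (1 / p) * ennreal w"
        using p by (intro mult_right_mono epowr_mono C \<phi>) auto
      also have "\<dots> \<le> (epowr (ennreal (c * \<epsilon> powr p) * ?g) (1 / p) + epowr (ennreal C * ?f) (1 / p)) * ennreal w"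
        using p by (intro mult_right_mono epowr_subadd) auto
      also have "epowr (ennreal (c * \<epsilon> powr p) * ?g) (1 / p) = ennreal (c powr (1 / p) * \<epsilon>) * Lnorm p (frac_laplacian \<alpha> \<phi>)"
        unfolding Lp using p c \<epsilon> by (simp add: epowr_mult epowr_ennreal powr_mult powr_powr)
      also have "epowr (ennreal C * ?f) (1 / p) = ennreal (C powr (1 / p)) * Lnorm p \<phi>"
        unfolding Lp using p C by (simp add: epowr_mult epowr_ennreal)
      also have "(ennreal (c powr (1 / p) * \<epsilon>) * Lnorm p (frac_laplacian \<alpha> \<phi>) + ennreal (C powr (1 / p)) * Lnorm p \<phi>) * ennreal w
          \<le> (ennreal ((c powr (1 / p) + 1) * \<epsilon>) * Lnorm p (frac_laplacian \<alpha> \<phi>)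
            + ennreal ((c powr (1 / p) + 1) * (C powr (1 / p) + 1)) * Lnorm p \<phi>) * ennreal w"
        using \<epsilon> by (intro mult_right_mono add_mono ennreal_leI) (auto simp: algebra_simps)
      also have "\<dots> = ennreal (w * (c powr (1 / p) + 1)) *
          (ennreal \<epsilon> * Lnorm p (frac_laplacian \<alpha> \<phi>) + ennreal (C powr (1 / p) + 1) * Lnorm p \<phi>)"
      proof -
        have "ennreal ((c powr (1 / p) + 1) * \<epsilon>) = ennreal (c powr (1 / p) + 1) * ennreal \<epsilon>"
          "ennreal ((c powr (1 / p) + 1) * (C powr (1 / p) + 1)) = ennreal (c powr (1 / p) + 1) * ennreal (C powr (1 / p) + 1)"
          "ennreal (w * (c powr (1 / p) + 1)) = ennreal w * ennreal (c powr (1 / p) + 1)"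
          using \<epsilon> w by - (rule ennreal_mult; simp add: add_nonneg_nonneg)+
        then show ?thesis by (simp only: distrib_left distrib_right mult_ac)
      qed
      finally show "weighted_Lnorm q v \<phi> \<le> ennreal (w * (c powr (1 / p) + 1)) *
          (ennreal \<epsilon> * Lnorm p (frac_laplacian \<alpha> \<phi>) + ennreal (C powr (1 / p) + 1) * Lnorm p \<phi>)" .
    qed
  qed
qed

end
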